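(* Let $g_1,g_2\in L^2(\mathbb{R}^d)$ and $m\in L^\infty(\mathbb{R}^d)$. Then both the Fourier multiplier $T_m$ and the STFT multiplier $A^{g_1,g_2}_{1\otimes m}$ are well-defined linear bounded operators on $L^2(\mathbb{R}^d)$, and the equality $$A^{g_1,g_2}_{1\otimes m}=T_m\quad\text{on }L^2(\mathbb{R}^d)$$ holds if and only if $$\hat m\,\mathcal{C}_{g_1,g_2}=\hat m .$$ As a consequence, if $\hat m\,\mathcal{C}_{g_1,g_2}=\hat m$ is to hold for every $m\in L^\infty(\mathbb{R}^d)$, then necessarily $\mathcal{C}_{g_1,g_2}(t)=1$ for all $t\in\mathbb{R}^d$, and this is never the case: no $g_1,g_2\in L^2(\mathbb{R}^d)$ satisfy $\mathcal{C}_{g_1,g_2}\equiv1$.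
   Context: Fourier transform: $\mathcal{F}f(\omega)=\hat f(\omega)=\int_{\mathbb{R}^d}e^{-2\pi i t\cdot\omega}f(t)\,dt$. With $T_xf(t)=f(t-x)$, $M_\omega f(t)=e^{2\pi i t\cdot\omega}f(t)$, the short-time Fourier transform is $V_gf(x,\omega)=\langle f,M_\omega T_xg\rangle=\int f(y)\overline{g(y-x)}e^{-2\pi i y\cdot\omega}dy$. The STFT multiplier with symbol $a$ on $\mathbb{R}^{2d}$ is defined weakly by $\langle A^{g_1,g_2}_af,h\rangle=\int_{\mathbb{R}^{2d}}a\,V_{g_1}f\,\overline{V_{g_2}h}\,dx\,d\omega$, $f,h\in L^2(\mathbb{R}^d)$; $(1\otimes m)(x,\omega)=m(\omega)$. The Fourier multiplier is $T_mf=\mathcal{F}^{-1}(m\,\mathcal{F}f)$. The window correlation function is $\mathcal{C}_{g_1,g_2}=(\mathcal{I}g_2)\ast\overline{g_1}$, with $\mathcal{I}g(t)=g(-t)$; it is a continuous function. The equality $\hat m\,\mathcal{C}_{g_1,g_2}=\hat m$ is in $\mathcal{S}'(\mathbb{R}^d)$, where $\hat m\,\mathcal{C}_{g_1,g_2}:=\mathcal{F}\big(m\ast\mathcal{F}^{-1}(\mathcal{C}_{g_1,g_2})\big)$ (note $\mathcal{F}^{-1}(\mathcal{C}_{g_1,g_2})\in L^1(\mathbb{R}^d)$). *)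

theory Defs
  imports "HOL-Analysis.Analysis"
begin

section \<open>Lebesgue spaces\<close>

text \<open>
  Elements of the Lebesgue spaces are handled through Borel measurable representatives (every
  Lebesgue measurable function agrees almost everywhere with a Borel measurable one);
  \<open>L2_class u\<close> is the element of $L^2$ represented by \<open>u\<close>, so that equality of such
  sets is equality in $L^2$.
\<close>

definition L1 :: "('a::euclidean_space \<Rightarrow> complex) set" where
  "L1 = {f. integrable lborel f}"

definition L2 :: "('a::euclidean_space \<Rightarrow> complex) set" where
  "L2 = {f \<in> borel_measurable lborel. integrable lborel (\<lambda>x. (norm (f x))\<^sup>2)}"

definition Linf :: "('a::euclidean_space \<Rightarrow> complex) set" where
  "Linf = {f \<in> borel_measurable lborel. \<exists>B. AE x in lborel. norm (f x) \<le> B}"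

definition L2_norm :: "('a::euclidean_space \<Rightarrow> complex) \<Rightarrow> real" where
  "L2_norm f = sqrt (LINT x|lborel. (norm (f x))\<^sup>2)"

definition L2_inner :: "('a::euclidean_space \<Rightarrow> complex) \<Rightarrow> ('a \<Rightarrow> complex) \<Rightarrow> complex" where
  "L2_inner f h = (LINT x|lborel. f x * cnj (h x))"

definition L2_class :: "('a::euclidean_space \<Rightarrow> complex) \<Rightarrow> ('a \<Rightarrow> complex) set" where
  "L2_class u = {v \<in> L2. AE x in lborel. v x = u x}"

text \<open>
  The Bochner integral of a non-integrable function is 0, hence the membership conditions.
\<close>

definition L2_tendsto :: "(nat \<Rightarrow> 'a::euclidean_space \<Rightarrow> complex) \<Rightarrow> ('a \<Rightarrow> complex) \<Rightarrow> bool" where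
  "L2_tendsto F f \<longleftrightarrow>
     (\<forall>n. F n \<in> L2) \<and> f \<in> L2 \<and> (\<lambda>n. L2_norm (\<lambda>x. F n x - f x)) \<longlonglongrightarrow> 0"

text \<open>
  A map \<open>A\<close> from representatives to $L^2$-classes is a (well-defined) bounded linear operator
  on $L^2$: each value is a single $L^2$-class, and it depends only on the class of the argument.
\<close>

definition bounded_linear_operator_L2 ::
    "(('a::euclidean_space \<Rightarrow> complex) \<Rightarrow> ('a \<Rightarrow> complex) set) \<Rightarrow> bool" where
  "bounded_linear_operator_L2 A \<longleftrightarrow>
     (\<forall>f\<in>L2. \<exists>u\<in>L2. A f = L2_class u) \<and>
     (\<forall>f\<in>L2. \<forall>f'\<in>L2_class f. A f' = A f) \<and>
     (\<forall>f\<in>L2. \<forall>h\<in>L2. \<forall>u\<in>A f. \<forall>v\<in>A h. \<forall>c d.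
        (\<lambda>x. c * u x + d * v x) \<in> A (\<lambda>x. c * f x + d * h x)) \<and>
     (\<exists>B. \<forall>f\<in>L2. \<forall>u\<in>A f. L2_norm u \<le> B * L2_norm f)"


section \<open>Fourier transform and Fourier multipliers\<close>

definition fourier :: "('a::euclidean_space \<Rightarrow> complex) \<Rightarrow> 'a \<Rightarrow> complex" where
  "fourier f \<omega> = (LINT t|lborel. exp (- 2 * of_real pi * \<i> * of_real (t \<bullet> \<omega>)) * f t)"

definition inv_fourier :: "('a::euclidean_space \<Rightarrow> complex) \<Rightarrow> 'a \<Rightarrow> complex" where
  "inv_fourier f t = (LINT \<omega>|lborel. exp (2 * of_real pi * \<i> * of_real (t \<bullet> \<omega>)) * f \<omega>)"

text \<open>
  The $L^2$ Fourier transform (and its inverse) is the continuous extension of the integral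
  formula from $L^1 \cap L^2$.
\<close>

definition L2_fourier :: "('a::euclidean_space \<Rightarrow> complex) \<Rightarrow> ('a \<Rightarrow> complex) set" where
  "L2_fourier f =
     {h. \<exists>F. (\<forall>n. F n \<in> L1) \<and> L2_tendsto F f \<and> L2_tendsto (\<lambda>n. fourier (F n)) h}"

definition L2_inv_fourier :: "('a::euclidean_space \<Rightarrow> complex) \<Rightarrow> ('a \<Rightarrow> complex) set" where
  "L2_inv_fourier f =
     {h. \<exists>F. (\<forall>n. F n \<in> L1) \<and> L2_tendsto F f \<and> L2_tendsto (\<lambda>n. inv_fourier (F n)) h}"

definition fourier_multiplier ::
    "('a::euclidean_space \<Rightarrow> complex) \<Rightarrow> ('a \<Rightarrow> complex) \<Rightarrow> ('a \<Rightarrow> complex) set" where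
  "fourier_multiplier m f = (\<Union>h\<in>L2_fourier f. L2_inv_fourier (\<lambda>\<omega>. m \<omega> * h \<omega>))"


section \<open>Short-time Fourier transform and STFT multipliers\<close>

definition translation :: "'a::euclidean_space \<Rightarrow> ('a \<Rightarrow> complex) \<Rightarrow> 'a \<Rightarrow> complex" where
  "translation x f t = f (t - x)"

definition modulation :: "'a::euclidean_space \<Rightarrow> ('a \<Rightarrow> complex) \<Rightarrow> 'a \<Rightarrow> complex" where
  "modulation \<omega> f t = exp (2 * of_real pi * \<i> * of_real (t \<bullet> \<omega>)) * f t"

definition stft ::
    "('a::euclidean_space \<Rightarrow> complex) \<Rightarrow> ('a \<Rightarrow> complex) \<Rightarrow> 'a \<times> 'a \<Rightarrow> complex" where
  "stft g f = (\<lambda>(x, \<omega>). L2_inner f (modulation \<omega> (translation x g)))"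

definition stft_multiplier ::
    "('a::euclidean_space \<Rightarrow> complex) \<Rightarrow> ('a \<Rightarrow> complex) \<Rightarrow> ('a \<times> 'a \<Rightarrow> complex)
      \<Rightarrow> ('a \<Rightarrow> complex) \<Rightarrow> ('a \<Rightarrow> complex) set" where
  "stft_multiplier g1 g2 a f =
     {u \<in> L2. \<forall>h\<in>L2.
        integrable lborel (\<lambda>z. a z * stft g1 f z * cnj (stft g2 h z)) \<and>
        L2_inner u h = (LINT z|lborel. a z * stft g1 f z * cnj (stft g2 h z))}"

definition one_tensor :: "('a \<Rightarrow> complex) \<Rightarrow> 'a \<times> 'a \<Rightarrow> complex" where
  "one_tensor m = (\<lambda>(x, \<omega>). m \<omega>)"

definition convolution ::
    "('a::euclidean_space \<Rightarrow> complex) \<Rightarrow> ('a \<Rightarrow> complex) \<Rightarrow> 'a \<Rightarrow> complex" where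
  "convolution f g x = (LINT y|lborel. f y * g (x - y))"

definition window_correlation ::
    "('a::euclidean_space \<Rightarrow> complex) \<Rightarrow> ('a \<Rightarrow> complex) \<Rightarrow> 'a \<Rightarrow> complex" where
  "window_correlation g1 g2 = convolution (\<lambda>t. g2 (- t)) (\<lambda>t. cnj (g1 t))"


section \<open>Tempered distributions\<close>

definition partial :: "'a::euclidean_space \<Rightarrow> ('a \<Rightarrow> complex) \<Rightarrow> 'a \<Rightarrow> complex" where
  "partial b \<phi> x = frechet_derivative \<phi> (at x) b"

definition schwartz :: "('a::euclidean_space \<Rightarrow> complex) set" where
  "schwartz = {\<phi>. \<forall>bs. set bs \<subseteq> Basis \<longrightarrow>
     (\<forall>x. foldr partial bs \<phi> differentiable (at x)) \<and>
     (\<forall>k. \<exists>B. \<forall>x. norm x ^ k * norm (foldr partial bs \<phi> x) \<le> B)}"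

text \<open>
  Distributions are functionals of which only the values on Schwartz functions matter
  (\<open>distr_eq\<close> is equality in $\mathcal{S}'$). Everything below is applied only to bounded
  measurable or integrable functions, for which \<open>distr_of\<close> is indeed tempered. The pairing is
  bilinear.
\<close>

type_synonym 'a distr = "('a \<Rightarrow> complex) \<Rightarrow> complex"

definition distr_of :: "('a::euclidean_space \<Rightarrow> complex) \<Rightarrow> 'a distr" where
  "distr_of f \<phi> = (LINT x|lborel. f x * \<phi> x)"

definition distr_eq :: "'a::euclidean_space distr \<Rightarrow> 'a distr \<Rightarrow> bool" where
  "distr_eq u v \<longleftrightarrow> (\<forall>\<phi>\<in>schwartz. u \<phi> = v \<phi>)"

definition distr_fourier :: "'a::euclidean_space distr \<Rightarrow> 'a distr" where
  "distr_fourier u \<phi> = u (fourier \<phi>)"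

definition distr_inv_fourier :: "'a::euclidean_space distr \<Rightarrow> 'a distr" where
  "distr_inv_fourier u \<phi> = u (inv_fourier \<phi>)"

text \<open>
  The $L^1$ function (unique up to null sets, if there is one) representing a distribution.
\<close>

definition L1_density :: "'a::euclidean_space distr \<Rightarrow> 'a \<Rightarrow> complex" where
  "L1_density u = (SOME k. k \<in> L1 \<and> distr_eq (distr_of k) u)"

text \<open>
  For a function \<open>C\<close> with $\mathcal{F}^{-1} C \in L^1$, the product $\hat m\, C$ is
  $\mathcal{F}(m \ast \mathcal{F}^{-1} C)$. For \<open>C = window_correlation g1 g2\<close> with
  \<open>g1, g2 \<in> L2\<close> this is the case, $\mathcal{F}^{-1} C$ being
  $\hat g_2\, \overline{\hat g_1}$. The choice of the representative of $\mathcal{F}^{-1} C$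
  does not affect the convolution.
\<close>

definition fourier_times ::
    "('a::euclidean_space \<Rightarrow> complex) \<Rightarrow> ('a \<Rightarrow> complex) \<Rightarrow> 'a distr" where
  "fourier_times m C =
     distr_fourier (distr_of (convolution m (L1_density (distr_inv_fourier (distr_of C)))))"

end

theory Submission
  imports Defs "HOL-Probability.Characteristic_Functions" "HOL-Probability.Sinc_Integral"
begin

text \<open>
  Put $K = \hat g_2\,\overline{\hat g_1} \in L^1$. By Parseval,
  $V_g f(x,\omega) = e^{-2\pi i x\cdot\omega}\,
    \mathcal{F}^{-1}\big(\hat f\;\overline{\hat g(\cdot-\omega)}\big)(x)$;
  applying Parseval once more in $x$ for fixed $\omega$ and then Fubini in $\omega$ shows that
  $A^{g_1,g_2}_{1\otimes m}$ is the Fourier multiplier with symbol $m \ast K$. Since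
  $m \mapsto T_m$ is injective, $A^{g_1,g_2}_{1\otimes m} = T_m$ means $m \ast K = m$ almost
  everywhere. On the other hand $\mathcal{C}_{g_1,g_2} = \mathcal{F} K$, so
  $\hat m\,\mathcal{C}_{g_1,g_2}$ is the Fourier transform of $m \ast K$, and testing with
  translated Gaussians gives the same condition. For a character $m(y) = e^{2\pi i t\cdot y}$ one
  has $m \ast K = \mathcal{C}_{g_1,g_2}(t)\,m$, which forces $\mathcal{C}_{g_1,g_2}(t) = 1$; and
  the Fourier transform of an integrable function is never constantly 1, because its averages
  against dilated Gaussians tend to 0.
\<close>

section \<open>Lebesgue integration and the space $L^2$\<close>

text \<open>\<open>L2_fourier\<close> is a set of limits, so Plancherel's theorem on L^1 \<inter>
  L^2 and completeness of L^2 have to come before any statement about T_m. The Fourier analysis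
  rests on \<open>fourier_gaussian_smoothing\<close>: an inversion integral damped by a Gaussian of
  parameter s equals an average of f over distances of order s. Together with continuity (of
  translations in L^1 or L^2, or of f itself) it yields, as s tends to 0, uniqueness in L^1,
  Plancherel's theorem and pointwise inversion. Gaussians recur because they are positive, equal
  their own transform, and turn bounded symbols into integrable functions from which they can be
  divided out again. Two obstacles shape the rest. The product of one transform with a translate of
  another lies in L^2 only for almost every \<omega>, so the STFT is analysed in slices that
  Fubini's theorem joins. And \<open>L1_density\<close> picks an arbitrary representative, so an L^1
  function must be shown to be determined by its values on Schwartz functions; that K represents the
  inverse transform of \<open>fourier K\<close> uses integrability of transforms of Schwartz
  functions, whence the decay estimates.\<close>

lemma lborel_distr_isometry:
  fixes t :: "'a::euclidean_space"
  assumes "\<bar>c\<bar> = 1"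
  shows "distr lborel borel (\<lambda>x. t + c *\<^sub>R x) = lborel"
proof -
  have "c \<noteq> 0" using assms by auto
  then show ?thesis
    using lborel_affine[of c t] assms by (simp add: density_1)
qed

text \<open>The condition on \<open>c\<close> leaves only 1 and -1, so one statement serves
  translations and reflections; the Jacobian of the affine substitution is then 1.\<close>

lemma
  fixes f :: "'a::euclidean_space \<Rightarrow> 'b::{banach, second_countable_topology}"
  assumes c: "\<bar>c\<bar> = 1" and f[measurable]: "f \<in> borel_measurable borel"
  shows integrable_lborel_isometry: "integrable lborel (\<lambda>x. f (t + c *\<^sub>R x)) = integrable lborel f"
    and integral_lborel_isometry: "(LINT x|lborel. f (t + c *\<^sub>R x)) = (LINT x|lborel. f x)"
proof -
  have m[measurable]: "(\<lambda>x. t + c *\<^sub>R x) \<in> borel_measurable borel" by simp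
  show "integrable lborel (\<lambda>x. f (t + c *\<^sub>R x)) = integrable lborel f"
    using integrable_distr_eq[of "\<lambda>x. t + c *\<^sub>R x" lborel borel f]
    by (simp add: lborel_distr_isometry[OF c])
  show "(LINT x|lborel. f (t + c *\<^sub>R x)) = (LINT x|lborel. f x)"
    using integral_distr[of "\<lambda>x. t + c *\<^sub>R x" lborel borel f]
    by (simp add: lborel_distr_isometry[OF c])
qed

lemma AE_lborel_isometry:
  fixes t :: "'a::euclidean_space"
  assumes c: "\<bar>c\<bar> = 1" and "AE x in lborel. P x"
  shows "AE x in lborel. P (t + c *\<^sub>R x)"
proof -
  have "AE x in distr lborel borel (\<lambda>x. t + c *\<^sub>R x). P x"
    using assms(2) unfolding lborel_distr_isometry[OF c] .
  from AE_distrD[OF _ this] show ?thesis by simp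
qed

lemma
  fixes f :: "'a::euclidean_space \<Rightarrow> 'b::{banach, second_countable_topology}"
  assumes f[measurable]: "f \<in> borel_measurable borel"
  shows integrable_lborel_translate: "integrable lborel (\<lambda>x. f (x - a)) = integrable lborel f"
    and integral_lborel_translate: "(LINT x|lborel. f (x - a)) = (LINT x|lborel. f x)"
    and integrable_lborel_reflect: "integrable lborel (\<lambda>x. f (a - x)) = integrable lborel f"
    and integral_lborel_reflect: "(LINT x|lborel. f (a - x)) = (LINT x|lborel. f x)"
    and integrable_lborel_uminus: "integrable lborel (\<lambda>x. f (- x)) = integrable lborel f"
    and integral_lborel_uminus: "(LINT x|lborel. f (- x)) = (LINT x|lborel. f x)"
  using integrable_lborel_isometry[of 1 f "- a"] integral_lborel_isometry[of 1 f "- a"]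
    integrable_lborel_isometry[of "-1" f a] integral_lborel_isometry[of "-1" f a]
    integrable_lborel_isometry[of "-1" f 0] integral_lborel_isometry[of "-1" f 0]
  by (simp_all add: f)

lemma integral_lborel_scale:
  fixes f :: "'a::euclidean_space \<Rightarrow> 'b::{banach, second_countable_topology}"
  assumes f[measurable]: "f \<in> borel_measurable borel" and c: "c \<noteq> 0"
  shows "(LINT x|lborel. f x) = \<bar>c\<bar> ^ DIM('a) *\<^sub>R (LINT x|lborel. f (t + c *\<^sub>R x))"
  by (subst lborel_affine[OF c, of t]) (simp add: integral_density integral_distr)

lemma integrable_lborel_scale:
  fixes f :: "'a::euclidean_space \<Rightarrow> 'b::{banach, second_countable_topology}"
  assumes f[measurable]: "f \<in> borel_measurable borel" and c: "c \<noteq> 0"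
  shows "integrable lborel (\<lambda>x. f (t + c *\<^sub>R x)) \<longleftrightarrow> integrable lborel f"
proof -
  have "integrable lborel f \<longleftrightarrow> integrable lborel (\<lambda>x. \<bar>c\<bar> ^ DIM('a) *\<^sub>R f (t + c *\<^sub>R x))"
    by (subst lborel_affine[OF c, of t], subst integrable_density) (auto simp: integrable_distr_eq)
  also have "\<dots> \<longleftrightarrow> integrable lborel (\<lambda>x. f (t + c *\<^sub>R x))"
    using c integrable_scaleR_right[of "\<bar>c\<bar> ^ DIM('a)" lborel "\<lambda>x. f (t + c *\<^sub>R x)"]
     integrable_scaleR_right[of "inverse (\<bar>c\<bar> ^ DIM('a))" lborel "\<lambda>x. \<bar>c\<bar> ^ DIM('a) *\<^sub>R f (t + c *\<^sub>R x)"]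
    by auto
  finally show ?thesis ..
qed

section \<open>Unimodular characters\<close>

text \<open>The character r \<mapsto> e^(2 pi i r). With a real argument, the exponentials of both
  signs in the transforms become \<open>chi\<close> of plus or minus an inner product, and all phase
  computations reduce to \<open>chi_add\<close>.\<close>

definition chi :: "real \<Rightarrow> complex" where
  "chi r = cis (2 * pi * r)"

lemma chi_0 [simp]: "chi 0 = 1"
  by (simp add: chi_def)

lemma norm_chi [simp]: "norm (chi r) = 1"
  by (simp add: chi_def)

lemma chi_add: "chi (r + s) = chi r * chi s"
  by (simp add: chi_def cis_mult distrib_left)

lemma cnj_chi [simp]: "cnj (chi r) = chi (- r)"
  by (simp add: chi_def cis_cnj)

lemma chi_diff: "chi (r - s) = chi r * chi (- s)"
  using chi_add[of r "- s"] by simp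

lemma chi_mult_minus [simp]: "chi r * chi (- r) = 1" "chi (- r) * chi r = 1"
  by (simp_all flip: chi_add)

lemma continuous_chi [continuous_intros]:
  "continuous_on S f \<Longrightarrow> continuous_on S (\<lambda>x. chi (f x))"
  unfolding chi_def cis_conv_exp by (intro continuous_intros)

lemma measurable_chi [measurable]: "chi \<in> borel_measurable borel"
  by (intro borel_measurable_continuous_onI continuous_chi continuous_on_id)

lemma exp_eq_chi: "exp (2 * of_real pi * \<i> * of_real r) = chi r"
  "exp (- 2 * of_real pi * \<i> * of_real r) = chi (- r)"
  by (simp_all add: chi_def cis_conv_exp algebra_simps)

lemma fourier_eq: "fourier f \<omega> = (LINT t|lborel. chi (- (t \<bullet> \<omega>)) * f t)"
  unfolding fourier_def exp_eq_chi ..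

lemma inv_fourier_eq: "inv_fourier f t = (LINT \<omega>|lborel. chi (t \<bullet> \<omega>) * f \<omega>)"
  unfolding inv_fourier_def exp_eq_chi ..

lemma modulation_eq: "modulation \<omega> f t = chi (t \<bullet> \<omega>) * f t"
  unfolding modulation_def exp_eq_chi ..

lemma measurable_cnj [measurable]: "cnj \<in> borel_measurable borel"
  by (intro borel_measurable_continuous_onI continuous_intros)

section \<open>The normed space L^2\<close>

lemma L1_measurable [measurable_dest]: "f \<in> L1 \<Longrightarrow> f \<in> borel_measurable borel"
  using borel_measurable_integrable[of lborel f] by (simp add: L1_def)

lemma L2_measurable [measurable_dest]: "f \<in> L2 \<Longrightarrow> f \<in> borel_measurable borel"
  by (simp add: L2_def)

lemma L2_iff: "f \<in> L2 \<longleftrightarrow> f \<in> borel_measurable borel \<and> integrable lborel (\<lambda>x. (norm (f x))\<^sup>2)"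
  by (simp add: L2_def)

text \<open>Lebesgue measure is not zero, so the filter of almost everywhere statements is proper.
  This shows that an essential bound is nonnegative and lets an almost everywhere identity be
  evaluated at some point.\<close>

lemma AE_lborel_ex:
  assumes "AE x in (lborel :: 'a::euclidean_space measure). P x"
  shows "\<exists>x. P x"
proof -
  have "ae_filter (lborel :: 'a measure) \<noteq> bot"
    by (simp add: ae_filter_eq_bot_iff)
  then show ?thesis using eventually_happens'[of "ae_filter lborel" P] assms by auto
qed

lemma integrable_mult_bounded:
  fixes f g :: "'a::euclidean_space \<Rightarrow> complex"
  assumes "integrable lborel f" and [measurable]: "g \<in> borel_measurable borel"
    and "AE x in lborel. norm (g x) \<le> B"
  shows "integrable lborel (\<lambda>x. g x * f x)"
proof (rule Bochner_Integration.integrable_bound)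
  show "integrable lborel (\<lambda>x. B * norm (f x))" using assms by simp
  show "(\<lambda>x. g x * f x) \<in> borel_measurable lborel"
    using borel_measurable_integrable[OF assms(1)] by measurable
  show "AE x in lborel. norm (g x * f x) \<le> norm (B * norm (f x))"
    using assms(3)
  proof eventually_elim
    case (elim x)
    then have "norm (g x) * norm (f x) \<le> B * norm (f x)" by (intro mult_right_mono) auto
    then show ?case by (simp add: norm_mult)
  qed
qed

lemma integrable_chi_mult:
  assumes "integrable lborel f" and [measurable]: "p \<in> borel_measurable borel"
  shows "integrable lborel (\<lambda>x::'a::euclidean_space. chi (p x) * f x)"
  by (rule integrable_mult_bounded[where B=1]) (use assms in auto)

lemma L2_cong_AE:
  assumes "f \<in> L2" "AE x in lborel. f x = g x" "g \<in> borel_measurable borel"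
  shows "g \<in> L2"
proof -
  have "integrable lborel (\<lambda>x. (norm (g x))\<^sup>2)"
    using assms unfolding L2_iff
    by (subst integrable_cong_AE[of _ _ "\<lambda>x. (norm (f x))\<^sup>2"]) auto
  with assms show ?thesis by (simp add: L2_iff)
qed

lemma L2_norm_cong_AE:
  assumes "f \<in> borel_measurable borel" "AE x in lborel. f x = g x" "g \<in> borel_measurable borel"
  shows "L2_norm f = L2_norm g"
  unfolding L2_norm_def using assms
  by (intro arg_cong[where f=sqrt] integral_cong_AE) auto

lemma L2_bounded_mult:
  assumes f: "f \<in> L2" and [measurable]: "g \<in> borel_measurable borel"
    and B: "AE x in lborel. norm (g x) \<le> B"
  shows "(\<lambda>x. g x * f x) \<in> L2" and "L2_norm (\<lambda>x. g x * f x) \<le> B * L2_norm f"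
proof -
  note [measurable] = L2_measurable[OF f]
  have "\<exists>x. norm (g x) \<le> B"
    using AE_lborel_ex[OF B] .
  then have "B \<ge> 0" using norm_ge_zero order_trans by blast
  have le: "AE x in lborel. (norm (g x * f x))\<^sup>2 \<le> B\<^sup>2 * (norm (f x))\<^sup>2"
    using B by eventually_elim (auto simp: norm_mult power_mult_distrib intro!: mult_right_mono power_mono)
  have i: "integrable lborel (\<lambda>x. B\<^sup>2 * (norm (f x))\<^sup>2)" using f by (simp add: L2_iff)
  have j: "integrable lborel (\<lambda>x. (norm (g x * f x))\<^sup>2)"
    by (rule Bochner_Integration.integrable_bound[OF i]) (use le in auto)
  then show "(\<lambda>x. g x * f x) \<in> L2" by (simp add: L2_iff)
  have "(LINT x|lborel. (norm (g x * f x))\<^sup>2) \<le> (LINT x|lborel. B\<^sup>2 * (norm (f x))\<^sup>2)"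
    by (rule integral_mono_AE[OF j i le])
  then have "L2_norm (\<lambda>x. g x * f x) \<le> sqrt (B\<^sup>2 * (LINT x|lborel. (norm (f x))\<^sup>2))"
    unfolding L2_norm_def by (simp add: real_sqrt_le_mono)
  also have "\<dots> = B * L2_norm f"
    using \<open>B \<ge> 0\<close> by (simp add: L2_norm_def real_sqrt_mult)
  finally show "L2_norm (\<lambda>x. g x * f x) \<le> B * L2_norm f" .
qed

lemma L2_cmult:
  assumes "f \<in> L2"
  shows "(\<lambda>x. c * f x) \<in> L2" "L2_norm (\<lambda>x. c * f x) = norm c * L2_norm f"
  using assms by (auto simp: L2_iff L2_norm_def norm_mult power_mult_distrib real_sqrt_mult)

lemma L2_cnj:
  assumes "f \<in> L2"
  shows "(\<lambda>x. cnj (f x)) \<in> L2"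
proof -
  note [measurable] = L2_measurable[OF assms]
  show ?thesis using assms by (simp add: L2_iff)
qed

lemma L2_add:
  assumes f: "f \<in> L2" and g: "g \<in> L2"
  shows "(\<lambda>x. f x + g x) \<in> L2"
proof -
  note [measurable] = L2_measurable[OF f] L2_measurable[OF g]
  have i: "integrable lborel (\<lambda>x. 2 * (norm (f x))\<^sup>2 + 2 * (norm (g x))\<^sup>2)"
    using f g by (simp add: L2_iff)
  have "(norm (f x + g x))\<^sup>2 \<le> 2 * (norm (f x))\<^sup>2 + 2 * (norm (g x))\<^sup>2" for x
  proof -
    have "(norm (f x + g x))\<^sup>2 \<le> (norm (f x) + norm (g x))\<^sup>2"
      by (intro power_mono norm_triangle_ineq) simp
    also have "\<dots> \<le> 2 * (norm (f x))\<^sup>2 + 2 * (norm (g x))\<^sup>2"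
      using sum_squares_bound[of "norm (f x)" "norm (g x)"] by (simp add: power2_sum)
    finally show ?thesis .
  qed
  then have "integrable lborel (\<lambda>x. (norm (f x + g x))\<^sup>2)"
    by (intro Bochner_Integration.integrable_bound[OF i]) auto
  then show ?thesis by (simp add: L2_iff)
qed

lemma L2_diff: "f \<in> L2 \<Longrightarrow> g \<in> L2 \<Longrightarrow> (\<lambda>x. f x - g x) \<in> L2"
  using L2_add[of f "\<lambda>x. - 1 * g x"] L2_cmult(1)[of g "- 1"] by simp

lemma L2_linear: "f \<in> L2 \<Longrightarrow> g \<in> L2 \<Longrightarrow> (\<lambda>x. c * f x + d * g x) \<in> L2"
  by (intro L2_add L2_cmult)

lemma L2_norm_nonneg [simp]: "0 \<le> L2_norm f"
  by (simp add: L2_norm_def)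

lemma L2_norm_sq: "(L2_norm f)\<^sup>2 = (LINT x|lborel. (norm (f x))\<^sup>2)"
  by (simp add: L2_norm_def)

lemma L2_mult_integrable:
  assumes f: "f \<in> L2" and g: "g \<in> L2"
  shows "integrable lborel (\<lambda>x. f x * g x)"
proof -
  note [measurable] = L2_measurable[OF f] L2_measurable[OF g]
  have i: "integrable lborel (\<lambda>x. (norm (f x))\<^sup>2 + (norm (g x))\<^sup>2)"
    using f g by (simp add: L2_iff)
  have "norm (f x * g x) \<le> (norm (f x))\<^sup>2 + (norm (g x))\<^sup>2" for x
    using sum_squares_bound[of "norm (f x)" "norm (g x)"]
      mult_nonneg_nonneg[OF norm_ge_zero[of "f x"] norm_ge_zero[of "g x"]]
    unfolding norm_mult mult.assoc by linarith
  then show ?thesis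
    by (intro Bochner_Integration.integrable_bound[OF i]) auto
qed

text \<open>The absolute values stand inside the integral because the triangle inequality and the
  absolute convergence behind Fubini's theorem in \<open>Plancherel_L1_L2\<close> use this stronger
  form.\<close>

lemma L2_Cauchy_Schwarz_norm:
  assumes f: "f \<in> L2" and g: "g \<in> L2"
  shows "(LINT x|lborel. norm (f x) * norm (g x)) \<le> L2_norm f * L2_norm g"
proof -
  note [measurable] = L2_measurable[OF f] L2_measurable[OF g]
  have i: "integrable lborel (\<lambda>x. norm (f x) * norm (g x))"
    using integrable_norm[OF L2_mult_integrable[OF f g]] by (simp add: norm_mult)
  have "(\<integral>\<^sup>+x. ennreal (norm (f x)) * ennreal (norm (g x)) \<partial>lborel)\<^sup>2
     \<le> (\<integral>\<^sup>+x. ennreal (norm (f x)) ^ 2 \<partial>lborel) * (\<integral>\<^sup>+x. ennreal (norm (g x)) ^ 2 \<partial>lborel)"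
    by (rule Cauchy_Schwarz_nn_integral) auto
  also have "(\<integral>\<^sup>+x. ennreal (norm (f x)) ^ 2 \<partial>lborel) = ennreal ((L2_norm f)\<^sup>2)"
    using f by (simp add: L2_norm_sq L2_iff nn_integral_eq_integral ennreal_power)
  also have "(\<integral>\<^sup>+x. ennreal (norm (g x)) ^ 2 \<partial>lborel) = ennreal ((L2_norm g)\<^sup>2)"
    using g by (simp add: L2_norm_sq L2_iff nn_integral_eq_integral ennreal_power)
  also have "(\<integral>\<^sup>+x. ennreal (norm (f x)) * ennreal (norm (g x)) \<partial>lborel)
      = ennreal (LINT x|lborel. norm (f x) * norm (g x))"
    using i by (simp add: nn_integral_eq_integral flip: ennreal_mult')
  finally have "(LINT x|lborel. norm (f x) * norm (g x))\<^sup>2 \<le> (L2_norm f * L2_norm g)\<^sup>2"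
    by (simp add: ennreal_power power_mult_distrib flip: ennreal_mult')
  then show ?thesis
    by (rule power2_le_imp_le) simp
qed

lemma L2_Cauchy_Schwarz:
  assumes f: "f \<in> L2" and g: "g \<in> L2"
  shows "norm (LINT x|lborel. f x * g x) \<le> L2_norm f * L2_norm g"
  using integral_norm_bound[of lborel "\<lambda>x. f x * g x"] L2_Cauchy_Schwarz_norm[OF f g]
  by (simp add: norm_mult)

lemma L2_norm_cnj [simp]: "L2_norm (\<lambda>x. cnj (f x)) = L2_norm f"
  by (simp add: L2_norm_def)

lemma L2_norm_triangle:
  assumes f: "f \<in> L2" and g: "g \<in> L2"
  shows "L2_norm (\<lambda>x. f x + g x) \<le> L2_norm f + L2_norm g"
proof (rule power2_le_imp_le)
  have i: "integrable lborel (\<lambda>x. norm (f x) * norm (g x))"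
    using integrable_norm[OF L2_mult_integrable[OF f g]] by (simp add: norm_mult)
  have "(L2_norm (\<lambda>x. f x + g x))\<^sup>2 \<le> (LINT x|lborel. (norm (f x))\<^sup>2 + (norm (g x))\<^sup>2 + 2 * (norm (f x) * norm (g x)))"
    unfolding L2_norm_sq
  proof (rule integral_mono)
    show "integrable lborel (\<lambda>x. (norm (f x + g x))\<^sup>2)" using L2_add[OF f g] by (simp add: L2_iff)
    show "integrable lborel (\<lambda>x. (norm (f x))\<^sup>2 + (norm (g x))\<^sup>2 + 2 * (norm (f x) * norm (g x)))"
      using f g i by (simp add: L2_iff)
    show "(norm (f x + g x))\<^sup>2 \<le> (norm (f x))\<^sup>2 + (norm (g x))\<^sup>2 + 2 * (norm (f x) * norm (g x))" for x
      using power_mono[OF norm_triangle_ineq[of "f x" "g x"], of 2] by (simp add: power2_sum)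
  qed
  also have "\<dots> = (L2_norm f)\<^sup>2 + (L2_norm g)\<^sup>2 + 2 * (LINT x|lborel. norm (f x) * norm (g x))"
    using f g i by (simp add: L2_iff L2_norm_sq)
  also have "\<dots> \<le> (L2_norm f + L2_norm g)\<^sup>2"
    using L2_Cauchy_Schwarz_norm[OF f g] by (simp add: power2_sum)
  finally show "(L2_norm (\<lambda>x. f x + g x))\<^sup>2 \<le> (L2_norm f + L2_norm g)\<^sup>2" .
qed simp

lemma L2_norm_minus_commute: "L2_norm (\<lambda>x. f x - g x) = L2_norm (\<lambda>x. g x - f x)"
  by (simp add: L2_norm_def norm_minus_commute)

lemma L2_norm_triangle_diff:
  assumes "f \<in> L2" "g \<in> L2" "h \<in> L2"
  shows "L2_norm (\<lambda>x. f x - h x) \<le> L2_norm (\<lambda>x. f x - g x) + L2_norm (\<lambda>x. g x - h x)"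
  using L2_norm_triangle[OF L2_diff[OF assms(1,2)] L2_diff[OF assms(2,3)]] by simp

lemma L2_norm_diff_ge:
  assumes "f \<in> L2" "g \<in> L2"
  shows "\<bar>L2_norm f - L2_norm g\<bar> \<le> L2_norm (\<lambda>x. f x - g x)"
  using L2_norm_triangle[OF L2_diff[OF assms] assms(2)] L2_norm_triangle[OF L2_diff[OF assms(2,1)] assms(1)]
    L2_norm_minus_commute[of f g] by simp

lemma L2_norm_eq_0_iff:
  assumes "f \<in> L2"
  shows "L2_norm f = 0 \<longleftrightarrow> (AE x in lborel. f x = 0)"
proof -
  have "L2_norm f = 0 \<longleftrightarrow> (AE x in lborel. (norm (f x))\<^sup>2 = 0)"
    using assms unfolding L2_norm_def by (simp add: L2_iff integral_nonneg_eq_0_iff_AE)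
  then show ?thesis by simp
qed

lemma
  assumes "f \<in> L2" "\<bar>c\<bar> = 1"
  shows L2_isometry: "(\<lambda>x. f (t + c *\<^sub>R x)) \<in> L2"
    and L2_norm_isometry: "L2_norm (\<lambda>x. f (t + c *\<^sub>R x)) = L2_norm f"
proof -
  have [measurable]: "f \<in> borel_measurable borel" using assms(1) by measurable
  note integrable_lborel_isometry[OF assms(2), of "\<lambda>x. (norm (f x))\<^sup>2" t] 
   integral_lborel_isometry[OF assms(2), of "\<lambda>x. (norm (f x))\<^sup>2" t] 
  then show "(\<lambda>x. f (t + c *\<^sub>R x)) \<in> L2" "L2_norm (\<lambda>x. f (t + c *\<^sub>R x)) = L2_norm f"
    using assms(1) by (simp_all add: L2_iff L2_norm_def)
qed

lemma
  assumes "f \<in> L2"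
  shows L2_translate: "(\<lambda>x. f (x - a)) \<in> L2"
    and L2_norm_translate: "L2_norm (\<lambda>x. f (x - a)) = L2_norm f"
    and L2_reflect: "(\<lambda>x. f (- x)) \<in> L2"
    and L2_norm_reflect: "L2_norm (\<lambda>x. f (- x)) = L2_norm f"
  using L2_isometry[OF assms, of 1 "- a"] L2_norm_isometry[OF assms, of 1 "- a"]
   L2_isometry[OF assms, of "-1" 0] L2_norm_isometry[OF assms, of "-1" 0] by simp_all

section \<open>Convergence, truncation and completeness in L^2\<close>

lemma L2_tendstoD:
  assumes "L2_tendsto F f"
  shows "F n \<in> L2" "f \<in> L2" "(\<lambda>n. L2_norm (\<lambda>x. F n x - f x)) \<longlonglongrightarrow> 0"
  using assms by (auto simp: L2_tendsto_def)

lemma L2_tendsto_bound: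
  assumes "\<And>n. F n \<in> L2" "f \<in> L2" "\<And>n. L2_norm (\<lambda>x. F n x - f x) \<le> b n" "b \<longlonglongrightarrow> 0"
  shows "L2_tendsto F f"
  unfolding L2_tendsto_def using assms
  by (auto intro!: tendsto_sandwich[OF always_eventually always_eventually tendsto_const assms(4)])

lemma L2_tendsto_const: "f \<in> L2 \<Longrightarrow> L2_tendsto (\<lambda>n. f) f"
  by (simp add: L2_tendsto_def L2_norm_def)

lemma L2_tendsto_linear:
  assumes "L2_tendsto F f" "L2_tendsto G g"
  shows "L2_tendsto (\<lambda>n x. c * F n x + d * G n x) (\<lambda>x. c * f x + d * g x)"
proof (rule L2_tendsto_bound)
  note F = L2_tendstoD[OF assms(1)] and G = L2_tendstoD[OF assms(2)]
  show "(\<lambda>x. c * F n x + d * G n x) \<in> L2" for n using F G by (intro L2_linear)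
  show "(\<lambda>x. c * f x + d * g x) \<in> L2" using F G by (intro L2_linear)
  have t: "(\<lambda>n. norm c * L2_norm (\<lambda>x. F n x - f x) + norm d * L2_norm (\<lambda>x. G n x - g x))
      \<longlonglongrightarrow> norm c * 0 + norm d * 0"
    by (intro tendsto_intros F G)
  then show "(\<lambda>n. norm c * L2_norm (\<lambda>x. F n x - f x) + norm d * L2_norm (\<lambda>x. G n x - g x)) \<longlonglongrightarrow> 0"
    by simp
  show "L2_norm (\<lambda>x. c * F n x + d * G n x - (c * f x + d * g x))
      \<le> norm c * L2_norm (\<lambda>x. F n x - f x) + norm d * L2_norm (\<lambda>x. G n x - g x)" for n
  proof -
    have d: "(\<lambda>x. F n x - f x) \<in> L2" "(\<lambda>x. G n x - g x) \<in> L2" using F G by (auto intro: L2_diff)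
    have "L2_norm (\<lambda>x. c * (F n x - f x) + d * (G n x - g x))
        \<le> norm c * L2_norm (\<lambda>x. F n x - f x) + norm d * L2_norm (\<lambda>x. G n x - g x)"
      using L2_norm_triangle[OF L2_cmult(1)[OF d(1), of c] L2_cmult(1)[OF d(2), of d]]
      by (simp add: L2_cmult(2)[OF d(1)] L2_cmult(2)[OF d(2)])
    then show ?thesis by (simp add: algebra_simps)
  qed
qed

lemma L2_tendsto_norm:
  assumes "L2_tendsto F f"
  shows "(\<lambda>n. L2_norm (F n)) \<longlonglongrightarrow> L2_norm f"
proof -
  note F = L2_tendstoD[OF assms]
  have "(\<lambda>n. L2_norm (F n) - L2_norm f) \<longlonglongrightarrow> 0"
    by (rule Lim_null_comparison[OF _ F(3)]) (simp add: L2_norm_diff_ge[OF F(1,2)])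
  then show ?thesis by (simp add: LIM_zero_iff)
qed

lemma L2_tendsto_cong_AE:
  assumes "L2_tendsto F f" "AE x in lborel. f x = g x" "g \<in> borel_measurable borel"
  shows "L2_tendsto F g"
proof -
  note F = L2_tendstoD[OF assms(1)]
  note [measurable] = L2_measurable[OF F(1)] L2_measurable[OF F(2)] assms(3)
  have "L2_norm (\<lambda>x. F n x - g x) = L2_norm (\<lambda>x. F n x - f x)" for n
    by (rule L2_norm_cong_AE) (use assms(2) in auto)
  then show ?thesis using F L2_cong_AE[OF F(2) assms(2,3)] by (simp add: L2_tendsto_def)
qed

text \<open>The difference of the products is split as (F - f) times the conjugate of G, plus f
  times the conjugate of G - g. Cauchy-Schwarz bounds both parts, and the norms of
  \<open>G n\<close> stay bounded because they converge.\<close>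

lemma L2_inner_tendsto:
  assumes "L2_tendsto F f" "L2_tendsto G g"
  shows "(\<lambda>n. L2_inner (F n) (G n)) \<longlonglongrightarrow> L2_inner f g"
proof -
  note F = L2_tendstoD[OF assms(1)] and G = L2_tendstoD[OF assms(2)]
  have "norm (L2_inner (F n) (G n) - L2_inner f g)
      \<le> L2_norm (\<lambda>x. F n x - f x) * L2_norm (G n) + L2_norm f * L2_norm (\<lambda>x. G n x - g x)" for n
  proof -
    have d: "(\<lambda>x. F n x - f x) \<in> L2" "(\<lambda>x. G n x - g x) \<in> L2" using F G by (auto intro: L2_diff)
    have "L2_inner (F n) (G n) - L2_inner f g
       = (LINT x|lborel. F n x * cnj (G n x) - f x * cnj (g x))"
      unfolding L2_inner_def
      by (rule Bochner_Integration.integral_diff[symmetric]) (intro L2_mult_integrable L2_cnj F G)+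
    also have "\<dots> = (LINT x|lborel. (F n x - f x) * cnj (G n x) + f x * cnj (G n x - g x))"
      by (simp add: algebra_simps)
    also have "\<dots> = (LINT x|lborel. (F n x - f x) * cnj (G n x)) + (LINT x|lborel. f x * cnj (G n x - g x))"
      by (rule Bochner_Integration.integral_add) (intro L2_mult_integrable L2_cnj F G d)+
    also have "norm \<dots> \<le> L2_norm (\<lambda>x. F n x - f x) * L2_norm (\<lambda>x. cnj (G n x))
        + L2_norm f * L2_norm (\<lambda>x. cnj (G n x - g x))"
      by (intro norm_triangle_mono L2_Cauchy_Schwarz L2_cnj F G d)
    finally show ?thesis by (simp only: L2_norm_cnj)
  qed
  then have le: "\<forall>\<^sub>F n in sequentially. norm (L2_inner (F n) (G n) - L2_inner f g)
      \<le> L2_norm (\<lambda>x. F n x - f x) * L2_norm (G n) + L2_norm f * L2_norm (\<lambda>x. G n x - g x)"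
    by simp
  have "(\<lambda>n. L2_norm (\<lambda>x. F n x - f x) * L2_norm (G n) + L2_norm f * L2_norm (\<lambda>x. G n x - g x))
      \<longlonglongrightarrow> 0 * L2_norm g + L2_norm f * 0"
    by (intro tendsto_intros F G L2_tendsto_norm assms)
  then have "(\<lambda>n. L2_norm (\<lambda>x. F n x - f x) * L2_norm (G n) + L2_norm f * L2_norm (\<lambda>x. G n x - g x))
      \<longlonglongrightarrow> 0" by simp
  from Lim_null_comparison[OF le this]
  show ?thesis by (simp add: LIM_zero_iff)
qed

lemma L2_dominated_convergence:
  assumes f: "f \<in> L2" and F[measurable]: "\<And>n. F n \<in> borel_measurable borel"
    and le: "\<And>n x. norm (F n x) \<le> norm (f x)"
    and lim: "\<And>x. (\<lambda>n. F n x) \<longlonglongrightarrow> f x"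
  shows "L2_tendsto F f"
proof -
  note [measurable] = L2_measurable[OF f]
  have i: "integrable lborel (\<lambda>x. 4 * (norm (f x))\<^sup>2)" using f by (simp add: L2_iff)
  have F2: "F n \<in> L2" for n
  proof -
    have "integrable lborel (\<lambda>x. (norm (F n x))\<^sup>2)"
    proof (rule Bochner_Integration.integrable_bound)
      show "integrable lborel (\<lambda>x. (norm (f x))\<^sup>2)" using f by (simp add: L2_iff)
      show "AE x in lborel. norm ((norm (F n x))\<^sup>2) \<le> norm ((norm (f x))\<^sup>2)"
      proof (intro AE_I2)
        fix x
        have "(norm (F n x))\<^sup>2 \<le> (norm (f x))\<^sup>2" by (intro power_mono le) simp
        then show "norm ((norm (F n x))\<^sup>2) \<le> norm ((norm (f x))\<^sup>2)" by simp
      qed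
    qed simp
    then show ?thesis by (simp add: L2_iff)
  qed
  have "(\<lambda>n. LINT x|lborel. (norm (F n x - f x))\<^sup>2) \<longlonglongrightarrow> (LINT x|(lborel::'a measure). 0)"
  proof (rule integral_dominated_convergence[OF _ _ i])
    show "AE x in lborel. (\<lambda>n. (norm (F n x - f x))\<^sup>2) \<longlonglongrightarrow> 0"
    proof (intro AE_I2)
      fix x
      have "(\<lambda>n. (norm (F n x - f x))\<^sup>2) \<longlonglongrightarrow> (norm (f x - f x))\<^sup>2"
        by (intro tendsto_intros lim)
      then show "(\<lambda>n. (norm (F n x - f x))\<^sup>2) \<longlonglongrightarrow> 0" by simp
    qed
    show "AE x in lborel. norm ((norm (F n x - f x))\<^sup>2) \<le> 4 * (norm (f x))\<^sup>2" for n
    proof (intro AE_I2)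
      fix x
      have "norm (F n x - f x) \<le> 2 * norm (f x)"
        using norm_triangle_ineq4[of "F n x" "f x"] le[of n x] by simp
      then have "(norm (F n x - f x))\<^sup>2 \<le> (2 * norm (f x))\<^sup>2" by (intro power_mono) auto
      then show "norm ((norm (F n x - f x))\<^sup>2) \<le> 4 * (norm (f x))\<^sup>2" by (simp add: power_mult_distrib)
    qed
  qed auto
  from tendsto_real_sqrt[OF this] show ?thesis
    by (simp add: L2_tendsto_def f F2 L2_norm_def)
qed

text \<open>Cutting off in both the argument and the value gives a bounded function of bounded
  support, hence an integrable one, that is nowhere larger than \<open>f\<close> in modulus. These
  are the elements of L^1 \<inter> L^2 from which the transform is extended.\<close>

definition truncate :: "nat \<Rightarrow> ('a::euclidean_space \<Rightarrow> complex) \<Rightarrow> 'a \<Rightarrow> complex" where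
  "truncate n f x = (if norm x \<le> real n \<and> norm (f x) \<le> real n then f x else 0)"

lemma truncate_measurable [measurable]:
  assumes [measurable]: "f \<in> borel_measurable borel"
  shows "truncate n f \<in> borel_measurable borel"
  unfolding truncate_def[abs_def] by measurable

lemma norm_truncate_le: "norm (truncate n f x) \<le> norm (f x)" "norm (truncate n f x) \<le> real n"
  by (auto simp: truncate_def)

lemma truncate_integrable:
  assumes [measurable]: "f \<in> borel_measurable borel"
  shows "integrable lborel (truncate n f)"
proof (rule integrableI_bounded_set[where A="cball 0 (real n)" and B="real n"])
  show "emeasure lborel (cball (0::'a) (real n)) < \<infinity>" by (rule emeasure_lborel_cball_finite)
  show "AE x in lborel. x \<in> cball 0 (real n) \<longrightarrow> norm (truncate n f x) \<le> real n"
    by (simp add: norm_truncate_le)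
qed (auto simp: truncate_def)

lemma truncate_tendsto: "(\<lambda>n. truncate n f x) \<longlonglongrightarrow> f x"
proof -
  obtain N where N: "max (norm x) (norm (f x)) \<le> real N" using real_arch_simple by blast
  have "\<forall>\<^sub>F n in sequentially. truncate n f x = f x"
    using eventually_ge_at_top[of N] by eventually_elim (use N in \<open>auto simp: truncate_def\<close>)
  then show ?thesis by (rule tendsto_eventually)
qed

lemma truncate_L2_tendsto:
  assumes f: "f \<in> L2"
  shows "L2_tendsto (\<lambda>n. truncate n f) f"
  by (rule L2_dominated_convergence[OF f truncate_measurable[OF L2_measurable[OF f]] norm_truncate_le(1) truncate_tendsto])

lemma L2_approx:
  assumes f: "f \<in> L2" and e: "e > 0"
  obtains n where "L2_norm (\<lambda>x. truncate n f x - f x) < e"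
  using order_tendstoD(2)[OF L2_tendstoD(3)[OF truncate_L2_tendsto[OF f]] e]
  by (auto simp: eventually_sequentially)

text \<open>The Riesz-Fischer theorem for sequences with a geometric rate. The rate makes the
  sequence itself converge almost everywhere, with no passage to a subsequence.\<close>

lemma L2_limit_exists:
  fixes F :: "nat \<Rightarrow> 'a::euclidean_space \<Rightarrow> complex"
  assumes F: "\<And>n. F n \<in> L2"
    and d: "\<And>n. L2_norm (\<lambda>x. F (Suc n) x - F n x) \<le> (1/2) ^ n"
  obtains u where "L2_tendsto F u"
proof -
  note [measurable] = L2_measurable[OF F]
  \<comment> \<open>\<open>lim\<close> is total, so \<open>u\<close> is defined and measurable
    everywhere; its value carries information only where the sequence converges.\<close>
  define u where "u x = lim (\<lambda>n. F n x)" for x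
  have u[measurable]: "u \<in> borel_measurable borel"
    unfolding u_def[abs_def] by (rule borel_measurable_lim_metric) measurable
  have nn: "(\<integral>\<^sup>+x. ennreal ((norm (g x))\<^sup>2) \<partial>lborel) = ennreal ((L2_norm g)\<^sup>2)" if "g \<in> L2" for g :: "'a \<Rightarrow> complex"
    using that by (simp add: L2_norm_sq L2_iff nn_integral_eq_integral)
  \<comment> \<open>The weights $2^n$ are harmless against the rate of convergence, and
    $d \le 2^n d^2 + 2^{-n}$ turns summability of $2^n d_n^2$ into that of $d_n$.\<close>
  have "(\<integral>\<^sup>+x. (\<Sum>n. ennreal (2 ^ n * (norm (F (Suc n) x - F n x))\<^sup>2)) \<partial>lborel)
      = (\<Sum>n. \<integral>\<^sup>+x. ennreal (2 ^ n * (norm (F (Suc n) x - F n x))\<^sup>2) \<partial>lborel)"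
    by (rule nn_integral_suminf) measurable
  also have "\<dots> \<le> (\<Sum>n. ennreal ((1/2) ^ n))"
  proof (intro suminf_le summableI)
    fix n
    have "(\<integral>\<^sup>+x. ennreal (2 ^ n * (norm (F (Suc n) x - F n x))\<^sup>2) \<partial>lborel)
      = ennreal (2 ^ n) * (\<integral>\<^sup>+x. ennreal ((norm (F (Suc n) x - F n x))\<^sup>2) \<partial>lborel)"
      by (subst nn_integral_cmult[symmetric]) (auto simp: ennreal_mult)
    also have "\<dots> = ennreal (2 ^ n * (L2_norm (\<lambda>x. F (Suc n) x - F n x))\<^sup>2)"
      by (subst nn[OF L2_diff[OF F F]]) (simp add: ennreal_mult)
    also have "\<dots> \<le> ennreal (2 ^ n * ((1/2) ^ n)\<^sup>2)"
      by (intro ennreal_leI mult_left_mono power_mono d) auto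
    also have "2 ^ n * ((1/2::real) ^ n)\<^sup>2 = (1/2) ^ n"
      by (simp add: power2_eq_square power_mult_distrib[symmetric] flip: mult.assoc)
    finally show "(\<integral>\<^sup>+x. ennreal (2 ^ n * (norm (F (Suc n) x - F n x))\<^sup>2) \<partial>lborel) \<le> ennreal ((1/2) ^ n)" .
  qed
  also have "\<dots> < \<infinity>"
    using summable_geometric[of "1/2::real"] by (simp add: suminf_ennreal2 less_top)
  finally have "AE x in lborel. (\<Sum>n. ennreal (2 ^ n * (norm (F (Suc n) x - F n x))\<^sup>2)) \<noteq> \<infinity>"
    by (intro nn_integral_PInf_AE) auto
  then have conv: "AE x in lborel. (\<lambda>n. F n x) \<longlonglongrightarrow> u x"
  proof eventually_elim
    case (elim x)
    have "summable (\<lambda>n. 2 ^ n * (norm (F (Suc n) x - F n x))\<^sup>2)"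
      using elim by (intro summable_suminf_not_top) auto
    then have s: "summable (\<lambda>n. 2 ^ n * (norm (F (Suc n) x - F n x))\<^sup>2 + (1/2) ^ n)"
      by (intro summable_add summable_geometric) auto
    have "summable (\<lambda>n. F (Suc n) x - F n x)"
    proof (rule summable_comparison_test'[OF s])
      fix n
      let ?d = "norm (F (Suc n) x - F n x)"
      have "2 * (sqrt (2 ^ n) * ?d) * sqrt ((1/2) ^ n) \<le> (sqrt (2 ^ n) * ?d)\<^sup>2 + (sqrt ((1/2) ^ n))\<^sup>2"
        by (rule sum_squares_bound)
      also have "2 * (sqrt (2 ^ n) * ?d) * sqrt ((1/2) ^ n) = 2 * ?d * sqrt (2 ^ n * (1/2) ^ n)"
        unfolding real_sqrt_mult by simp
      also have "(2::real) ^ n * (1/2) ^ n = 1" by (simp flip: power_mult_distrib)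
      also have "(sqrt (2 ^ n) * ?d)\<^sup>2 + (sqrt ((1/2) ^ n))\<^sup>2 = 2 ^ n * ?d\<^sup>2 + (1/2) ^ n"
        by (simp add: power_mult_distrib)
      finally have "2 * ?d \<le> 2 ^ n * ?d\<^sup>2 + (1/2) ^ n" by simp
      then show "?d \<le> 2 ^ n * ?d\<^sup>2 + (1/2) ^ n" by (smt (verit) norm_ge_zero)
    qed
    then have "convergent (\<lambda>n. \<Sum>i<n. F (Suc i) x - F i x)"
      by (simp add: summable_iff_convergent)
    moreover have "(\<Sum>i<n. F (Suc i) x - F i x) = F n x - F 0 x" for n
      by (rule sum_lessThan_telescope)
    ultimately have "convergent (\<lambda>n. F n x - F 0 x)" by simp
    then obtain l where "(\<lambda>n. F n x - F 0 x) \<longlonglongrightarrow> l" by (auto simp: convergent_def)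
    from tendsto_add[OF this tendsto_const[of "F 0 x"]] have "convergent (\<lambda>n. F n x)"
      by (auto simp: convergent_def)
    then show ?case by (simp add: u_def convergent_LIMSEQ_iff)
  qed
  \<comment> \<open>The right-hand side is the exact geometric sum from N to N + k - 1; keeping the
    subtracted term makes the induction close.\<close>
  have dist: "L2_norm (\<lambda>x. F (N + k) x - F N x) \<le> 2 * (1/2) ^ N - 2 * (1/2) ^ (N + k)" for N k
  proof (induction k)
    case 0
    then show ?case by (simp add: L2_norm_def)
  next
    case (Suc k)
    show ?case
      using L2_norm_triangle_diff[of "F (N + Suc k)" "F (N + k)" "F N", OF F F F] Suc d[of "N + k"] by simp
  qed
  \<comment> \<open>Fatou's lemma as k grows turns the uniform bound \<open>dist\<close> into a
    bound for the almost everywhere limit. Working with the nonnegative integral avoids presupposing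
    that \<open>u\<close> is in L^2.\<close>
  have le: "(\<integral>\<^sup>+x. ennreal ((norm (u x - F N x))\<^sup>2) \<partial>lborel) \<le> ennreal ((2 * (1/2) ^ N)\<^sup>2)" for N
  proof -
    have "(\<integral>\<^sup>+x. ennreal ((norm (u x - F N x))\<^sup>2) \<partial>lborel)
        = (\<integral>\<^sup>+x. liminf (\<lambda>k. ennreal ((norm (F (N + k) x - F N x))\<^sup>2)) \<partial>lborel)"
    proof (rule nn_integral_cong_AE)
      show "AE x in lborel. ennreal ((norm (u x - F N x))\<^sup>2)
          = liminf (\<lambda>k. ennreal ((norm (F (N + k) x - F N x))\<^sup>2))"
        using conv
      proof eventually_elim
        case (elim x)
        have "(\<lambda>k. F (N + k) x) \<longlonglongrightarrow> u x"
          using LIMSEQ_ignore_initial_segment[OF elim, of N] by (simp add: add.commute)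
        then have "(\<lambda>k. ennreal ((norm (F (N + k) x - F N x))\<^sup>2)) \<longlonglongrightarrow> ennreal ((norm (u x - F N x))\<^sup>2)"
          by (intro tendsto_intros)
        from lim_imp_Liminf[OF _ this] show ?case by simp
      qed
    qed
    also have "\<dots> \<le> liminf (\<lambda>k. \<integral>\<^sup>+x. ennreal ((norm (F (N + k) x - F N x))\<^sup>2) \<partial>lborel)"
      by (rule nn_integral_liminf) measurable
    also have "\<dots> = liminf (\<lambda>k. ennreal ((L2_norm (\<lambda>x. F (N + k) x - F N x))\<^sup>2))"
      by (subst nn[OF L2_diff[OF F F]]) simp
    also have "\<dots> \<le> ennreal ((2 * (1/2) ^ N)\<^sup>2)"
    proof (rule Liminf_le)
      show "\<forall>\<^sub>F k in sequentially. ennreal ((L2_norm (\<lambda>x. F (N + k) x - F N x))\<^sup>2) \<le> ennreal ((2 * (1/2) ^ N)\<^sup>2)"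
        by (intro always_eventually allI ennreal_leI power_mono order_trans[OF dist]) auto
    qed auto
    finally show ?thesis .
  qed
  have uF: "(\<lambda>x. u x - F N x) \<in> L2" for N
    using le[of N] unfolding L2_iff
    by (auto simp: integrable_iff_bounded intro: le_less_trans)
  have u2: "u \<in> L2" using L2_add[OF uF[of 0] F[of 0]] by simp
  have "L2_tendsto F u"
  proof (rule L2_tendsto_bound[OF F u2])
    show "(\<lambda>n. 2 * (1/2) ^ n :: real) \<longlonglongrightarrow> 0"
      by (intro tendsto_mult_right_zero LIMSEQ_power_zero) auto
    fix n
    have "(L2_norm (\<lambda>x. u x - F n x))\<^sup>2 \<le> (2 * (1/2) ^ n)\<^sup>2"
      using le[of n] unfolding nn[OF uF] by (subst (asm) ennreal_le_iff) auto
    then show "L2_norm (\<lambda>x. F n x - u x) \<le> 2 * (1/2) ^ n"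
      by (subst L2_norm_minus_commute) (rule power2_le_imp_le, simp_all)
  qed
  then show ?thesis by (rule that)
qed

section \<open>Continuity of translations\<close>

lemma L1_translation_approx:
  fixes f g :: "'a::euclidean_space \<Rightarrow> complex"
  assumes f: "integrable lborel f" and g: "integrable lborel g"
  shows "(LINT x|lborel. norm (f (x - a) - f x))
      \<le> 2 * (LINT x|lborel. norm (f x - g x)) + (LINT x|lborel. norm (g (x - a) - g x))"
proof -
  note [measurable] = borel_measurable_integrable[OF f, simplified] borel_measurable_integrable[OF g, simplified]
  have i: "integrable lborel (\<lambda>x. f (x - a))" "integrable lborel (\<lambda>x. g (x - a))"
    using f g by (simp_all add: integrable_lborel_translate)
  have "(LINT x|lborel. norm (f (x - a) - f x))
     \<le> (LINT x|lborel. norm (f (x - a) - g (x - a)) + norm (f x - g x) + norm (g (x - a) - g x))"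
  proof (rule integral_mono)
    fix x
    have "f (x - a) - f x = (f (x - a) - g (x - a)) - (f x - g x) + (g (x - a) - g x)" by simp
    then show "norm (f (x - a) - f x) \<le> norm (f (x - a) - g (x - a)) + norm (f x - g x) + norm (g (x - a) - g x)"
      by (metis (no_types, lifting) add_right_mono norm_triangle_ineq norm_triangle_ineq4 order_trans)
  qed (use f g i in \<open>auto intro!: Bochner_Integration.integrable_add integrable_norm Bochner_Integration.integrable_diff\<close>)
  also have "\<dots> = (LINT x|lborel. norm (f (x - a) - g (x - a))) + (LINT x|lborel. norm (f x - g x))
       + (LINT x|lborel. norm (g (x - a) - g x))"
    using f g i by simp
  also have "(LINT x|lborel. norm (f (x - a) - g (x - a))) = (LINT x|lborel. norm (f x - g x))"
    using integral_lborel_translate[of "\<lambda>x. norm (f x - g x)" a] by simp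
  finally show ?thesis by simp
qed

text \<open>The functions whose translates depend continuously on the shift form an L^1-closed set:
  translations are isometries, so the approximation error enters uniformly in the shift, namely
  twice.\<close>

lemma L1_translation_limit:
  fixes f :: "'a::euclidean_space \<Rightarrow> complex"
  assumes f: "integrable lborel f"
    and g: "\<And>e. e > 0 \<Longrightarrow> \<exists>g. integrable lborel g \<and> (LINT x|lborel. norm (f x - g x)) < e \<and>
      (\<lambda>n. LINT x|lborel. norm (g (x - a n) - g x)) \<longlonglongrightarrow> 0"
  shows "(\<lambda>n. LINT x|lborel. norm (f (x - a n) - f x)) \<longlonglongrightarrow> 0"
proof (rule LIMSEQ_I)
  fix e :: real assume e: "e > 0"
  obtain g where g: "integrable lborel g" "(LINT x|lborel. norm (f x - g x)) < e / 4"
      "(\<lambda>n. LINT x|lborel. norm (g (x - a n) - g x)) \<longlonglongrightarrow> 0"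
    using g[of "e/4"] e by auto
  have "\<forall>\<^sub>F n in sequentially. (LINT x|lborel. norm (g (x - a n) - g x)) < e / 2"
    using order_tendstoD(2)[OF g(3), of "e/2"] e by simp
  then have "\<forall>\<^sub>F n in sequentially. (LINT x|lborel. norm (f (x - a n) - f x)) < e"
  proof eventually_elim
    case (elim n)
    then show ?case using L1_translation_approx[OF f g(1), of "a n"] g(2) by linarith
  qed
  then show "\<exists>no. \<forall>n\<ge>no. norm ((LINT x|lborel. norm (f (x - a n) - f x)) - 0) < e"
    by (auto simp: eventually_sequentially)
qed

lemma L1_translation_indicator_open:
  fixes U :: "'a::euclidean_space set"
  assumes U: "open U" "emeasure lborel U < \<infinity>" and a: "a \<longlonglongrightarrow> 0"
  shows "(\<lambda>n. LINT x|lborel. \<bar>indicator U (x - a n) - indicator U x :: real\<bar>) \<longlonglongrightarrow> 0"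
proof -
  have [measurable]: "U \<in> sets borel" using U(1) by simp
  have i: "integrable lborel (indicator U :: 'a \<Rightarrow> real)" using U by simp
  have i': "integrable lborel (\<lambda>x. indicator U (x - b) :: real)" for b
    using i by (simp add: integrable_lborel_translate)
  \<comment> \<open>Both indicators have the same integral, so their distance is twice the integral of the
    positive part, which converges pointwise to 0 since \<open>U\<close> is open.\<close>
  have eq: "(LINT x|lborel. \<bar>indicator U (x - b) - indicator U x :: real\<bar>)
      = 2 * (LINT x|lborel. max 0 (indicator U x - indicator U (x - b)))" for b
  proof -
    have m: "integrable lborel (\<lambda>x. max 0 (indicator U x - indicator U (x - b)) :: real)"
      by (intro integrable_max Bochner_Integration.integrable_diff i i') auto
    have "(LINT x|lborel. \<bar>indicator U (x - b) - indicator U x :: real\<bar>)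
        = (LINT x|lborel. 2 * max 0 (indicator U x - indicator U (x - b)) + (indicator U (x - b) - indicator U x))"
      by (intro Bochner_Integration.integral_cong) (auto split: split_indicator)
    also have "\<dots> = 2 * (LINT x|lborel. max 0 (indicator U x - indicator U (x - b)))
        + ((LINT x|lborel. indicator U (x - b)) - (LINT x|lborel. indicator U x))"
      using i i' m by simp
    also have "(LINT x|lborel. indicator U (x - b)) = (LINT x|lborel. indicator U x :: real)"
      by (rule integral_lborel_translate) simp
    finally show ?thesis by simp
  qed
  have "(\<lambda>n. LINT x|lborel. max 0 (indicator U x - indicator U (x - a n)))
     \<longlonglongrightarrow> (LINT x|(lborel::'a measure). (0::real))"
  proof (rule integral_dominated_convergence[OF _ _ i])
    show "AE x in lborel. (\<lambda>n. max 0 (indicator U x - indicator U (x - a n)) :: real) \<longlonglongrightarrow> 0"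
    proof (intro AE_I2)
      fix x
      show "(\<lambda>n. max 0 (indicator U x - indicator U (x - a n)) :: real) \<longlonglongrightarrow> 0"
      proof (cases "x \<in> U")
        case True
        have "(\<lambda>n. x - a n) \<longlonglongrightarrow> x - 0" by (intro tendsto_intros a)
        then have "\<forall>\<^sub>F n in sequentially. x - a n \<in> U"
          using U(1) True by (auto dest: topological_tendstoD)
        then have "\<forall>\<^sub>F n in sequentially. max 0 (indicator U x - indicator U (x - a n)) = (0::real)"
          by eventually_elim (simp add: True)
        then show ?thesis by (rule tendsto_eventually)
      next
        case False
        then have "max 0 (indicator U x - indicator U (x - a n)) = (0::real)" for n
            by (simp split: split_indicator)
          then show ?thesis by simp
      qed
    qed
  qed (auto split: split_indicator)
  then show ?thesis unfolding eq by (intro tendsto_mult_right_zero) simp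
qed

text \<open>The induction runs over indicators, sums and dominated pointwise limits. Indicators are
  handled by passing to a slightly larger open set, where pointwise convergence is
  available.\<close>

lemma L1_translation_continuous:
  fixes f :: "'a::euclidean_space \<Rightarrow> complex"
  assumes f: "integrable lborel f" and a: "a \<longlonglongrightarrow> 0"
  shows "(\<lambda>n. LINT x|lborel. norm (f (x - a n) - f x)) \<longlonglongrightarrow> 0"
  using f
proof (induct rule: integrable_induct)
  case (base A c)
  have A[measurable]: "A \<in> sets borel" using base by simp
  have iA: "integrable lborel (\<lambda>x. indicator A x *\<^sub>R c)" using base by simp
  show ?case
  proof (rule L1_translation_limit[OF iA])
    fix e :: real assume e: "e > 0"
    \<comment> \<open>The denominator is \<open>norm c + 1\<close> because \<open>c\<close> may be
      0.\<close>
    obtain U where U: "open U" "A \<subseteq> U" "emeasure lborel (U - A) < ennreal (e / (norm c + 1))"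
      using outer_regular_lborel[OF A, of "e / (norm c + 1)"] e
      by (metis add_nonneg_pos divide_pos_pos norm_ge_zero zero_less_one)
    have [measurable]: "U \<in> sets borel" using U(1) by simp
    have fUA: "emeasure lborel (U - A) < \<infinity>" using U(3) by (metis ennreal_less_top less_trans infinity_ennreal_def)
    have "emeasure lborel U = emeasure lborel A + emeasure lborel (U - A)"
      using plus_emeasure[of A lborel "U - A"] U(2) by (simp add: Un_absorb1 Un_Diff_cancel)
    then have fU: "emeasure lborel U < \<infinity>" using base fUA by simp
    have "measure lborel (U - A) < e / (norm c + 1)"
      using U(3) fUA e by (simp add: emeasure_eq_ennreal_measure ennreal_less_iff)
    then have "norm c * measure lborel (U - A) < e"
    proof -
      assume m: "measure lborel (U - A) < e / (norm c + 1)"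
      have "norm c * measure lborel (U - A) \<le> (norm c + 1) * measure lborel (U - A)"
        by (intro mult_right_mono) auto
      also have "\<dots> < e" using m by (simp add: field_simps add_pos_nonneg pos_less_divide_eq)
      finally show ?thesis .
    qed
    moreover have "(LINT x|lborel. norm (indicator A x *\<^sub>R c - indicator U x *\<^sub>R c)) = norm c * measure lborel (U - A)"
    proof -
      have "(LINT x|lborel. norm (indicator A x *\<^sub>R c - indicator U x *\<^sub>R c))
          = (LINT x|lborel. norm c * indicator (U - A) x)"
        by (intro Bochner_Integration.integral_cong) (use U(2) in \<open>auto split: split_indicator\<close>)
      also have "\<dots> = norm c * measure lborel (U - A)"
        by simp
      finally show ?thesis .
    qed
    moreover have "(\<lambda>n. LINT x|lborel. norm (indicator U (x - a n) *\<^sub>R c - indicator U x *\<^sub>R c)) \<longlonglongrightarrow> 0"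
    proof -
      have "(\<lambda>n. norm c * (LINT x|lborel. \<bar>indicator U (x - a n) - indicator U x :: real\<bar>)) \<longlonglongrightarrow> 0"
        by (intro tendsto_mult_right_zero L1_translation_indicator_open U fU a)
      moreover have "(LINT x|lborel. norm (indicator U (x - b) *\<^sub>R c - indicator U x *\<^sub>R c))
         = norm c * (LINT x|lborel. \<bar>indicator U (x - b) - indicator U x :: real\<bar>)" for b
        by (subst integral_mult_right_zero[symmetric], intro Bochner_Integration.integral_cong)
          (auto simp flip: scaleR_diff_left)
      ultimately show ?thesis by simp
    qed
    moreover have "integrable lborel (\<lambda>x. indicator U x *\<^sub>R c)" using fU by simp
    ultimately show "\<exists>g. integrable lborel g \<and> (LINT x|lborel. norm (indicator A x *\<^sub>R c - g x)) < e \<and>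
       (\<lambda>n. LINT x|lborel. norm (g (x - a n) - g x)) \<longlonglongrightarrow> 0"
      by (intro exI[of _ "\<lambda>x. indicator U x *\<^sub>R c"]) auto
  qed
next
  case (add f g)
  note [measurable] = borel_measurable_integrable[OF add(1), simplified] borel_measurable_integrable[OF add(3), simplified]
  have i: "integrable lborel (\<lambda>x. f (x - b))" "integrable lborel (\<lambda>x. g (x - b))" for b
    using add(1,3) by (simp_all add: integrable_lborel_translate)
  have le: "(LINT x|lborel. norm (f (x - b) + g (x - b) - (f x + g x)))
     \<le> (LINT x|lborel. norm (f (x - b) - f x)) + (LINT x|lborel. norm (g (x - b) - g x))" for b
  proof -
    have "(LINT x|lborel. norm (f (x - b) + g (x - b) - (f x + g x)))
       \<le> (LINT x|lborel. norm (f (x - b) - f x) + norm (g (x - b) - g x))"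
      by (rule integral_mono)
       (use add(1,3) i[of b] norm_triangle_ineq[of "f (_ - b) - f _" "g (_ - b) - g _"] in \<open>auto simp: norm_diff_triangle_ineq\<close>)
    also have "\<dots> = (LINT x|lborel. norm (f (x - b) - f x)) + (LINT x|lborel. norm (g (x - b) - g x))"
      using add(1,3) i[of b] by simp
    finally show ?thesis .
  qed
  have "(\<lambda>n. (LINT x|lborel. norm (f (x - a n) - f x)) + (LINT x|lborel. norm (g (x - a n) - g x))) \<longlonglongrightarrow> 0 + 0"
    by (intro tendsto_add add(2,4))
  then have s: "(\<lambda>n. (LINT x|lborel. norm (f (x - a n) - f x)) + (LINT x|lborel. norm (g (x - a n) - g x))) \<longlonglongrightarrow> 0"
    by simp
  show ?case
    by (rule Lim_null_comparison[OF always_eventually s]) (simp add: le)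
next
  case (lim f s)
  note [measurable] = borel_measurable_integrable[OF lim(1), simplified] borel_measurable_integrable[OF lim(5), simplified]
  \<comment> \<open>The approximants of the induction rule satisfy |s| \<le> 2 |f|, which gives the
    majorant 3 |f|.\<close>
  have t: "(\<lambda>i. LINT x|lborel. norm (f x - s i x)) \<longlonglongrightarrow> (LINT x|(lborel::'a measure). (0::real))"
  proof (rule integral_dominated_convergence[where w="\<lambda>x. 3 * norm (f x)"])
    show "AE x in lborel. (\<lambda>i. norm (f x - s i x)) \<longlonglongrightarrow> 0"
    proof (intro AE_I2)
      fix x
      have "(\<lambda>i. norm (f x - s i x)) \<longlonglongrightarrow> norm (f x - f x)"
        by (intro tendsto_intros lim(3)) auto
      then show "(\<lambda>i. norm (f x - s i x)) \<longlonglongrightarrow> 0" by simp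
    qed
    show "AE x in lborel. norm (norm (f x - s i x)) \<le> 3 * norm (f x)" for i
    proof (intro AE_I2)
      fix x
      show "norm (norm (f x - s i x)) \<le> 3 * norm (f x)"
        using norm_triangle_ineq4[of "f x" "s i x"] lim(4)[of x i] by simp
    qed
  qed (use lim in auto)
  show ?case
  proof (rule L1_translation_limit[OF lim(5)])
    fix e :: real assume "e > 0"
    with order_tendstoD(2)[OF t, of e] obtain i where "(LINT x|lborel. norm (f x - s i x)) < e"
      by (auto simp: eventually_sequentially)
    then show "\<exists>g. integrable lborel g \<and> (LINT x|lborel. norm (f x - g x)) < e \<and>
        (\<lambda>n. LINT x|lborel. norm (g (x - a n) - g x)) \<longlonglongrightarrow> 0"
      using lim(1,2) by (intro exI[of _ "s i"]) auto
  qed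
qed

text \<open>Reduction to L^1: if |g| \<le> k, the square of a difference of values of g is at most 2
  k times its modulus. Truncating \<open>f\<close> supplies such a g within e/4, and the error is
  spent as e/4 + e/2 + e/4.\<close>

lemma L2_translation_continuous:
  assumes f: "f \<in> L2" and a: "a \<longlonglongrightarrow> 0"
  shows "L2_tendsto (\<lambda>n x. f (x - a n)) f"
proof -
  have "(\<lambda>n. L2_norm (\<lambda>x. f (x - a n) - f x)) \<longlonglongrightarrow> 0"
  proof (rule LIMSEQ_I)
    fix e :: real assume e: "e > 0"
    obtain k where k: "L2_norm (\<lambda>x. truncate k f x - f x) < e / 4"
      using L2_approx[OF f, of "e/4"] e by auto
    define g where "g = truncate k f"
    have [measurable]: "f \<in> borel_measurable borel" using f by measurable
    have ig: "integrable lborel g" unfolding g_def by (intro truncate_integrable) simp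
    have g2: "g \<in> L2" unfolding g_def by (rule L2_tendstoD(1)[OF truncate_L2_tendsto[OF f]])
    have gk: "norm (g x) \<le> k" for x unfolding g_def by (rule norm_truncate_le)
    note [measurable] = L2_measurable[OF g2]
    have sq: "(L2_norm (\<lambda>x. g (x - b) - g x))\<^sup>2 \<le> 2 * real k * (LINT x|lborel. norm (g (x - b) - g x))" for b
    proof -
      have i: "integrable lborel (\<lambda>x. norm (g (x - b) - g x))"
        using ig by (intro integrable_norm Bochner_Integration.integrable_diff) (simp_all add: integrable_lborel_translate)
      have "(L2_norm (\<lambda>x. g (x - b) - g x))\<^sup>2 \<le> (LINT x|lborel. 2 * real k * norm (g (x - b) - g x))"
        unfolding L2_norm_sq
      proof (rule integral_mono)
        show "integrable lborel (\<lambda>x. (norm (g (x - b) - g x))\<^sup>2)"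
          using L2_diff[OF L2_translate[OF g2] g2, of b] by (simp add: L2_iff)
        show "integrable lborel (\<lambda>x. 2 * real k * norm (g (x - b) - g x))" using i by simp
        show "(norm (g (x - b) - g x))\<^sup>2 \<le> 2 * real k * norm (g (x - b) - g x)" for x
          unfolding power2_eq_square
          by (intro mult_right_mono) (use norm_triangle_ineq4[of "g (x - b)" "g x"] gk[of x] gk[of "x - b"] in auto)
      qed
      then show ?thesis by simp
    qed
    have "(\<lambda>n. 2 * real k * (LINT x|lborel. norm (g (x - a n) - g x))) \<longlonglongrightarrow> 0"
      by (intro tendsto_mult_right_zero L1_translation_continuous ig a)
    then have "\<forall>\<^sub>F n in sequentially. 2 * real k * (LINT x|lborel. norm (g (x - a n) - g x)) < (e/2)\<^sup>2"
      using e by (intro order_tendstoD(2)) auto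
    then have "\<forall>\<^sub>F n in sequentially. L2_norm (\<lambda>x. f (x - a n) - f x) < e"
    proof eventually_elim
      case (elim n)
      have "(L2_norm (\<lambda>x. g (x - a n) - g x))\<^sup>2 < (e/2)\<^sup>2" using sq[of "a n"] elim by simp
      then have gn: "L2_norm (\<lambda>x. g (x - a n) - g x) < e / 2" by (rule power2_less_imp_less) (use e in simp)
      have 1: "L2_norm (\<lambda>x. f (x - a n) - g (x - a n)) < e / 4"
        using L2_norm_translate[OF L2_diff[OF f g2], of "a n"] k
        by (simp add: g_def L2_norm_minus_commute[of f])
      have "L2_norm (\<lambda>x. f (x - a n) - f x)
          \<le> L2_norm (\<lambda>x. f (x - a n) - g (x - a n)) + L2_norm (\<lambda>x. g (x - a n) - f x)"
        by (rule L2_norm_triangle_diff) (intro L2_translate f g2)+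
      also have "L2_norm (\<lambda>x. g (x - a n) - f x)
          \<le> L2_norm (\<lambda>x. g (x - a n) - g x) + L2_norm (\<lambda>x. g x - f x)"
        by (rule L2_norm_triangle_diff) (intro L2_translate f g2)+
      finally show ?case using 1 gn k by (simp add: g_def)
    qed
    then show "\<exists>no. \<forall>n\<ge>no. norm (L2_norm (\<lambda>x. f (x - a n) - f x) - 0) < e"
      by (auto simp: eventually_sequentially)
  qed
  then show ?thesis using L2_translate[OF f] f by (simp add: L2_tendsto_def)
qed

section \<open>Gaussians and Plancherel's theorem\<close>

text \<open>The factor pi in the exponent gives integral 1 and, for the present normalisation of the
  transform, makes the function its own Fourier transform.\<close>

definition gaussian :: "'a::euclidean_space \<Rightarrow> real" where
  "gaussian x = exp (- pi * (norm x)\<^sup>2)"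

lemma gaussian_pos [simp]: "0 < gaussian x"
  by (simp add: gaussian_def)

lemma gaussian_nonneg [simp]: "0 \<le> gaussian x"
  by (simp add: less_imp_le)

lemma gaussian_le_1: "gaussian x \<le> 1"
  by (simp add: gaussian_def)

lemma gaussian_measurable [measurable]: "gaussian \<in> borel_measurable borel"
  unfolding gaussian_def[abs_def] by measurable

text \<open>\<open>lborel\<close> is the image of the product of one-dimensional measures under the
  coordinate map, so integrals of products of coordinate functions factor. Gaussians and
  \<open>decay_weight\<close> are both reduced to the line in this way.\<close>

lemma
  fixes f :: "'a::euclidean_space \<Rightarrow> real \<Rightarrow> 'b::{real_normed_field, banach, second_countable_topology}"
  assumes f: "\<And>b. b \<in> Basis \<Longrightarrow> integrable lborel (f b)"
  shows integrable_lborel_Basis_prod: "integrable lborel (\<lambda>x. \<Prod>b\<in>Basis. f b (x \<bullet> b))"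
    and integral_lborel_Basis_prod:
      "(LINT x|lborel. (\<Prod>b\<in>Basis. f b (x \<bullet> b))) = (\<Prod>b\<in>Basis. LINT y|lborel. f b y)"
proof -
  interpret product_sigma_finite "\<lambda>_::'a. lborel :: real measure" ..
  have [measurable]: "f b \<in> borel_measurable borel" if "b \<in> Basis" for b
    using borel_measurable_integrable[OF f[OF that]] by simp
  have m: "(\<lambda>x::'a. \<Prod>b\<in>Basis. f b (x \<bullet> b)) \<in> borel_measurable borel"
    by measurable
  have T: "(\<lambda>f. \<Sum>b\<in>Basis. f b *\<^sub>R (b::'a)) \<in> (\<Pi>\<^sub>M b\<in>Basis. lborel) \<rightarrow>\<^sub>M borel"
    by measurable
  have eq: "(\<Prod>b\<in>Basis. f b ((\<Sum>b\<in>Basis. y b *\<^sub>R (b::'a)) \<bullet> b)) = (\<Prod>b\<in>Basis. f b (y b))" for y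
    by (rule prod.cong) (simp_all add: inner_sum_left_Basis)
  show "integrable lborel (\<lambda>x. \<Prod>b\<in>Basis. f b (x \<bullet> b))"
    unfolding lborel_eq[where 'a='a] integrable_distr_eq[OF T m] eq
    using product_integrable_prod[of "Basis :: 'a set" f] f by simp
  show "(LINT x|lborel. (\<Prod>b\<in>Basis. f b (x \<bullet> b))) = (\<Prod>b\<in>Basis. LINT y|lborel. f b y)"
    unfolding lborel_eq[where 'a='a] integral_distr[OF T m] eq
    using product_integral_prod[of "Basis :: 'a set" f] f by simp
qed

text \<open>A rescaling of the known characteristic function e^(-s^2/2) of the standard normal
  distribution.\<close>

lemma
  fixes w :: real
  shows integrable_gaussian_real: "integrable lborel (gaussian :: real \<Rightarrow> real)"
    and fourier_gaussian_real: "(LINT t|lborel. chi (- (t * w)) * of_real (gaussian t)) = of_real (gaussian w)"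
proof -
  \<comment> \<open>The substitution by c t turns t^2/2 into pi t^2, and 1/c is also the normalising
    factor of the normal density.\<close>
  define c where "c = sqrt (2 * pi)"
  have c: "c > 0" "c\<^sup>2 = 2 * pi" by (simp_all add: c_def)
  have dens: "std_normal_density (c * t) = gaussian t / c" for t
    by (simp add: std_normal_density_def gaussian_def power_mult_distrib c(2) flip: c_def)
  have "integrable lborel std_normal_density"
    using integrable_std_normal_moment[of 0] by simp
  then have "integrable lborel (\<lambda>t. std_normal_density (0 + c * t))"
    by (rule lborel_integrable_real_affine) (use c in simp)
  then have "integrable lborel (\<lambda>t::real. c * (gaussian t / c))"
    by (intro integrable_mult_right) (simp add: dens)
  moreover have "(\<lambda>t::real. c * (gaussian t / c)) = gaussian" using c by (simp add: fun_eq_iff)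
  ultimately show "integrable lborel (gaussian :: real \<Rightarrow> real)" by simp
  \<comment> \<open>With this choice s^2/2 = pi w^2, and s (c t) = - 2 pi t w has the sign of the
    forward transform.\<close>
  define s where "s = - c * w"
  have "of_real (exp (- s\<^sup>2 / 2)) = char std_normal_distribution s"
    by (simp add: char_std_normal_distribution)
  also have "\<dots> = (LINT x|lborel. std_normal_density x *\<^sub>R iexp (s * x))"
    unfolding char_def by (subst integral_density) auto
  also have "\<dots> = c *\<^sub>R (LINT t|lborel. std_normal_density (0 + c * t) *\<^sub>R iexp (s * (0 + c * t)))"
    using lborel_integral_real_affine[of c "\<lambda>x. std_normal_density x *\<^sub>R iexp (s * x)" 0] c by simp
  also have "\<dots> = (LINT t|lborel. c *\<^sub>R (std_normal_density (0 + c * t) *\<^sub>R iexp (s * (0 + c * t))))"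
    by (rule integral_scaleR_right[symmetric])
  also have "\<dots> = (LINT t|lborel. chi (- (t * w)) * of_real (gaussian t))"
  proof (rule Bochner_Integration.integral_cong)
    fix t
    have "s * (c * t) = 2 * pi * (- (t * w))"
      using c(2) by (simp add: s_def power2_eq_square)
    then have "iexp (s * (0 + c * t)) = chi (- (t * w))"
      unfolding chi_def cis_conv_exp by simp
    then show "c *\<^sub>R (std_normal_density (0 + c * t) *\<^sub>R iexp (s * (0 + c * t))) = chi (- (t * w)) * of_real (gaussian t)"
      using c by (simp add: dens scaleR_conv_of_real)
  qed simp
  finally show "(LINT t|lborel. chi (- (t * w)) * of_real (gaussian t)) = of_real (gaussian w)"
    by (simp add: gaussian_def s_def power_mult_distrib c(2))
qed

lemma chi_sum: "finite A \<Longrightarrow> chi (\<Sum>b\<in>A. f b) = (\<Prod>b\<in>A. chi (f b))"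
  by (induction A rule: finite_induct) (simp_all add: chi_add)

lemma gaussian_prod: "gaussian (x::'a::euclidean_space) = (\<Prod>b\<in>Basis. gaussian (x \<bullet> b))"
proof -
  have "(norm x)\<^sup>2 = (\<Sum>b\<in>Basis. (x \<bullet> b)\<^sup>2)"
    unfolding power2_norm_eq_inner euclidean_inner[of x x] by (simp add: power2_eq_square)
  then show ?thesis
    by (simp add: gaussian_def sum_distrib_left flip: exp_sum)
qed

lemma integrable_gaussian [simp, intro]: "integrable lborel (gaussian :: 'a::euclidean_space \<Rightarrow> real)"
proof -
  have "(gaussian :: 'a \<Rightarrow> real) = (\<lambda>x. \<Prod>b\<in>Basis. gaussian (x \<bullet> b))"
    by (rule ext) (rule gaussian_prod)
  with integrable_lborel_Basis_prod[where f="\<lambda>_::'a. gaussian", OF integrable_gaussian_real]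
  show ?thesis by simp
qed

lemma fourier_gaussian:
  "fourier (\<lambda>x. of_real (gaussian x)) \<omega> = of_real (gaussian (\<omega>::'a::euclidean_space))"
proof -
  have eq: "chi (- (t \<bullet> \<omega>)) * of_real (gaussian t)
      = (\<Prod>b\<in>Basis. chi (- ((t \<bullet> b) * (\<omega> \<bullet> b))) * of_real (gaussian (t \<bullet> b)))" for t
    unfolding gaussian_prod[of t] euclidean_inner[of t \<omega>] sum_negf[symmetric]
    by (simp add: chi_sum prod.distrib)
  have i: "integrable lborel (\<lambda>y::real. chi (- (y * w)) * of_real (gaussian y))" for w
    by (rule integrable_chi_mult) (auto intro: integrable_of_real integrable_gaussian_real)
  show ?thesis
    unfolding fourier_eq eq
    by (subst integral_lborel_Basis_prod) (simp_all add: i fourier_gaussian_real gaussian_prod[of \<omega>])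
qed

lemma integral_gaussian: "(LINT x|lborel. gaussian (x::'a::euclidean_space)) = 1"
proof -
  have "of_real (LINT x|lborel. gaussian (x::'a)) = fourier (\<lambda>x::'a. of_real (gaussian x)) 0"
    unfolding fourier_eq by simp
  then show ?thesis unfolding fourier_gaussian by (simp add: gaussian_def)
qed

lemma integrable_gaussian_scale: "s \<noteq> 0 \<Longrightarrow> integrable lborel (\<lambda>x::'a::euclidean_space. gaussian (s *\<^sub>R x))"
  using integrable_lborel_scale[of "gaussian :: 'a \<Rightarrow> real" s 0] by simp

section \<open>Multiplication formula, Gaussian smoothing and Plancherel's theorem\<close>

lemma fourier_measurable [measurable]:
  assumes [measurable]: "f \<in> borel_measurable borel"
  shows "fourier f \<in> borel_measurable borel"
  unfolding fourier_eq[abs_def] by measurable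

lemma norm_fourier_le: "norm (fourier f \<omega>) \<le> (LINT x|lborel. norm (f x))"
  unfolding fourier_eq
  using integral_norm_bound[of lborel "\<lambda>t. chi (- (t \<bullet> \<omega>)) * f t"] by (simp add: norm_mult)

lemma integrable_fourier_mult:
  assumes "integrable lborel f" "integrable lborel g"
  shows "integrable lborel (\<lambda>x. fourier f x * g x)"
proof (rule integrable_mult_bounded[OF assms(2)])
  show "fourier f \<in> borel_measurable borel"
    using borel_measurable_integrable[OF assms(1)] by measurable
qed (use norm_fourier_le in auto)

lemma integrable_prod_mult:
  fixes f :: "'a::euclidean_space \<Rightarrow> complex" and g :: "'b::euclidean_space \<Rightarrow> complex"
  assumes f: "integrable lborel f" and g: "integrable lborel g"
  shows "integrable (lborel \<Otimes>\<^sub>M lborel) (\<lambda>(x, y). f x * g y)"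
proof (rule lborel_pair.Fubini_integrable)
  note [measurable] = borel_measurable_integrable[OF f] borel_measurable_integrable[OF g]
  show "(\<lambda>(x, y). f x * g y) \<in> borel_measurable (lborel \<Otimes>\<^sub>M lborel)" by measurable
qed (use f g in \<open>auto simp: norm_mult\<close>)

text \<open>The multiplication formula: the kernel is symmetric and unimodular, so Fubini's theorem
  applies to the product of two integrable functions. Smoothing, Plancherel's theorem, the adjoint
  relation and the distributional inversion all go through it.\<close>

lemma fourier_swap:
  assumes f: "integrable lborel f" and g: "integrable lborel g"
  shows "(LINT x|lborel. fourier f x * g x) = (LINT x|lborel. f x * fourier g x)"
proof -
  note [measurable] = borel_measurable_integrable[OF f] borel_measurable_integrable[OF g]
  have "integrable (lborel \<Otimes>\<^sub>M lborel) (\<lambda>(y, x). chi (- (y \<bullet> x)) * (f y * g x))"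
    by (rule Bochner_Integration.integrable_bound[OF integrable_prod_mult[OF f g]]) (auto simp: norm_mult)
  from lborel_pair.Fubini_integral[OF this]
  have "(LINT x|lborel. LINT y|lborel. chi (- (y \<bullet> x)) * (f y * g x))
      = (LINT y|lborel. LINT x|lborel. chi (- (y \<bullet> x)) * (f y * g x))" .
  moreover have "(LINT y|lborel. chi (- (y \<bullet> x)) * (f y * g x)) = fourier f x * g x" for x
    unfolding fourier_eq by (simp only: integral_mult_left_zero[symmetric] mult.assoc)
  moreover have "(LINT x|lborel. chi (- (y \<bullet> x)) * (f y * g x)) = f y * fourier g y" for y
    unfolding fourier_eq by (simp add: integral_mult_right_zero[symmetric] ac_simps inner_commute del: integral_mult_right_zero)
  ultimately show ?thesis by simp
qed

text \<open>The point of evaluation is written \<open>a + s *\<^sub>R z\<close> to match the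
  substitution in \<open>fourier_gaussian_smoothing\<close>, where the Jacobian cancels the division
  by \<open>s ^ DIM('a)\<close>.\<close>

lemma fourier_gaussian_scale:
  fixes x a :: "'a::euclidean_space"
  assumes s: "s > 0"
  shows "fourier (\<lambda>\<omega>. chi (\<omega> \<bullet> a) * of_real (gaussian (s *\<^sub>R \<omega>))) (a + s *\<^sub>R z) = of_real (gaussian z) / s ^ DIM('a)"
proof -
  have "of_real (gaussian z) = (LINT t|lborel. chi (- (t \<bullet> z)) * of_real (gaussian t))"
    unfolding fourier_eq[symmetric] fourier_gaussian ..
  also have "\<dots> = s ^ DIM('a) *\<^sub>R (LINT t|lborel. chi (- ((0 + s *\<^sub>R t) \<bullet> z)) * of_real (gaussian (0 + s *\<^sub>R t)))"
    using integral_lborel_scale[of "\<lambda>t. chi (- (t \<bullet> z)) * of_real (gaussian t)" s 0] s by simp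
  also have "(LINT t|lborel. chi (- ((0 + s *\<^sub>R t) \<bullet> z)) * of_real (gaussian (0 + s *\<^sub>R t)))
      = fourier (\<lambda>\<omega>. chi (\<omega> \<bullet> a) * of_real (gaussian (s *\<^sub>R \<omega>))) (a + s *\<^sub>R z)"
    unfolding fourier_eq
  proof (rule Bochner_Integration.integral_cong)
    fix t :: 'a
    have "chi (- (t \<bullet> (a + s *\<^sub>R z))) * chi (t \<bullet> a) = chi (- ((0 + s *\<^sub>R t) \<bullet> z))"
      unfolding chi_add[symmetric] by (simp add: inner_add_right)
    then show "chi (- ((0 + s *\<^sub>R t) \<bullet> z)) * of_real (gaussian (0 + s *\<^sub>R t))
        = chi (- (t \<bullet> (a + s *\<^sub>R z))) * (chi (t \<bullet> a) * of_real (gaussian (s *\<^sub>R t)))"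
      by (simp add: mult.assoc[symmetric] del: of_real_mult)
  qed simp
  finally show ?thesis using s by (simp add: scaleR_conv_of_real)
qed

text \<open>The multiplication formula applied to \<open>f\<close> and a modulated dilated Gaussian.
  As s tends to 0 the left side becomes the inversion integral at a, while the right side averages
  \<open>f\<close> over an ever smaller neighbourhood of a.\<close>

lemma fourier_gaussian_smoothing:
  fixes f :: "'a::euclidean_space \<Rightarrow> complex"
  assumes f: "integrable lborel f" and s: "s > 0"
  shows "(LINT \<omega>|lborel. fourier f \<omega> * (chi (\<omega> \<bullet> a) * of_real (gaussian (s *\<^sub>R \<omega>))))
      = (LINT z|lborel. f (a + s *\<^sub>R z) * of_real (gaussian z))"
proof -
  note [measurable] = borel_measurable_integrable[OF f, simplified]
  let ?g = "\<lambda>\<omega>::'a. chi (\<omega> \<bullet> a) * complex_of_real (gaussian (s *\<^sub>R \<omega>))"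
  have g: "integrable lborel ?g"
    by (rule integrable_chi_mult) (use s in \<open>auto intro!: integrable_of_real integrable_gaussian_scale\<close>)
  have "(LINT \<omega>|lborel. fourier f \<omega> * ?g \<omega>) = (LINT x|lborel. f x * fourier ?g x)"
    by (rule fourier_swap[OF f g])
  also have "\<dots> = s ^ DIM('a) *\<^sub>R (LINT z|lborel. f (a + s *\<^sub>R z) * fourier ?g (a + s *\<^sub>R z))"
    using integral_lborel_scale[of "\<lambda>x. f x * fourier ?g x" s a] s by simp
  also have "\<dots> = (LINT z|lborel. f (a + s *\<^sub>R z) * of_real (gaussian z))"
    unfolding fourier_gaussian_scale[OF s] using s
    by (subst integral_scaleR_right[symmetric]) (simp add: scaleR_conv_of_real)
  finally show ?thesis .
qed

lemma scaled_sequence: "(\<lambda>n. inverse (real (Suc n)) *\<^sub>R z) \<longlonglongrightarrow> (0 :: 'a::euclidean_space)"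
  using tendsto_scaleR[OF LIMSEQ_inverse_real_of_nat tendsto_const[of z]] by simp

text \<open>Gaussian averages are an approximate identity at 0, by dominated convergence. Continuity
  at 0 is assumed along sequences, the form in which the translation lemmas supply it.\<close>

lemma integral_gaussian_tendsto:
  fixes A :: "'a::euclidean_space \<Rightarrow> 'b::{banach, second_countable_topology, real_normed_field}"
  assumes [measurable]: "A \<in> borel_measurable borel" and bd: "\<And>u. norm (A u) \<le> B"
    and lim: "\<And>u. u \<longlonglongrightarrow> 0 \<Longrightarrow> (\<lambda>n. A (u n)) \<longlonglongrightarrow> l"
  shows "(\<lambda>n. LINT z|lborel. A (inverse (real (Suc n)) *\<^sub>R z) * of_real (gaussian z)) \<longlonglongrightarrow> l"
proof -
  have "(\<lambda>n. LINT z|lborel. A (inverse (real (Suc n)) *\<^sub>R z) * of_real (gaussian z))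
      \<longlonglongrightarrow> (LINT z|(lborel :: 'a measure). l * of_real (gaussian z))"
  proof (rule integral_dominated_convergence[where w="\<lambda>z. B * gaussian z"])
    show "AE z in lborel. (\<lambda>n. A (inverse (real (Suc n)) *\<^sub>R z) * of_real (gaussian z)) \<longlonglongrightarrow> l * of_real (gaussian z)"
      by (intro AE_I2 tendsto_mult tendsto_const lim scaled_sequence)
    show "AE z in lborel. norm (A (inverse (real (Suc n)) *\<^sub>R z) * of_real (gaussian z)) \<le> B * gaussian z" for n
      by (intro AE_I2) (auto simp: norm_mult intro!: mult_right_mono bd)
  qed auto
  also have "(LINT z|(lborel :: 'a measure). l * of_real (gaussian z)) = l"
    by (simp add: integral_gaussian)
  finally show ?thesis .
qed

text \<open>By the smoothing identity every Gaussian average of \<open>f\<close> vanishes, so the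
  L^1 norm of \<open>f\<close> is the norm of the difference between \<open>f\<close> and its
  average. That is at most an average of the translation error \<open>D\<close>, which tends to 0
  with the scale.\<close>

lemma fourier_L1_inj:
  fixes f :: "'a::euclidean_space \<Rightarrow> complex"
  assumes f: "integrable lborel f" and 0: "\<And>\<omega>. fourier f \<omega> = 0"
  shows "AE x in lborel. f x = 0"
proof -
  note fm[measurable] = borel_measurable_integrable[OF f, simplified]
  have tr: "integrable lborel (\<lambda>x. f (x + u))" for u
    using f integrable_lborel_translate[of f "- u"] by simp
  have id: "integrable lborel (\<lambda>x. norm (f x - f (x + u)))" for u
    using f tr by (intro integrable_norm Bochner_Integration.integrable_diff)
  define D where "D u = (LINT x|lborel. norm (f x - f (x + u)))" for u
  have Dm[measurable]: "D \<in> borel_measurable borel" unfolding D_def[abs_def] by measurable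
  have D0: "D u \<ge> 0" for u by (simp add: D_def)
  have Dle: "D u \<le> 2 * (LINT x|lborel. norm (f x))" for u
  proof -
    have "D u \<le> (LINT x|lborel. norm (f x) + norm (f (x + u)))"
      unfolding D_def using f tr[of u] by (intro integral_mono id) (auto intro: norm_triangle_ineq4)
    also have "\<dots> = (LINT x|lborel. norm (f x)) + (LINT x|lborel. norm (f (x + u)))"
      using f tr[of u] by simp
    also have "(LINT x|lborel. norm (f (x + u))) = (LINT x|lborel. norm (f x))"
      using integral_lborel_translate[of "\<lambda>x. norm (f x)" "- u"] by simp
    finally show ?thesis by simp
  qed
  have Dlim: "(\<lambda>n. D (u n)) \<longlonglongrightarrow> 0" if "u \<longlonglongrightarrow> 0" for u
    using L1_translation_continuous[OF f tendsto_minus[OF that, simplified]]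
    by (simp add: D_def norm_minus_commute)
  have "(LINT x|lborel. norm (f x)) \<le> (LINT z|lborel. D (s *\<^sub>R z) * gaussian z)" if s: "s > 0" for s
  proof -
    have sm: "(LINT z|lborel. f (a + s *\<^sub>R z) * of_real (gaussian z)) = 0" for a
      using fourier_gaussian_smoothing[OF f s, of a] by (simp add: 0)
    have ip: "integrable (lborel \<Otimes>\<^sub>M lborel) (\<lambda>(z, x). (f x - f (x + s *\<^sub>R z)) * of_real (gaussian z))"
    proof (rule lborel_pair.Fubini_integrable)
      have "integrable lborel (\<lambda>z. D (s *\<^sub>R z) * gaussian z)"
      proof (rule Bochner_Integration.integrable_bound)
        show "integrable lborel (\<lambda>z::'a. 2 * (LINT x|lborel. norm (f x)) * gaussian z)" by simp
        show "AE z in lborel. norm (D (s *\<^sub>R z) * gaussian z) \<le> norm (2 * (LINT x|lborel. norm (f x)) * gaussian z)"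
          using Dle D0 by (auto simp: abs_mult intro!: mult_right_mono)
      qed simp
      then show "integrable lborel (\<lambda>z. LINT x|lborel. norm (case (z, x) of (z, x) \<Rightarrow> (f x - f (x + s *\<^sub>R z)) * of_real (gaussian z)))"
        by (simp add: norm_mult D_def)
      show "AE z in lborel. integrable lborel (\<lambda>x. case (z, x) of (z, x) \<Rightarrow> (f x - f (x + s *\<^sub>R z)) * of_real (gaussian z))"
        using f tr by (intro AE_I2) simp
    qed measurable
    have ipn: "integrable (lborel \<Otimes>\<^sub>M lborel) (\<lambda>(z, x). norm (f x - f (x + s *\<^sub>R z)) * gaussian z)"
      using integrable_norm[OF ip] by (simp add: split_def norm_mult)
    \<comment> \<open>Splitting the integral of a difference below needs genuine integrability,
      which Fubini's theorem supplies at almost every x.\<close>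
    have ia: "AE x in lborel. integrable lborel (\<lambda>z. (f x - f (x + s *\<^sub>R z)) * of_real (gaussian z))"
      using lborel_pair.AE_integrable_snd[OF ip] by simp
    have "(LINT x|lborel. norm (f x)) \<le> (LINT x|lborel. LINT z|lborel. norm (f x - f (x + s *\<^sub>R z)) * gaussian z)"
    proof (rule integral_mono_AE)
      show "integrable lborel (\<lambda>x. LINT z|lborel. norm (f x - f (x + s *\<^sub>R z)) * gaussian z)"
        using lborel_pair.integrable_snd[OF ipn] by simp
      show "AE x in lborel. norm (f x) \<le> (LINT z|lborel. norm (f x - f (x + s *\<^sub>R z)) * gaussian z)"
        using ia
      proof eventually_elim
        case (elim x)
        have ig: "integrable lborel (\<lambda>z::'a. f x * complex_of_real (gaussian z))"
          by (auto intro!: integrable_of_real)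
        have "integrable lborel (\<lambda>z. f x * of_real (gaussian z) - (f x - f (x + s *\<^sub>R z)) * of_real (gaussian z))"
          by (intro Bochner_Integration.integrable_diff ig elim)
        then have is': "integrable lborel (\<lambda>z. f (x + s *\<^sub>R z) * of_real (gaussian z))"
          by (simp add: algebra_simps)
        \<comment> \<open>The Gaussian has mass 1, so the value \<open>f x\<close> is itself an
          average, from which the vanishing average of \<open>f\<close> near x may be
          subtracted.\<close>
        have "f x = (LINT z|(lborel::'a measure). f x * of_real (gaussian z))"
          by (simp add: integral_gaussian)
        also have "\<dots> = (LINT z|(lborel::'a measure). f x * of_real (gaussian z)) - (LINT z|lborel. f (x + s *\<^sub>R z) * of_real (gaussian z))"
          unfolding sm by simp
        also have "\<dots> = (LINT z|lborel. (f x - f (x + s *\<^sub>R z)) * of_real (gaussian z))"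
          by (subst Bochner_Integration.integral_diff[symmetric]) (use ig is' in \<open>simp_all add: algebra_simps\<close>)
        finally have "norm (f x) = norm (LINT z|lborel. (f x - f (x + s *\<^sub>R z)) * of_real (gaussian z))" by simp
        also have "\<dots> \<le> (LINT z|lborel. norm ((f x - f (x + s *\<^sub>R z)) * of_real (gaussian z)))"
          by (rule integral_norm_bound)
        finally show ?case by (simp add: norm_mult)
      qed
    qed (use f in auto)
    also have "\<dots> = (LINT z|lborel. LINT x|lborel. norm (f x - f (x + s *\<^sub>R z)) * gaussian z)"
      by (rule lborel_pair.Fubini_integral[OF ipn])
    also have "\<dots> = (LINT z|lborel. D (s *\<^sub>R z) * gaussian z)"
      by (simp add: D_def)
    finally show ?thesis .
  qed
  then have le: "(LINT x|lborel. norm (f x)) \<le> (LINT z|lborel. D (inverse (real (Suc n)) *\<^sub>R z) * of_real (gaussian z))" for n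
    by simp
  have "(LINT x|lborel. norm (f x)) \<le> 0"
  proof (rule LIMSEQ_le_const)
    show "(\<lambda>n. LINT z|lborel. D (inverse (real (Suc n)) *\<^sub>R z) * of_real (gaussian z)) \<longlonglongrightarrow> 0"
    proof (rule integral_gaussian_tendsto[OF Dm])
      show "norm (D u) \<le> 2 * (LINT x|lborel. norm (f x))" for u using Dle[of u] D0[of u] by simp
    qed (rule Dlim)
  qed (use le in auto)
  then have "(LINT x|lborel. norm (f x)) = 0" by (simp add: order_antisym)
  then show ?thesis
    using f by (subst (asm) integral_nonneg_eq_0_iff_AE) auto
qed

text \<open>The Gaussian-weighted integral of the squared modulus of the transform equals a Gaussian
  average of the autocorrelation \<open>A\<close> near 0, and \<open>A\<close> is continuous at 0
  with value the squared norm of \<open>f\<close>. Removing the weight then gives integrability and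
  the norm identity at once.\<close>

lemma Plancherel_L1_L2:
  fixes f :: "'a::euclidean_space \<Rightarrow> complex"
  assumes f1: "integrable lborel f" and f2: "f \<in> L2"
  shows "fourier f \<in> L2" "L2_norm (fourier f) = L2_norm f"
proof -
  note fm[measurable] = L2_measurable[OF f2]
  have tr: "(\<lambda>x. f (x + u)) \<in> L2" "L2_norm (\<lambda>x. f (x + u)) = L2_norm f" for u
    using L2_translate[OF f2, of "- u"] L2_norm_translate[OF f2, of "- u"] by simp_all
  define A where "A u = (LINT x|lborel. f x * cnj (f (x + u)))" for u
  have Am[measurable]: "A \<in> borel_measurable borel" unfolding A_def[abs_def] by measurable
  have Ale: "norm (A u) \<le> (L2_norm f)\<^sup>2" for u
    using L2_Cauchy_Schwarz[OF f2 L2_cnj[OF tr(1)], of u] by (simp add: A_def tr(2) power2_eq_square)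
  have ff: "L2_inner f f = of_real ((L2_norm f)\<^sup>2)"
    unfolding L2_inner_def L2_norm_sq by (simp add: complex_norm_square[symmetric] flip: of_real_power)
  have Alim: "(\<lambda>n. A (u n)) \<longlonglongrightarrow> of_real ((L2_norm f)\<^sup>2)" if "u \<longlonglongrightarrow> 0" for u
    using L2_inner_tendsto[OF L2_tendsto_const[OF f2] L2_translation_continuous[OF f2 tendsto_minus[OF that, simplified]]]
    by (simp add: L2_inner_def[of f "\<lambda>x. f (x + _)"] A_def ff)
  have I: "integrable lborel (\<lambda>\<omega>. (norm (fourier f \<omega>))\<^sup>2 * gaussian (s *\<^sub>R \<omega>))"
    "of_real (LINT \<omega>|lborel. (norm (fourier f \<omega>))\<^sup>2 * gaussian (s *\<^sub>R \<omega>))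
      = (LINT z|lborel. A (s *\<^sub>R z) * of_real (gaussian z))" if s: "s > 0" for s
  proof -
    \<comment> \<open>Chosen so that the product with the transform is the weighted squared modulus,
      while its own transform is the conjugate of a Gaussian average of \<open>f\<close>
      (\<open>Fg\<close>).\<close>
    let ?g = "\<lambda>\<omega>. cnj (fourier f \<omega>) * complex_of_real (gaussian (s *\<^sub>R \<omega>))"
    have gs: "integrable lborel (\<lambda>\<omega>::'a. complex_of_real (gaussian (s *\<^sub>R \<omega>)))"
      using s by (intro integrable_of_real integrable_gaussian_scale) auto
    have g: "integrable lborel ?g"
      by (rule integrable_mult_bounded[OF gs]) (use norm_fourier_le in auto)
    have fg: "fourier f \<omega> * ?g \<omega> = of_real ((norm (fourier f \<omega>))\<^sup>2 * gaussian (s *\<^sub>R \<omega>))" for \<omega>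
      unfolding of_real_mult complex_norm_square by (simp only: mult.assoc)
    have "integrable lborel (\<lambda>\<omega>. fourier f \<omega> * ?g \<omega>)"
      by (rule integrable_fourier_mult[OF f1 g])
    then show "integrable lborel (\<lambda>\<omega>. (norm (fourier f \<omega>))\<^sup>2 * gaussian (s *\<^sub>R \<omega>))"
      unfolding fg complex_of_real_integrable_eq .
    have Fg: "fourier ?g x = cnj (LINT z|lborel. f (x + s *\<^sub>R z) * of_real (gaussian z))" for x
    proof -
      have "fourier ?g x = cnj (LINT \<omega>|lborel. fourier f \<omega> * (chi (\<omega> \<bullet> x) * of_real (gaussian (s *\<^sub>R \<omega>))))"
        unfolding fourier_eq[of ?g] Bochner_Integration.integral_cnj[symmetric]
        by (rule Bochner_Integration.integral_cong) (simp_all add: ac_simps)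
      then show ?thesis unfolding fourier_gaussian_smoothing[OF f1 s] .
    qed
    have "of_real (LINT \<omega>|lborel. (norm (fourier f \<omega>))\<^sup>2 * gaussian (s *\<^sub>R \<omega>)) = (LINT \<omega>|lborel. fourier f \<omega> * ?g \<omega>)"
      by (simp only: fg Bochner_Integration.integral_complex_of_real)
    also have "\<dots> = (LINT x|lborel. f x * fourier ?g x)"
      by (rule fourier_swap[OF f1 g])
    also have "\<dots> = (LINT x|lborel. LINT z|lborel. f x * cnj (f (x + s *\<^sub>R z)) * of_real (gaussian z))"
    proof (rule Bochner_Integration.integral_cong)
      fix x
      have "f x * fourier ?g x = f x * (LINT z|lborel. cnj (f (x + s *\<^sub>R z) * of_real (gaussian z)))"
        unfolding Fg Bochner_Integration.integral_cnj ..
      also have "\<dots> = (LINT z|lborel. f x * cnj (f (x + s *\<^sub>R z) * of_real (gaussian z)))"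
        by (rule integral_mult_right_zero[symmetric])
      finally show "f x * fourier ?g x = (LINT z|lborel. f x * cnj (f (x + s *\<^sub>R z)) * of_real (gaussian z))"
        by (simp only: complex_cnj_mult complex_cnj_complex_of_real mult.assoc)
    qed simp
    also have "\<dots> = (LINT z|lborel. LINT x|lborel. f x * cnj (f (x + s *\<^sub>R z)) * of_real (gaussian z))"
    proof (rule lborel_pair.Fubini_integral, rule lborel_pair.Fubini_integrable)
      have "integrable lborel (\<lambda>z. (LINT x|lborel. norm (f x) * norm (f (x + s *\<^sub>R z))) * gaussian z)"
      proof (rule Bochner_Integration.integrable_bound)
        show "integrable lborel (\<lambda>z::'a. (L2_norm f)\<^sup>2 * gaussian z)" by simp
        \<comment> \<open>Cauchy-Schwarz bounds the x-integral uniformly in the shift, which leaves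
          the Gaussian as a majorant in z.\<close>
        have "(LINT x|lborel. norm (f x) * norm (f (x + u))) \<le> (L2_norm f)\<^sup>2" for u
          using L2_Cauchy_Schwarz_norm[OF f2 tr(1), of u] by (simp add: tr(2) power2_eq_square)
        then show "AE z in lborel. norm ((LINT x|lborel. norm (f x) * norm (f (x + s *\<^sub>R z))) * gaussian z)
            \<le> norm ((L2_norm f)\<^sup>2 * gaussian z)"
          by (auto simp: abs_mult intro!: mult_right_mono)
      qed measurable
      then show "integrable lborel (\<lambda>z. LINT x|lborel. norm (case (z, x) of (z, x) \<Rightarrow> f x * cnj (f (x + s *\<^sub>R z)) * of_real (gaussian z)))"
        by (simp add: norm_mult)
      show "AE z in lborel. integrable lborel (\<lambda>x. case (z, x) of (z, x) \<Rightarrow> f x * cnj (f (x + s *\<^sub>R z)) * of_real (gaussian z))"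
        using L2_mult_integrable[OF f2 L2_cnj[OF tr(1)]] by (intro AE_I2) simp
    qed measurable
    also have "\<dots> = (LINT z|lborel. A (s *\<^sub>R z) * of_real (gaussian z))"
      by (simp add: A_def)
    finally show "of_real (LINT \<omega>|lborel. (norm (fourier f \<omega>))\<^sup>2 * gaussian (s *\<^sub>R \<omega>))
      = (LINT z|lborel. A (s *\<^sub>R z) * of_real (gaussian z))" .
  qed
  \<comment> \<open>The weights increase to 1 as n grows. Monotone convergence is the right tool
    because the limit is not yet known to be integrable.\<close>
  define G where "G n \<omega> = (norm (fourier f \<omega>))\<^sup>2 * gaussian (inverse (real (Suc n)) *\<^sub>R \<omega>)" for n \<omega>
  have G1: "integrable lborel (G n)" for n
    unfolding G_def by (rule I) simp
  have G2: "AE \<omega> in lborel. mono (\<lambda>n. G n \<omega>)"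
  proof (intro AE_I2 monoI)
    fix \<omega> :: 'a and m n :: nat assume "m \<le> n"
    then have "inverse (real (Suc n)) \<le> inverse (real (Suc m))" by (simp add: divide_simps)
    then have "norm (inverse (real (Suc n)) *\<^sub>R \<omega>) \<le> norm (inverse (real (Suc m)) *\<^sub>R \<omega>)"
      by (auto intro!: mult_right_mono)
    then have "(norm (inverse (real (Suc n)) *\<^sub>R \<omega>))\<^sup>2 \<le> (norm (inverse (real (Suc m)) *\<^sub>R \<omega>))\<^sup>2"
      by (rule power_mono) simp
    then have "gaussian (inverse (real (Suc m)) *\<^sub>R \<omega>) \<le> gaussian (inverse (real (Suc n)) *\<^sub>R \<omega>)"
      unfolding gaussian_def by (simp del: norm_scaleR)
    then show "G m \<omega> \<le> G n \<omega>" unfolding G_def by (intro mult_left_mono) auto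
  qed
  have G3: "AE \<omega> in lborel. (\<lambda>n. G n \<omega>) \<longlonglongrightarrow> (norm (fourier f \<omega>))\<^sup>2"
  proof (intro AE_I2)
    fix \<omega> :: 'a
    have "(\<lambda>n. gaussian (inverse (real (Suc n)) *\<^sub>R \<omega>)) \<longlonglongrightarrow> exp (- pi * (norm (0::'a))\<^sup>2)"
      unfolding gaussian_def
      by (intro tendsto_exp tendsto_mult tendsto_const tendsto_power tendsto_norm scaled_sequence)
    from tendsto_mult[OF tendsto_const[of "(norm (fourier f \<omega>))\<^sup>2"] this]
    show "(\<lambda>n. G n \<omega>) \<longlonglongrightarrow> (norm (fourier f \<omega>))\<^sup>2" by (simp add: G_def)
  qed
  have "(\<lambda>n. complex_of_real (LINT \<omega>|lborel. G n \<omega>)) \<longlonglongrightarrow> of_real ((L2_norm f)\<^sup>2)"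
    using integral_gaussian_tendsto[OF Am Ale Alim] by (simp only: G_def I(2) positive_imp_inverse_positive of_nat_0_less_iff zero_less_Suc)
  then have G4: "(\<lambda>n. LINT \<omega>|lborel. G n \<omega>) \<longlonglongrightarrow> (L2_norm f)\<^sup>2"
    by (simp only: tendsto_of_real_iff)
  have m: "(\<lambda>\<omega>. (norm (fourier f \<omega>))\<^sup>2) \<in> borel_measurable lborel" by measurable
  note mc = integrable_monotone_convergence[OF G1 G2 G3 G4 m] integral_monotone_convergence[OF G1 G2 G3 G4 m]
  show "fourier f \<in> L2" using mc(1) by (simp add: L2_iff)
  show "L2_norm (fourier f) = L2_norm f"
    using mc(2) by (simp add: L2_norm_def[of "fourier f"])
qed

section \<open>The Fourier transform on $L^2$\<close>

text \<open>The redundant factors 1 keep every norm in the shape produced by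
  \<open>L2_fourier_linear\<close>, so that preservation of norms carries over to inner products in
  \<open>Parseval\<close>.\<close>

lemma L2_polarization:
  assumes f: "f \<in> L2" and h: "h \<in> L2"
  shows "4 * L2_inner f h = of_real ((L2_norm (\<lambda>x. 1 * f x + 1 * h x))\<^sup>2) - of_real ((L2_norm (\<lambda>x. 1 * f x + (-1) * h x))\<^sup>2)
    + \<i> * of_real ((L2_norm (\<lambda>x. 1 * f x + \<i> * h x))\<^sup>2) - \<i> * of_real ((L2_norm (\<lambda>x. 1 * f x + (-\<i>) * h x))\<^sup>2)"
proof -
  have i: "integrable lborel (\<lambda>x. complex_of_real ((norm (1 * f x + c * h x))\<^sup>2))" for c
    using L2_linear[OF f h, of 1 c] by (intro integrable_of_real) (simp add: L2_iff)
  have N: "complex_of_real ((L2_norm (\<lambda>x. 1 * f x + c * h x))\<^sup>2) = (LINT x|lborel. complex_of_real ((norm (1 * f x + c * h x))\<^sup>2))" for c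
    by (simp only: L2_norm_sq Bochner_Integration.integral_complex_of_real)
  have p: "4 * (a * cnj b) = of_real ((norm (1 * a + 1 * b))\<^sup>2) - of_real ((norm (1 * a + (-1) * b))\<^sup>2)
     + \<i> * of_real ((norm (1 * a + \<i> * b))\<^sup>2) - \<i> * of_real ((norm (1 * a + (-\<i>) * b))\<^sup>2)" for a b :: complex
    unfolding complex_norm_square by (simp add: algebra_simps)
  have "4 * L2_inner f h = (LINT x|lborel. 4 * (f x * cnj (h x)))"
    unfolding L2_inner_def by (rule integral_mult_right_zero[symmetric])
  also have "\<dots> = (LINT x|lborel. of_real ((norm (1 * f x + 1 * h x))\<^sup>2) - of_real ((norm (1 * f x + (-1) * h x))\<^sup>2)
     + \<i> * of_real ((norm (1 * f x + \<i> * h x))\<^sup>2) - \<i> * of_real ((norm (1 * f x + (-\<i>) * h x))\<^sup>2))"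
    unfolding p ..
  also have "\<dots> = (LINT x|lborel. of_real ((norm (1 * f x + 1 * h x))\<^sup>2)) - (LINT x|lborel. of_real ((norm (1 * f x + (-1) * h x))\<^sup>2))
     + \<i> * (LINT x|lborel. of_real ((norm (1 * f x + \<i> * h x))\<^sup>2)) - \<i> * (LINT x|lborel. of_real ((norm (1 * f x + (-\<i>) * h x))\<^sup>2))"
    by (simp only: Bochner_Integration.integral_diff Bochner_Integration.integral_add integral_mult_right_zero
       i Bochner_Integration.integrable_diff Bochner_Integration.integrable_add integrable_mult_right simp_thms)
  finally show ?thesis unfolding N .
qed

lemma fourier_linear:
  assumes f: "integrable lborel f" and h: "integrable lborel h"
  shows "fourier (\<lambda>x. c * f x + d * h x) = (\<lambda>\<omega>. c * fourier f \<omega> + d * fourier h \<omega>)"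
proof
  fix \<omega>
  have i: "integrable lborel (\<lambda>t. chi (- (t \<bullet> \<omega>)) * f t)" "integrable lborel (\<lambda>t. chi (- (t \<bullet> \<omega>)) * h t)"
    by (intro integrable_chi_mult f h; simp)+
  have "fourier (\<lambda>x. c * f x + d * h x) \<omega>
      = (LINT t|lborel. c * (chi (- (t \<bullet> \<omega>)) * f t) + d * (chi (- (t \<bullet> \<omega>)) * h t))"
    unfolding fourier_eq by (simp add: algebra_simps)
  also have "\<dots> = c * fourier f \<omega> + d * fourier h \<omega>"
    unfolding fourier_eq using i by simp
  finally show "fourier (\<lambda>x. c * f x + d * h x) \<omega> = c * fourier f \<omega> + d * fourier h \<omega>" .
qed

lemma L2_fourierD:
  assumes "u \<in> L2_fourier f"
  shows "f \<in> L2" "u \<in> L2" "L2_norm u = L2_norm f"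
proof -
  from assms obtain F where F: "\<And>n. F n \<in> L1" "L2_tendsto F f" "L2_tendsto (\<lambda>n. fourier (F n)) u"
    unfolding L2_fourier_def by blast
  show "f \<in> L2" "u \<in> L2" using F L2_tendstoD by blast+
  have "L2_norm (fourier (F n)) = L2_norm (F n)" for n
    using F L2_tendstoD(1) by (intro Plancherel_L1_L2) (auto simp: L1_def)
  with L2_tendsto_norm[OF F(3)] have "(\<lambda>n. L2_norm (F n)) \<longlonglongrightarrow> L2_norm u" by simp
  with L2_tendsto_norm[OF F(2)] show "L2_norm u = L2_norm f" by (rule LIMSEQ_unique[rotated])
qed

lemma L2_fourier_linear:
  assumes "u \<in> L2_fourier f" "v \<in> L2_fourier h"
  shows "(\<lambda>x. c * u x + d * v x) \<in> L2_fourier (\<lambda>x. c * f x + d * h x)"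
proof -
  from assms obtain F H where F: "\<And>n. F n \<in> L1" "L2_tendsto F f" "L2_tendsto (\<lambda>n. fourier (F n)) u"
    and H: "\<And>n. H n \<in> L1" "L2_tendsto H h" "L2_tendsto (\<lambda>n. fourier (H n)) v"
    unfolding L2_fourier_def by blast
  have "fourier (\<lambda>x. c * F n x + d * H n x) = (\<lambda>\<omega>. c * fourier (F n) \<omega> + d * fourier (H n) \<omega>)" for n
    using F(1) H(1) by (intro fourier_linear) (auto simp: L1_def)
  then show ?thesis
    unfolding L2_fourier_def mem_Collect_eq
    using F(1) H(1) L2_tendsto_linear[OF F(2) H(2), of c d] L2_tendsto_linear[OF F(3) H(3), of c d]
    by (intro exI[of _ "\<lambda>n x. c * F n x + d * H n x"]) (auto simp: L1_def)
qed

lemma L2_fourier_cong_AE: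
  assumes "u \<in> L2_fourier f"
  shows "AE x in lborel. f x = f' x \<Longrightarrow> f' \<in> borel_measurable borel \<Longrightarrow> u \<in> L2_fourier f'"
    and "AE x in lborel. u x = u' x \<Longrightarrow> u' \<in> borel_measurable borel \<Longrightarrow> u' \<in> L2_fourier f"
proof -
  obtain F where F: "\<And>n. F n \<in> L1" "L2_tendsto F f" "L2_tendsto (\<lambda>n. fourier (F n)) u"
    using assms unfolding L2_fourier_def by blast
  show "u \<in> L2_fourier f'" if "AE x in lborel. f x = f' x" "f' \<in> borel_measurable borel"
    unfolding L2_fourier_def mem_Collect_eq
    by (intro exI[of _ F] conjI allI F L2_tendsto_cong_AE[OF F(2) that])
  show "u' \<in> L2_fourier f" if "AE x in lborel. u x = u' x" "u' \<in> borel_measurable borel"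
    unfolding L2_fourier_def mem_Collect_eq
    by (intro exI[of _ F] conjI allI F L2_tendsto_cong_AE[OF F(3) that])
qed

text \<open>The difference of two values is a transform of f - f = 0, so its norm is 0 by the
  isometry. Independence of the approximating sequence is thereby included.\<close>

lemma L2_fourier_unique:
  assumes "u \<in> L2_fourier f" "v \<in> L2_fourier f"
  shows "AE x in lborel. u x = v x"
proof -
  have "L2_norm (\<lambda>x. 1 * u x + (- 1) * v x) = L2_norm (\<lambda>x. 1 * f x + (- 1) * f x)"
    by (intro L2_fourierD(3) L2_fourier_linear assms)
  then have "L2_norm (\<lambda>x. u x - v x) = 0" by (simp add: L2_norm_def)
  moreover have "(\<lambda>x. u x - v x) \<in> L2"
    by (intro L2_diff L2_fourierD(2)[OF assms(1)] L2_fourierD(2)[OF assms(2)])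
  ultimately show ?thesis using L2_norm_eq_0_iff by force
qed

lemma L2_fourier_exists:
  assumes f: "f \<in> L2"
  obtains u where "u \<in> L2_fourier f"
proof -
  \<comment> \<open>The exponent \<open>Suc k\<close> makes consecutive truncations differ by at
    most (1/2)^(k+2) + (1/2)^(k+1) \<le> (1/2)^k, the rate that \<open>L2_limit_exists\<close> asks
    for; Plancherel's theorem transfers it to the transforms.\<close>
  have "\<exists>n. L2_norm (\<lambda>x. truncate n f x - f x) < (1/2) ^ Suc k" for k
    using L2_approx[OF f, of "(1/2) ^ Suc k"] by force
  then obtain N where N: "\<And>k. L2_norm (\<lambda>x. truncate (N k) f x - f x) < (1/2) ^ Suc k"
    by metis
  define F where "F k = truncate (N k) f" for k
  have F1: "integrable lborel (F k)" for k
    unfolding F_def by (rule truncate_integrable) (rule L2_measurable[OF f])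
  have F2: "F k \<in> L2" for k
    unfolding F_def by (rule L2_tendstoD(1)[OF truncate_L2_tendsto[OF f]])
  have Ff: "L2_tendsto F f"
  proof (rule L2_tendsto_bound[OF F2 f])
    show "L2_norm (\<lambda>x. F k x - f x) \<le> (1/2) ^ Suc k" for k
      unfolding F_def using N[of k] by simp
    show "(\<lambda>k. (1/2 :: real) ^ Suc k) \<longlonglongrightarrow> 0"
      by (intro LIMSEQ_Suc LIMSEQ_power_zero) simp
  qed
  have "L2_norm (\<lambda>x. fourier (F (Suc k)) x - fourier (F k) x) \<le> (1/2) ^ k" for k
  proof -
    have "L2_norm (\<lambda>x. fourier (F (Suc k)) x - fourier (F k) x)
        = L2_norm (fourier (\<lambda>x. 1 * F (Suc k) x + (- 1) * F k x))"
      unfolding fourier_linear[OF F1 F1] by simp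
    also have "\<dots> = L2_norm (\<lambda>x. 1 * F (Suc k) x + (- 1) * F k x)"
      by (intro Plancherel_L1_L2 L2_linear F2) (simp add: F1)
    also have "\<dots> = L2_norm (\<lambda>x. F (Suc k) x - F k x)" by simp
    also have "\<dots> \<le> L2_norm (\<lambda>x. F (Suc k) x - f x) + L2_norm (\<lambda>x. f x - F k x)"
      by (intro L2_norm_triangle_diff F2 f)
    also have "\<dots> \<le> (1/2) ^ Suc (Suc k) + (1/2) ^ Suc k"
      using N[of k] N[of "Suc k"] L2_norm_minus_commute[of f "F k"] by (simp add: F_def)
    also have "\<dots> \<le> (1/2) ^ k" by simp
    finally show ?thesis .
  qed
  then obtain u where "L2_tendsto (\<lambda>k. fourier (F k)) u"
    using L2_limit_exists[of "\<lambda>k. fourier (F k)"] Plancherel_L1_L2(1)[OF F1 F2] by blast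
  with Ff F1 have "u \<in> L2_fourier f" unfolding L2_fourier_def by (auto simp: L1_def)
  then show ?thesis by (rule that)
qed

lemma L2_fourier_L1_L2:
  assumes "integrable lborel f" "f \<in> L2"
  shows "fourier f \<in> L2_fourier f"
  unfolding L2_fourier_def mem_Collect_eq
  using assms Plancherel_L1_L2(1)[OF assms]
  by (intro exI[of _ "\<lambda>_. f"]) (auto simp: L1_def L2_tendsto_const)

lemma L2_class_eqI:
  assumes "\<And>v. v \<in> A \<Longrightarrow> v \<in> L2 \<and> (AE x in lborel. v x = u x)"
    and "\<And>v. v \<in> L2 \<Longrightarrow> AE x in lborel. u x = v x \<Longrightarrow> v \<in> A"
  shows "A = L2_class u"
proof -
  have "AE x in lborel. v x = u x \<Longrightarrow> AE x in lborel. u x = v x" for v :: "'a \<Rightarrow> complex"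
    by (simp add: eq_commute)
  with assms show ?thesis unfolding L2_class_def by blast
qed

lemma L2_fourier_eq_class:
  assumes u: "u \<in> L2_fourier f"
  shows "L2_fourier f = L2_class u"
  by (rule L2_class_eqI)
    (use L2_fourierD(2) L2_fourier_unique[OF _ u] L2_fourier_cong_AE(2)[OF u] L2_measurable in blast)+

lemma Parseval:
  assumes "u \<in> L2_fourier f" "v \<in> L2_fourier h"
  shows "L2_inner u v = L2_inner f h"
proof -
  have eq: "L2_norm (\<lambda>x. 1 * u x + c * v x) = L2_norm (\<lambda>x. 1 * f x + c * h x)" for c
    by (intro L2_fourierD(3) L2_fourier_linear assms)
  have "4 * L2_inner u v = 4 * L2_inner f h"
    unfolding L2_polarization[OF L2_fourierD(2)[OF assms(1)] L2_fourierD(2)[OF assms(2)]] eq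
      L2_polarization[OF L2_fourierD(1)[OF assms(1)] L2_fourierD(1)[OF assms(2)]] ..
  then show ?thesis by simp
qed

section \<open>The inverse transform and time-frequency shifts\<close>

lemma L2_tendsto_reflect:
  assumes "L2_tendsto F f"
  shows "L2_tendsto (\<lambda>n x. F n (- x)) (\<lambda>x. f (- x))"
proof -
  note F = L2_tendstoD[OF assms]
  have "L2_norm (\<lambda>x. F n (- x) - f (- x)) = L2_norm (\<lambda>x. F n x - f x)" for n
    using L2_norm_reflect[OF L2_diff[OF F(1,2)]] by simp
  then show ?thesis using F by (simp add: L2_tendsto_def L2_reflect)
qed

lemma inv_fourier_eq_reflect:
  assumes [measurable]: "f \<in> borel_measurable borel"
  shows "inv_fourier f = fourier (\<lambda>x. f (- x))"
proof
  fix t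
  show "inv_fourier f t = fourier (\<lambda>x. f (- x)) t"
    unfolding inv_fourier_eq fourier_eq
    using integral_lborel_uminus[of "\<lambda>x. chi (t \<bullet> x) * f x"] by (simp add: inner_commute)
qed

text \<open>Reflecting the approximating sequences identifies the two defining sets, so existence,
  uniqueness, isometry and linearity transfer from \<open>L2_fourier\<close>.\<close>

lemma L2_inv_fourier_eq_reflect: "L2_inv_fourier f = L2_fourier (\<lambda>x. f (- x))"
proof (intro set_eqI iffI)
  fix u
  assume "u \<in> L2_inv_fourier f"
  then obtain F where F: "\<And>n. F n \<in> L1" "L2_tendsto F f" "L2_tendsto (\<lambda>n. inv_fourier (F n)) u"
    unfolding L2_inv_fourier_def by blast
  have "(\<lambda>x. F n (- x)) \<in> L1" for n
    using F(1)[of n] integrable_lborel_uminus[OF L1_measurable[OF F(1)[of n]]] by (simp add: L1_def)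
  moreover have "inv_fourier (F n) = fourier (\<lambda>x. F n (- x))" for n
    by (rule inv_fourier_eq_reflect[OF L1_measurable[OF F(1)]])
  ultimately show "u \<in> L2_fourier (\<lambda>x. f (- x))"
    unfolding L2_fourier_def mem_Collect_eq using F(3) L2_tendsto_reflect[OF F(2)]
    by (intro exI[of _ "\<lambda>n x. F n (- x)"]) auto
next
  fix u
  assume "u \<in> L2_fourier (\<lambda>x. f (- x))"
  then obtain F where F: "\<And>n. F n \<in> L1" "L2_tendsto F (\<lambda>x. f (- x))" "L2_tendsto (\<lambda>n. fourier (F n)) u"
    unfolding L2_fourier_def by blast
  have r: "(\<lambda>x. F n (- x)) \<in> L1" for n
    using F(1)[of n] integrable_lborel_uminus[OF L1_measurable[OF F(1)[of n]]] by (simp add: L1_def)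
  moreover have "inv_fourier (\<lambda>x. F n (- x)) = fourier (F n)" for n
    using inv_fourier_eq_reflect[OF L1_measurable[OF r[of n]]] by simp
  ultimately show "u \<in> L2_inv_fourier f"
    unfolding L2_inv_fourier_def mem_Collect_eq using F(3) L2_tendsto_reflect[OF F(2)]
    by (intro exI[of _ "\<lambda>n x. F n (- x)"]) auto
qed

lemma fourier_cnj: "fourier (\<lambda>x. cnj (f x)) \<omega> = cnj (fourier f (- \<omega>))"
  unfolding fourier_eq Bochner_Integration.integral_cnj[symmetric]
  by (rule Bochner_Integration.integral_cong) simp_all

text \<open>For integrable approximants this is the multiplication formula after a reflection, and
  continuity of the inner product gives the general case. It brings the weak form of the STFT
  multiplier, computed on the frequency side, back to an inner product with
  \<open>h\<close>.\<close>

lemma L2_inv_fourier_adjoint: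
  assumes u: "u \<in> L2_inv_fourier w" and v: "v \<in> L2_fourier h"
  shows "L2_inner u h = L2_inner w v"
proof -
  obtain F where F: "\<And>n. F n \<in> L1" "L2_tendsto F w" "L2_tendsto (\<lambda>n. inv_fourier (F n)) u"
    using u unfolding L2_inv_fourier_def by blast
  obtain H where H: "\<And>n. H n \<in> L1" "L2_tendsto H h" "L2_tendsto (\<lambda>n. fourier (H n)) v"
    using v unfolding L2_fourier_def by blast
  have "L2_inner (inv_fourier (F n)) (H n) = L2_inner (F n) (fourier (H n))" for n
  proof -
    note [measurable] = L1_measurable[OF F(1)[of n]] L1_measurable[OF H(1)[of n]]
    have "L2_inner (inv_fourier (F n)) (H n) = (LINT x|lborel. fourier (\<lambda>x. F n (- x)) x * cnj (H n x))"
      unfolding L2_inner_def by (simp add: inv_fourier_eq_reflect)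
    also have "\<dots> = (LINT x|lborel. F n (- x) * fourier (\<lambda>x. cnj (H n x)) x)"
      using F(1)[of n] H(1)[of n] by (intro fourier_swap) (simp_all add: L1_def integrable_lborel_uminus)
    also have "\<dots> = L2_inner (F n) (fourier (H n))"
      unfolding L2_inner_def fourier_cnj
      using integral_lborel_uminus[of "\<lambda>x. F n x * cnj (fourier (H n) x)"] by simp
    finally show ?thesis .
  qed
  with L2_inner_tendsto[OF F(3) H(2)] have "(\<lambda>n. L2_inner (F n) (fourier (H n))) \<longlonglongrightarrow> L2_inner u h" by simp
  with L2_inner_tendsto[OF F(2) H(3)] show ?thesis by (rule LIMSEQ_unique[rotated])
qed

lemma L2_tendsto_chi_translate:
  assumes "L2_tendsto F f" and [measurable]: "p \<in> borel_measurable borel"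
  shows "L2_tendsto (\<lambda>n x. chi (p x) * F n (x - a)) (\<lambda>x. chi (p x) * f (x - a))"
proof -
  note F = L2_tendstoD[OF assms(1)]
  have L2: "(\<lambda>x. chi (p x) * h (x - a)) \<in> L2" if "h \<in> L2" for h
    by (rule L2_bounded_mult(1)[OF L2_translate[OF that], where B=1]) auto
  have "L2_norm (\<lambda>x. chi (p x) * F n (x - a) - chi (p x) * f (x - a)) = L2_norm (\<lambda>x. F n x - f x)" for n
  proof -
    have "L2_norm (\<lambda>x. chi (p x) * F n (x - a) - chi (p x) * f (x - a)) = L2_norm (\<lambda>x. F n (x - a) - f (x - a))"
      unfolding L2_norm_def right_diff_distrib[symmetric] by (simp add: norm_mult)
    then show ?thesis using L2_norm_translate[OF L2_diff[OF F(1,2)]] by simp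
  qed
  then show ?thesis using F L2 by (simp add: L2_tendsto_def)
qed

lemma fourier_modulation_translation:
  assumes [measurable]: "g \<in> borel_measurable borel"
  shows "fourier (modulation \<omega> (translation x g)) \<xi> = chi (- (x \<bullet> (\<xi> - \<omega>))) * fourier g (\<xi> - \<omega>)"
proof -
  have "fourier (modulation \<omega> (translation x g)) \<xi>
      = (LINT t|lborel. chi (- (t \<bullet> \<xi>)) * (chi (t \<bullet> \<omega>) * g (t - x)))"
    unfolding fourier_eq modulation_eq translation_def ..
  also have "\<dots> = (LINT t|lborel. chi (- ((t + x) \<bullet> \<xi>)) * (chi ((t + x) \<bullet> \<omega>) * g (t + x - x)))"
    using integral_lborel_translate[of "\<lambda>t. chi (- (t \<bullet> \<xi>)) * (chi (t \<bullet> \<omega>) * g (t - x))" "- x"] by simp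
  also have "\<dots> = (LINT t|lborel. chi (- (x \<bullet> (\<xi> - \<omega>))) * (chi (- (t \<bullet> (\<xi> - \<omega>))) * g t))"
  proof (rule Bochner_Integration.integral_cong)
    fix t
    have "chi (- ((t + x) \<bullet> \<xi>)) * chi ((t + x) \<bullet> \<omega>) = chi (- (x \<bullet> (\<xi> - \<omega>))) * chi (- (t \<bullet> (\<xi> - \<omega>)))"
      unfolding chi_add[symmetric] by (simp add: algebra_simps)
    then show "chi (- ((t + x) \<bullet> \<xi>)) * (chi ((t + x) \<bullet> \<omega>) * g (t + x - x))
       = chi (- (x \<bullet> (\<xi> - \<omega>))) * (chi (- (t \<bullet> (\<xi> - \<omega>))) * g t)"
      by (simp add: mult.assoc[symmetric])
  qed simp
  also have "\<dots> = chi (- (x \<bullet> (\<xi> - \<omega>))) * fourier g (\<xi> - \<omega>)"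
    unfolding fourier_eq by (rule integral_mult_right_zero)
  finally show ?thesis .
qed

lemma L2_fourier_modulation_translation:
  assumes "v \<in> L2_fourier g"
  shows "(\<lambda>\<xi>. chi (- (x \<bullet> (\<xi> - \<omega>))) * v (\<xi> - \<omega>)) \<in> L2_fourier (modulation \<omega> (translation x g))"
proof -
  obtain F where F: "\<And>n. F n \<in> L1" "L2_tendsto F g" "L2_tendsto (\<lambda>n. fourier (F n)) v"
    using assms unfolding L2_fourier_def by blast
  have "modulation \<omega> (translation x (F n)) \<in> L1" for n
    unfolding L1_def mem_Collect_eq modulation_eq[abs_def] translation_def
    by (intro integrable_chi_mult)
      (use F(1)[of n] integrable_lborel_translate[OF L1_measurable[OF F(1)[of n]]] in \<open>auto simp: L1_def\<close>)
  moreover have "L2_tendsto (\<lambda>n. modulation \<omega> (translation x (F n))) (modulation \<omega> (translation x g))"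
    unfolding modulation_eq[abs_def] translation_def
    by (rule L2_tendsto_chi_translate[OF F(2)]) measurable
  moreover have "fourier (modulation \<omega> (translation x (F n))) = (\<lambda>\<xi>. chi (- (x \<bullet> (\<xi> - \<omega>))) * fourier (F n) (\<xi> - \<omega>))" for n
    by (rule ext) (rule fourier_modulation_translation[OF L1_measurable[OF F(1)]])
  moreover have "L2_tendsto (\<lambda>n \<xi>. chi (- (x \<bullet> (\<xi> - \<omega>))) * fourier (F n) (\<xi> - \<omega>))
      (\<lambda>\<xi>. chi (- (x \<bullet> (\<xi> - \<omega>))) * v (\<xi> - \<omega>))"
    by (rule L2_tendsto_chi_translate[OF F(3)]) measurable
  ultimately show ?thesis unfolding L2_fourier_def mem_Collect_eq
    by (intro exI[of _ "\<lambda>n. modulation \<omega> (translation x (F n))"]) auto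
qed

section \<open>The short-time Fourier transform and multipliers\<close>

text \<open>The identity holds at every point, since the product of two L^2 functions is integrable
  and \<open>inv_fourier\<close> is then a genuine integral. The phase in front has modulus 1 and
  cancels when two such transforms are paired at the same point.\<close>

lemma stft_eq:
  assumes u: "u \<in> L2_fourier f" and v: "v \<in> L2_fourier g"
  shows "stft g f (x, \<omega>) = chi (- (x \<bullet> \<omega>)) * inv_fourier (\<lambda>\<xi>. u \<xi> * cnj (v (\<xi> - \<omega>))) x"
proof -
  have "stft g f (x, \<omega>) = L2_inner u (\<lambda>\<xi>. chi (- (x \<bullet> (\<xi> - \<omega>))) * v (\<xi> - \<omega>))"
    unfolding stft_def prod.case
    by (rule Parseval[symmetric, OF u L2_fourier_modulation_translation[OF v]])
  also have "\<dots> = (LINT \<xi>|lborel. chi (- (x \<bullet> \<omega>)) * (chi (x \<bullet> \<xi>) * (u \<xi> * cnj (v (\<xi> - \<omega>)))))"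
    unfolding L2_inner_def
  proof (rule Bochner_Integration.integral_cong)
    fix \<xi>
    have "chi (x \<bullet> (\<xi> - \<omega>)) = chi (- (x \<bullet> \<omega>)) * chi (x \<bullet> \<xi>)"
      unfolding chi_add[symmetric] by (simp add: inner_diff_right)
    then show "u \<xi> * cnj (chi (- (x \<bullet> (\<xi> - \<omega>))) * v (\<xi> - \<omega>))
        = chi (- (x \<bullet> \<omega>)) * (chi (x \<bullet> \<xi>) * (u \<xi> * cnj (v (\<xi> - \<omega>))))"
      by (simp add: ac_simps)
  qed simp
  also have "\<dots> = chi (- (x \<bullet> \<omega>)) * inv_fourier (\<lambda>\<xi>. u \<xi> * cnj (v (\<xi> - \<omega>))) x"
    unfolding inv_fourier_eq by (rule integral_mult_right_zero)
  finally show ?thesis .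
qed

lemma inv_fourier_L2:
  assumes p: "integrable lborel p" "p \<in> L2"
  shows "inv_fourier p \<in> L2" "L2_norm (inv_fourier p) = L2_norm p"
  using p Plancherel_L1_L2[OF _ L2_reflect[OF p(2)]]
  by (simp_all add: inv_fourier_eq_reflect L2_measurable integrable_lborel_uminus L2_norm_reflect)

lemma inv_fourier_inner:
  assumes p: "integrable lborel p" "p \<in> L2" and q: "integrable lborel q" "q \<in> L2"
  shows "L2_inner (inv_fourier p) (inv_fourier q) = L2_inner p q"
proof -
  note [measurable] = L2_measurable[OF p(2)] L2_measurable[OF q(2)]
  have "L2_inner (inv_fourier p) (inv_fourier q) = L2_inner (\<lambda>x. p (- x)) (\<lambda>x. q (- x))"
    unfolding inv_fourier_eq_reflect[OF L2_measurable[OF p(2)]] inv_fourier_eq_reflect[OF L2_measurable[OF q(2)]]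
    by (intro Parseval L2_fourier_L1_L2 L2_reflect p q) (simp_all add: integrable_lborel_uminus p q)
  also have "\<dots> = L2_inner p q"
    unfolding L2_inner_def using integral_lborel_uminus[of "\<lambda>x. p x * cnj (q x)"] by simp
  finally show ?thesis .
qed

text \<open>Integrating over the shift first merely reflects \<open>G\<close>, so the total is the
  product of two L^1 norms. The lemma is applied once to squared moduli and once to the kernel of
  the STFT multiplier.\<close>

lemma integrable_translation_kernel:
  fixes F G :: "'a::euclidean_space \<Rightarrow> complex"
  assumes F: "integrable lborel F" and G: "integrable lborel G"
  shows "integrable (lborel \<Otimes>\<^sub>M lborel) (\<lambda>(\<xi>, \<omega>). F \<xi> * G (\<xi> - \<omega>))"
proof (rule lborel_pair.Fubini_integrable)
  note [measurable] = borel_measurable_integrable[OF F, simplified] borel_measurable_integrable[OF G, simplified]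
  show "(\<lambda>(\<xi>, \<omega>). F \<xi> * G (\<xi> - \<omega>)) \<in> borel_measurable (lborel \<Otimes>\<^sub>M lborel)"
    by measurable
  have "(LINT \<omega>|lborel. norm (G (\<xi> - \<omega>))) = (LINT \<omega>|lborel. norm (G \<omega>))" for \<xi>
    by (rule integral_lborel_reflect) measurable
  then show "integrable lborel (\<lambda>\<xi>. LINT \<omega>|lborel. norm (case (\<xi>, \<omega>) of (\<xi>, \<omega>) \<Rightarrow> F \<xi> * G (\<xi> - \<omega>)))"
    using F by (simp add: norm_mult)
  show "AE \<xi> in lborel. integrable lborel (\<lambda>\<omega>. case (\<xi>, \<omega>) of (\<xi>, \<omega>) \<Rightarrow> F \<xi> * G (\<xi> - \<omega>))"
    using G by (intro AE_I2) (simp add: integrable_lborel_reflect)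
qed

lemma L2_mult_translate_kernel:
  assumes u: "u \<in> L2" and v: "v \<in> L2"
  shows "integrable (lborel \<Otimes>\<^sub>M lborel) (\<lambda>(\<xi>, \<omega>). (norm (u \<xi> * cnj (v (\<xi> - \<omega>))))\<^sup>2)"
proof -
  have "integrable lborel (\<lambda>\<xi>. complex_of_real ((norm (u \<xi>))\<^sup>2))" "integrable lborel (\<lambda>\<xi>. complex_of_real ((norm (v \<xi>))\<^sup>2))"
    using u v unfolding L2_iff by (intro integrable_of_real; simp)+
  from integrable_norm[OF integrable_translation_kernel[OF this]]
  show ?thesis by (simp add: split_def norm_mult power_mult_distrib norm_power)
qed

text \<open>The product is integrable for every \<omega>. Its square is only known to be integrable
  for almost every \<omega>, as a slice of an integrable function of two variables; hence
  Plancherel's theorem in the time variable holds slicewise almost everywhere.\<close>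

lemma
  assumes u: "u \<in> L2" and v: "v \<in> L2"
  shows L1_mult_translate: "integrable lborel (\<lambda>\<xi>. u \<xi> * cnj (v (\<xi> - \<omega>)))"
    and AE_L2_mult_translate: "AE \<omega> in lborel. (\<lambda>\<xi>. u \<xi> * cnj (v (\<xi> - \<omega>))) \<in> L2"
proof -
  note [measurable] = L2_measurable[OF u] L2_measurable[OF v]
  show "integrable lborel (\<lambda>\<xi>. u \<xi> * cnj (v (\<xi> - \<omega>)))"
    by (intro L2_mult_integrable u L2_cnj L2_translate v)
  show "AE \<omega> in lborel. (\<lambda>\<xi>. u \<xi> * cnj (v (\<xi> - \<omega>))) \<in> L2"
    using lborel_pair.AE_integrable_snd[OF L2_mult_translate_kernel[OF u v]]
    by eventually_elim (simp add: L2_iff)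
qed

lemma stft_measurable:
  fixes f g :: "'a::euclidean_space \<Rightarrow> complex"
  assumes [measurable]: "f \<in> borel_measurable borel" "g \<in> borel_measurable borel"
  shows "stft g f \<in> borel_measurable (lborel \<Otimes>\<^sub>M lborel)"
  unfolding stft_def L2_inner_def modulation_eq translation_def by measurable

lemma measurable_lborel_pair:
  "borel_measurable (lborel \<Otimes>\<^sub>M lborel :: ('a::euclidean_space \<times> 'b::euclidean_space) measure) = borel_measurable borel"
  unfolding lborel_prod by simp

text \<open>For almost every \<omega>, Plancherel's theorem in x replaces the slice of the STFT by a
  product of transforms, and these products are square integrable in both variables by
  \<open>L2_mult_translate_kernel\<close>.\<close>

lemma stft_L2:
  fixes f g :: "'a::euclidean_space \<Rightarrow> complex"
  assumes f: "f \<in> L2" and g: "g \<in> L2"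
  shows "stft g f \<in> L2"
proof -
  note [measurable] = L2_measurable[OF f] L2_measurable[OF g]
  obtain u where u: "u \<in> L2_fourier f" using L2_fourier_exists[OF f] .
  obtain v where v: "v \<in> L2_fourier g" using L2_fourier_exists[OF g] .
  note u2 = L2_fourierD(2)[OF u] and v2 = L2_fourierD(2)[OF v]
  note [measurable] = L2_measurable[OF u2] L2_measurable[OF v2]
  note [measurable] = stft_measurable[of f g]
  have n: "norm (stft g f (x, \<omega>)) = norm (inv_fourier (\<lambda>\<xi>. u \<xi> * cnj (v (\<xi> - \<omega>))) x)" for x \<omega>
    unfolding stft_eq[OF u v] by (simp add: norm_mult)
  \<comment> \<open>The coordinates are exchanged so that the Fubini criterion integrates over x
    first, with \<omega> fixed; the swap is undone at the end.\<close>
  let ?W = "\<lambda>(\<omega>, x). (norm (stft g f (x, \<omega>)))\<^sup>2"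
  have slice: "AE \<omega> in lborel. integrable lborel (\<lambda>x. (norm (stft g f (x, \<omega>)))\<^sup>2) \<and>
      (LINT x|lborel. (norm (stft g f (x, \<omega>)))\<^sup>2) = (LINT \<xi>|lborel. (norm (u \<xi> * cnj (v (\<xi> - \<omega>))))\<^sup>2)"
    using AE_L2_mult_translate[OF u2 v2]
  proof eventually_elim
    case (elim \<omega>)
    note p = inv_fourier_L2[OF L1_mult_translate[OF u2 v2] elim]
    from p(2) have "(L2_norm (inv_fourier (\<lambda>\<xi>. u \<xi> * cnj (v (\<xi> - \<omega>)))))\<^sup>2 = (L2_norm (\<lambda>\<xi>. u \<xi> * cnj (v (\<xi> - \<omega>))))\<^sup>2"
      by simp
    with p(1) show ?case unfolding n L2_norm_sq by (simp add: L2_iff)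
  qed
  have "integrable (lborel \<Otimes>\<^sub>M lborel) ?W"
  proof (rule lborel_pair.Fubini_integrable)
    show "?W \<in> borel_measurable (lborel \<Otimes>\<^sub>M lborel)" by measurable
    show "AE \<omega> in lborel. integrable lborel (\<lambda>x. ?W (\<omega>, x))"
      using slice by eventually_elim simp
    have "integrable lborel (\<lambda>\<omega>. LINT x|lborel. (norm (stft g f (x, \<omega>)))\<^sup>2)
      \<longleftrightarrow> integrable lborel (\<lambda>\<omega>. LINT \<xi>|lborel. (norm (u \<xi> * cnj (v (\<xi> - \<omega>))))\<^sup>2)"
    proof (rule integrable_cong_AE)
      show "AE \<omega> in lborel. (LINT x|lborel. (norm (stft g f (x, \<omega>)))\<^sup>2) = (LINT \<xi>|lborel. (norm (u \<xi> * cnj (v (\<xi> - \<omega>))))\<^sup>2)"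
        using slice by eventually_elim simp
    qed measurable
    then show "integrable lborel (\<lambda>\<omega>. LINT x|lborel. norm (?W (\<omega>, x)))"
      using lborel_pair.integrable_snd[OF L2_mult_translate_kernel[OF u2 v2]] by simp
  qed
  then have "integrable (lborel \<Otimes>\<^sub>M lborel) (\<lambda>z. (norm (stft g f z))\<^sup>2)"
    using lborel_pair.integrable_product_swap_iff[of ?W] by (simp add: split_def)
  then show ?thesis
    using stft_measurable[of f g] unfolding L2_iff measurable_lborel_pair lborel_prod by simp
qed

lemma AE_one_tensor:
  assumes [measurable]: "m \<in> borel_measurable borel" and B: "AE \<omega> in lborel. norm (m \<omega>) \<le> B"
  shows "one_tensor m \<in> borel_measurable borel"
    and "AE z in (lborel :: ('a::euclidean_space \<times> 'a) measure). norm (one_tensor m z) \<le> B"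
proof -
  have "one_tensor m \<in> borel_measurable (lborel \<Otimes>\<^sub>M lborel)"
    unfolding one_tensor_def by measurable
  then show "one_tensor m \<in> borel_measurable borel" unfolding measurable_lborel_pair .
  have "AE z in (lborel \<Otimes>\<^sub>M lborel :: ('a \<times> 'a) measure). norm (m (snd z)) \<le> B"
  proof (rule lborel_pair.AE_pair_measure)
    show "{z \<in> space (lborel \<Otimes>\<^sub>M lborel :: ('a \<times> 'a) measure). norm (m (snd z)) \<le> B} \<in> sets (lborel \<Otimes>\<^sub>M lborel)"
      by measurable
  qed (use B in simp)
  then show "AE z in (lborel :: ('a \<times> 'a) measure). norm (one_tensor m z) \<le> B"
    unfolding lborel_prod by (simp add: one_tensor_def split_def)
qed

lemma
  fixes m :: "'a::euclidean_space \<Rightarrow> complex"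
  assumes [measurable]: "m \<in> borel_measurable borel" and B: "AE \<omega> in lborel. norm (m \<omega>) \<le> B"
    and K: "integrable lborel K"
  shows convolution_measurable: "Defs.convolution m K \<in> borel_measurable borel"
    and norm_convolution_le: "norm (Defs.convolution m K x) \<le> B * (LINT y|lborel. norm (K y))"
proof -
  note [measurable] = borel_measurable_integrable[OF K, simplified]
  show "Defs.convolution m K \<in> borel_measurable borel"
    unfolding Defs.convolution_def[abs_def] by measurable
  have K': "integrable lborel (\<lambda>y. K (x - y))" using K by (simp add: integrable_lborel_reflect)
  have i: "integrable lborel (\<lambda>y. m y * K (x - y))"
    by (rule integrable_mult_bounded[OF K' _ B]) measurable
  have "norm (Defs.convolution m K x) \<le> (LINT y|lborel. norm (m y * K (x - y)))"
    unfolding Defs.convolution_def by (rule integral_norm_bound)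
  also have "\<dots> \<le> (LINT y|lborel. B * norm (K (x - y)))"
  proof (rule integral_mono_AE)
    show "integrable lborel (\<lambda>y. norm (m y * K (x - y)))" by (rule integrable_norm[OF i])
    show "integrable lborel (\<lambda>y. B * norm (K (x - y)))" using K' by simp
    show "AE y in lborel. norm (m y * K (x - y)) \<le> B * norm (K (x - y))"
      using B by eventually_elim (auto simp: norm_mult intro: mult_right_mono)
  qed
  also have "\<dots> = B * (LINT y|lborel. norm (K y))"
    using integral_lborel_reflect[of "\<lambda>y. norm (K y)" x] by simp
  finally show "norm (Defs.convolution m K x) \<le> B * (LINT y|lborel. norm (K y))" .
qed

text \<open>Fubini's theorem is used for two different double integrals: in time and frequency,
  where integrability comes from two L^2 STFTs, and in two frequencies, where it comes from a kernel
  built of L^1 functions. Parseval in x, slice by slice, leads from one to the other.\<close>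

lemma
  fixes m :: "'a::euclidean_space \<Rightarrow> complex"
  assumes m: "m \<in> Linf" and f: "u \<in> L2_fourier f" and h: "w \<in> L2_fourier h"
    and g1: "v1 \<in> L2_fourier g1" and g2: "v2 \<in> L2_fourier g2"
  shows stft_multiplier_integrable:
      "integrable lborel (\<lambda>z. one_tensor m z * stft g1 f z * cnj (stft g2 h z))"
    and stft_multiplier_integral:
      "(LINT z|lborel. one_tensor m z * stft g1 f z * cnj (stft g2 h z))
        = L2_inner (\<lambda>\<xi>. Defs.convolution m (\<lambda>\<xi>. v2 \<xi> * cnj (v1 \<xi>)) \<xi> * u \<xi>) w"
proof -
  note L2 = L2_fourierD(1)[OF f] L2_fourierD(1)[OF h] L2_fourierD(1)[OF g1] L2_fourierD(1)[OF g2]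
  note u = L2_fourierD(2)[OF f] and w = L2_fourierD(2)[OF h] and v1 = L2_fourierD(2)[OF g1] and v2 = L2_fourierD(2)[OF g2]
  note [measurable] = L2_measurable[OF u] L2_measurable[OF v1] L2_measurable[OF w] L2_measurable[OF v2]
    L2[THEN L2_measurable]
  obtain B where B: "AE \<omega> in lborel. norm (m \<omega>) \<le> B" and mm[measurable]: "m \<in> borel_measurable borel"
    using m by (auto simp: Linf_def)
  have "integrable lborel (\<lambda>z. stft g1 f z * cnj (stft g2 h z))"
    by (intro L2_mult_integrable L2_cnj stft_L2 L2)
  from integrable_mult_bounded[OF this AE_one_tensor[OF mm B]]
  show int: "integrable lborel (\<lambda>z. one_tensor m z * stft g1 f z * cnj (stft g2 h z))"
    by (simp add: mult.assoc)
  have int': "integrable (lborel \<Otimes>\<^sub>M lborel)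
      (case_prod (\<lambda>x \<omega>. m \<omega> * stft g1 f (x, \<omega>) * cnj (stft g2 h (x, \<omega>))))"
    using int unfolding lborel_prod by (simp add: split_def one_tensor_def)
  note [measurable] = stft_measurable[of f g1] stft_measurable[of h g2]
  define K where "K = (\<lambda>\<xi>. v2 \<xi> * cnj (v1 \<xi>))"
  define F where "F = (\<lambda>\<xi>. u \<xi> * cnj (w \<xi>))"
  have K: "integrable lborel K" and F: "integrable lborel F"
    unfolding K_def F_def by (intro L2_mult_integrable L2_cnj u w v1 v2)+
  have Km[measurable]: "K \<in> borel_measurable borel" and Fm[measurable]: "F \<in> borel_measurable borel"
    unfolding K_def F_def by measurable
  have slice: "AE \<omega> in lborel. (LINT x|lborel. m \<omega> * stft g1 f (x, \<omega>) * cnj (stft g2 h (x, \<omega>)))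
      = (LINT \<xi>|lborel. m \<omega> * (F \<xi> * K (\<xi> - \<omega>)))"
    using AE_L2_mult_translate[OF u v1] AE_L2_mult_translate[OF w v2]
  proof eventually_elim
    case (elim \<omega>)
    let ?p = "\<lambda>\<xi>. u \<xi> * cnj (v1 (\<xi> - \<omega>))" and ?q = "\<lambda>\<xi>. w \<xi> * cnj (v2 (\<xi> - \<omega>))"
    have "(LINT x|lborel. m \<omega> * stft g1 f (x, \<omega>) * cnj (stft g2 h (x, \<omega>)))
        = (LINT x|lborel. m \<omega> * (inv_fourier ?p x * cnj (inv_fourier ?q x)))"
    proof (rule Bochner_Integration.integral_cong)
      fix x
      show "m \<omega> * stft g1 f (x, \<omega>) * cnj (stft g2 h (x, \<omega>)) = m \<omega> * (inv_fourier ?p x * cnj (inv_fourier ?q x))"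
        unfolding stft_eq[OF f g1] stft_eq[OF h g2]
        using chi_mult_minus(1)[of "x \<bullet> \<omega>"] by (simp add: ac_simps)
    qed simp
    also have "\<dots> = m \<omega> * L2_inner (inv_fourier ?p) (inv_fourier ?q)"
      unfolding L2_inner_def by (rule integral_mult_right_zero)
    also have "L2_inner (inv_fourier ?p) (inv_fourier ?q) = L2_inner ?p ?q"
      by (intro inv_fourier_inner L1_mult_translate u v1 w v2 elim)
    also have "m \<omega> * L2_inner ?p ?q = (LINT \<xi>|lborel. m \<omega> * (?p \<xi> * cnj (?q \<xi>)))"
      unfolding L2_inner_def by (rule integral_mult_right_zero[symmetric])
    \<comment> \<open>Regrouping the four factors separates the functions \<open>u\<close>,
      \<open>w\<close> at \<xi> from the windows \<open>v1\<close>, \<open>v2\<close> at \<xi> -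
      \<omega>, which makes the \<omega>-integral a convolution.\<close>
    also have "\<dots> = (LINT \<xi>|lborel. m \<omega> * (F \<xi> * K (\<xi> - \<omega>)))"
      by (intro Bochner_Integration.integral_cong) (simp_all add: F_def K_def ac_simps)
    finally show ?case .
  qed
  have B2: "AE z in (lborel \<Otimes>\<^sub>M lborel :: ('a \<times> 'a) measure). norm (m (snd z)) \<le> B"
    using AE_one_tensor(2)[OF mm B] unfolding lborel_prod by (simp add: one_tensor_def split_def)
  have kern: "integrable (lborel \<Otimes>\<^sub>M lborel) (case_prod (\<lambda>\<xi> \<omega>. m \<omega> * (F \<xi> * K (\<xi> - \<omega>))))"
  proof (rule Bochner_Integration.integrable_bound)
    show "integrable (lborel \<Otimes>\<^sub>M lborel) (\<lambda>z. B * norm (case z of (\<xi>, \<omega>) \<Rightarrow> F \<xi> * K (\<xi> - \<omega>)))"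
      by (intro integrable_mult_right integrable_norm integrable_translation_kernel F K)
    show "AE z in lborel \<Otimes>\<^sub>M lborel. norm (case z of (\<xi>, \<omega>) \<Rightarrow> m \<omega> * (F \<xi> * K (\<xi> - \<omega>)))
        \<le> norm (B * norm (case z of (\<xi>, \<omega>) \<Rightarrow> F \<xi> * K (\<xi> - \<omega>)))"
      using B2
    proof eventually_elim
      case (elim z)
      then have "norm (m (snd z)) * norm (F (fst z) * K (fst z - snd z)) \<le> B * norm (F (fst z) * K (fst z - snd z))"
        by (intro mult_right_mono) auto
      then have "norm (m (snd z) * (F (fst z) * K (fst z - snd z))) \<le> norm (B * norm (F (fst z) * K (fst z - snd z)))"
        unfolding norm_mult[of "m (snd z)"] by (smt (verit) real_norm_def)
      then show ?case by (simp add: split_def)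
    qed
  qed measurable
  have "(LINT z|lborel. one_tensor m z * stft g1 f z * cnj (stft g2 h z))
     = (LINT z|(lborel \<Otimes>\<^sub>M lborel). (case_prod (\<lambda>x \<omega>. m \<omega> * stft g1 f (x, \<omega>) * cnj (stft g2 h (x, \<omega>)))) z)"
    unfolding lborel_prod by (simp add: split_def one_tensor_def)
  also have "\<dots> = (LINT \<omega>|lborel. LINT x|lborel. m \<omega> * stft g1 f (x, \<omega>) * cnj (stft g2 h (x, \<omega>)))"
    by (rule lborel_pair.integral_snd[OF int', symmetric])
  also have "\<dots> = (LINT \<omega>|lborel. LINT \<xi>|lborel. m \<omega> * (F \<xi> * K (\<xi> - \<omega>)))"
    by (rule integral_cong_AE[OF _ _ slice]) measurable
  also have "\<dots> = (LINT \<xi>|lborel. LINT \<omega>|lborel. m \<omega> * (F \<xi> * K (\<xi> - \<omega>)))"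
    by (rule lborel_pair.Fubini_integral[OF kern])
  also have "\<dots> = (LINT \<xi>|lborel. Defs.convolution m K \<xi> * u \<xi> * cnj (w \<xi>))"
  proof (rule Bochner_Integration.integral_cong)
    fix \<xi>
    have "(LINT \<omega>|lborel. m \<omega> * (F \<xi> * K (\<xi> - \<omega>))) = (LINT \<omega>|lborel. F \<xi> * (m \<omega> * K (\<xi> - \<omega>)))"
      by (simp add: ac_simps)
    also have "\<dots> = F \<xi> * Defs.convolution m K \<xi>"
      unfolding Defs.convolution_def by (rule integral_mult_right_zero)
    finally show "(LINT \<omega>|lborel. m \<omega> * (F \<xi> * K (\<xi> - \<omega>))) = Defs.convolution m K \<xi> * u \<xi> * cnj (w \<xi>)"
      by (simp add: F_def ac_simps)
  qed simp
  finally show "(LINT z|lborel. one_tensor m z * stft g1 f z * cnj (stft g2 h z))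
        = L2_inner (\<lambda>\<xi>. Defs.convolution m (\<lambda>\<xi>. v2 \<xi> * cnj (v1 \<xi>)) \<xi> * u \<xi>) w"
    unfolding K_def L2_inner_def .
qed

section \<open>Fourier multipliers and identification of the STFT multiplier\<close>

lemma convolution_Linf:
  assumes "m \<in> Linf" "integrable lborel K"
  shows "Defs.convolution m K \<in> Linf"
  using assms convolution_measurable norm_convolution_le unfolding Linf_def by fastforce

lemma Linf_mult_L2:
  assumes "m \<in> Linf" "u \<in> L2"
  shows "(\<lambda>x. m x * u x) \<in> L2"
  using assms L2_bounded_mult(1) unfolding Linf_def by auto

lemma L2_inv_fourier_exists:
  assumes "f \<in> L2"
  obtains u where "u \<in> L2_inv_fourier f"
  using L2_fourier_exists[OF L2_reflect[OF assms]] unfolding L2_inv_fourier_eq_reflect by blast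

lemma L2_inv_fourierD:
  assumes "u \<in> L2_inv_fourier f" "f \<in> L2"
  shows "u \<in> L2" "L2_norm u = L2_norm f" "L2_inv_fourier f = L2_class u"
  using L2_fourierD[of u "\<lambda>x. f (- x)"] L2_fourier_eq_class[of u "\<lambda>x. f (- x)"] assms
  unfolding L2_inv_fourier_eq_reflect by (simp_all add: L2_norm_reflect)

lemma L2_inv_fourier_cong_AE:
  assumes "AE x in lborel. f x = f' x" "f \<in> L2" "f' \<in> L2"
  shows "L2_inv_fourier f = L2_inv_fourier f'"
proof -
  obtain u where u: "u \<in> L2_inv_fourier f" using L2_inv_fourier_exists[OF assms(2)] .
  have "AE x in lborel. f (- x) = f' (- x)"
    using AE_lborel_isometry[of "-1" _ 0, OF _ assms(1)] by simp
  with u have "u \<in> L2_inv_fourier f'"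
    unfolding L2_inv_fourier_eq_reflect
    using L2_fourier_cong_AE(1)[of u "\<lambda>x. f (- x)" "\<lambda>x. f' (- x)"] L2_measurable[OF L2_reflect[OF assms(3)]]
    by simp
  with u show ?thesis using L2_inv_fourierD(3) assms by blast
qed

text \<open>The union in the definition collapses to one set: any two members of
  \<open>L2_fourier f\<close> agree almost everywhere, and \<open>L2_inv_fourier\<close> respects
  this.\<close>

lemma fourier_multiplier_eq:
  assumes m: "m \<in> Linf" and u: "u \<in> L2_fourier f" 
  shows "fourier_multiplier m f = L2_inv_fourier (\<lambda>\<omega>. m \<omega> * u \<omega>)"
proof -
  have "L2_inv_fourier (\<lambda>\<omega>. m \<omega> * v \<omega>) = L2_inv_fourier (\<lambda>\<omega>. m \<omega> * u \<omega>)" if v: "v \<in> L2_fourier f" for v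
  proof (rule L2_inv_fourier_cong_AE)
    show "AE x in lborel. m x * v x = m x * u x"
      using L2_fourier_unique[OF v u] by eventually_elim simp
  qed (intro Linf_mult_L2 m L2_fourierD(2)[OF v] L2_fourierD(2)[OF u])+
  then show ?thesis unfolding fourier_multiplier_def using u by blast
qed

lemma fourier_multiplier_bounded_linear:
  fixes m :: "'a::euclidean_space \<Rightarrow> complex"
  assumes m: "m \<in> Linf"
  shows "bounded_linear_operator_L2 (fourier_multiplier m)"
  unfolding bounded_linear_operator_L2_def
proof (intro conjI ballI allI)
  fix f :: "'a \<Rightarrow> complex" assume f: "f \<in> L2"
  obtain u where u: "u \<in> L2_fourier f" using L2_fourier_exists[OF f] .
  have mu: "(\<lambda>x. m x * u x) \<in> L2" by (rule Linf_mult_L2[OF m L2_fourierD(2)[OF u]])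
  obtain r where "r \<in> L2_inv_fourier (\<lambda>x. m x * u x)" using L2_inv_fourier_exists[OF mu] .
  then show "\<exists>r\<in>L2. fourier_multiplier m f = L2_class r"
    unfolding fourier_multiplier_eq[OF m u] using L2_inv_fourierD[OF _ mu] by blast
  fix f' assume "f' \<in> L2_class f"
  then have "f' \<in> L2" "AE x in lborel. f x = f' x" by (auto simp: L2_class_def eq_commute)
  then have "u \<in> L2_fourier f'"
    using L2_fourier_cong_AE(1)[OF u] L2_measurable by blast
  then show "fourier_multiplier m f' = fourier_multiplier m f"
    using fourier_multiplier_eq[OF m] u by simp
next
  fix f h u v :: "'a \<Rightarrow> complex" and c d
  assume f: "f \<in> L2" and h: "h \<in> L2" and u: "u \<in> fourier_multiplier m f" and v: "v \<in> fourier_multiplier m h"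
  obtain p where p: "p \<in> L2_fourier f" using L2_fourier_exists[OF f] .
  obtain q where q: "q \<in> L2_fourier h" using L2_fourier_exists[OF h] .
  have "u \<in> L2_fourier (\<lambda>\<omega>. m (- \<omega>) * p (- \<omega>))" "v \<in> L2_fourier (\<lambda>\<omega>. m (- \<omega>) * q (- \<omega>))"
    using u v unfolding fourier_multiplier_eq[OF m p] fourier_multiplier_eq[OF m q] L2_inv_fourier_eq_reflect .
  from L2_fourier_linear[OF this, of c d]
  show "(\<lambda>x. c * u x + d * v x) \<in> fourier_multiplier m (\<lambda>x. c * f x + d * h x)"
    unfolding fourier_multiplier_eq[OF m L2_fourier_linear[OF p q]] L2_inv_fourier_eq_reflect
    by (simp add: algebra_simps)
next
  obtain B where B: "AE x in lborel. norm (m x) \<le> B" and mm: "m \<in> borel_measurable borel"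
    using m by (auto simp: Linf_def)
  show "\<exists>B. \<forall>f\<in>L2. \<forall>u\<in>fourier_multiplier m f. L2_norm u \<le> B * L2_norm f"
  proof (intro exI ballI)
    fix f u assume f: "f \<in> L2" and u: "u \<in> fourier_multiplier m f"
    obtain p where p: "p \<in> L2_fourier f" using L2_fourier_exists[OF f] .
    note p2 = L2_fourierD(2)[OF p]
    have "L2_norm u = L2_norm (\<lambda>x. m x * p x)"
      using u unfolding fourier_multiplier_eq[OF m p] by (rule L2_inv_fourierD(2)[OF _ Linf_mult_L2[OF m p2]])
    also have "\<dots> \<le> B * L2_norm p" by (rule L2_bounded_mult(2)[OF p2 mm B])
    finally show "L2_norm u \<le> B * L2_norm f" unfolding L2_fourierD(3)[OF p] .
  qed
qed

text \<open>The test function is the difference u - v itself.\<close>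

lemma L2_inner_eqI:
  assumes u: "u \<in> L2" and v: "v \<in> L2" and eq: "\<And>h. h \<in> L2 \<Longrightarrow> L2_inner u h = L2_inner v h"
  shows "AE x in lborel. u x = v x"
proof -
  let ?d = "\<lambda>x. u x - v x"
  have d: "?d \<in> L2" by (rule L2_diff[OF u v])
  have "of_real ((L2_norm ?d)\<^sup>2) = (LINT x|lborel. u x * cnj (?d x) - v x * cnj (?d x))"
    unfolding L2_norm_sq Bochner_Integration.integral_complex_of_real[symmetric] complex_norm_square
    by (simp add: algebra_simps)
  also have "\<dots> = L2_inner u ?d - L2_inner v ?d"
    unfolding L2_inner_def
    by (rule Bochner_Integration.integral_diff) (intro L2_mult_integrable L2_cnj u v d)+
  also have "\<dots> = 0" using eq[OF d] by simp
  finally have "L2_norm ?d = 0" by simp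
  then show ?thesis using L2_norm_eq_0_iff[OF d] by simp
qed

text \<open>An inverse transform \<open>r\<close> of the convolved symbol times \<open>u\<close>
  satisfies the weak identity by the adjoint relation. Since L^2 functions are determined by their
  inner products, the set of all solutions is exactly the class of \<open>r\<close>.\<close>

lemma stft_multiplier_eq_fourier_multiplier:
  fixes m :: "'a::euclidean_space \<Rightarrow> complex"
  assumes m: "m \<in> Linf" and g1: "v1 \<in> L2_fourier g1" and g2: "v2 \<in> L2_fourier g2" and f: "f \<in> L2"
  shows "stft_multiplier g1 g2 (one_tensor m) f
    = fourier_multiplier (Defs.convolution m (\<lambda>\<xi>. v2 \<xi> * cnj (v1 \<xi>))) f"
proof -
  define M where "M = Defs.convolution m (\<lambda>\<xi>. v2 \<xi> * cnj (v1 \<xi>))"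
  have M: "M \<in> Linf"
    unfolding M_def by (intro convolution_Linf m L2_mult_integrable L2_cnj L2_fourierD(2)[OF g1] L2_fourierD(2)[OF g2])
  obtain u where u: "u \<in> L2_fourier f" using L2_fourier_exists[OF f] .
  have Mu: "(\<lambda>x. M x * u x) \<in> L2" by (rule Linf_mult_L2[OF M L2_fourierD(2)[OF u]])
  obtain r where r: "r \<in> L2_inv_fourier (\<lambda>x. M x * u x)" using L2_inv_fourier_exists[OF Mu] .
  note r2 = L2_inv_fourierD[OF r Mu]
  have weak: "integrable lborel (\<lambda>z. one_tensor m z * stft g1 f z * cnj (stft g2 h z)) \<and>
      (LINT z|lborel. one_tensor m z * stft g1 f z * cnj (stft g2 h z)) = L2_inner r h" if h: "h \<in> L2" for h
  proof -
    obtain w where w: "w \<in> L2_fourier h" using L2_fourier_exists[OF h] .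
    show ?thesis
      using stft_multiplier_integrable[OF m u w g1 g2] stft_multiplier_integral[OF m u w g1 g2]
        L2_inv_fourier_adjoint[OF r w] by (simp add: M_def)
  qed
  have "stft_multiplier g1 g2 (one_tensor m) f = {v \<in> L2. \<forall>h\<in>L2. L2_inner v h = L2_inner r h}"
    unfolding stft_multiplier_def using weak by auto
  also have "\<dots> = L2_class r"
  proof (rule L2_class_eqI)
    fix v assume "v \<in> {v \<in> L2. \<forall>h\<in>L2. L2_inner v h = L2_inner r h}"
    then show "v \<in> L2 \<and> (AE x in lborel. v x = r x)" using L2_inner_eqI[OF _ r2(1)] by blast
  next
    fix v assume v: "v \<in> L2" and eq: "AE x in lborel. r x = v x"
    have "L2_inner v h = L2_inner r h" if h: "h \<in> L2" for h
      unfolding L2_inner_def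
    proof (rule integral_cong_AE)
      show "AE x in lborel. v x * cnj (h x) = r x * cnj (h x)" using eq by eventually_elim simp
    qed (use L2_measurable[OF v] L2_measurable[OF r2(1)] L2_measurable[OF h] in measurable)
    with v show "v \<in> {v \<in> L2. \<forall>h\<in>L2. L2_inner v h = L2_inner r h}" by blast
  qed
  also have "\<dots> = fourier_multiplier M f"
    unfolding fourier_multiplier_eq[OF M u] r2(3) ..
  finally show ?thesis unfolding M_def .
qed

lemma bounded_linear_operator_L2_cong:
  assumes "\<And>f. f \<in> L2 \<Longrightarrow> A f = A' f" "bounded_linear_operator_L2 A'"
  shows "bounded_linear_operator_L2 (A :: ('a::euclidean_space \<Rightarrow> complex) \<Rightarrow> ('a \<Rightarrow> complex) set)"
proof -
  note A' = assms(2)[unfolded bounded_linear_operator_L2_def]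
  have lin: "A (\<lambda>x. c * f x + d * h x) = A' (\<lambda>x. c * f x + d * h x)" if "f \<in> L2" "h \<in> L2" for f h c d
    by (intro assms(1) L2_linear that)
  show ?thesis
    unfolding bounded_linear_operator_L2_def
  proof (intro conjI ballI allI)
    fix f :: "'a \<Rightarrow> complex" assume f: "f \<in> L2"
    show "\<exists>u\<in>L2. A f = L2_class u" using A' f assms(1)[OF f] by simp
    fix f' assume f': "f' \<in> L2_class f"
    then have "f' \<in> L2" by (simp add: L2_class_def)
    then show "A f' = A f" using A' f f' assms(1) by simp
  next
    fix f h u v :: "'a \<Rightarrow> complex" and c d
    assume "f \<in> L2" "h \<in> L2" "u \<in> A f" "v \<in> A h"
    then show "(\<lambda>x. c * u x + d * v x) \<in> A (\<lambda>x. c * f x + d * h x)"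
      using A' assms(1) lin by simp
  next
    show "\<exists>B. \<forall>f\<in>L2. \<forall>u\<in>A f. L2_norm u \<le> B * L2_norm f"
      using A' assms(1) by simp
  qed
qed

section \<open>Schwartz functions\<close>

text \<open>An integrable majorant for Schwartz functions and their transforms. The product form
  reduces integrability to 1/(1 + t^2) on the line and matches the decay gained from two derivatives
  in each coordinate.\<close>

definition decay_weight :: "'a::euclidean_space \<Rightarrow> real" where
  "decay_weight x = (\<Prod>b\<in>Basis. inverse (1 + (x \<bullet> b)\<^sup>2))"

lemma decay_weight_eq: "decay_weight x = inverse (\<Prod>b\<in>Basis. 1 + (x \<bullet> b)\<^sup>2)"
  unfolding decay_weight_def by (rule prod_inversef[unfolded comp_def])

lemma integrable_decay_weight: "integrable lborel (decay_weight :: 'a::euclidean_space \<Rightarrow> real)"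
proof -
  have "integrable lborel (\<lambda>x::real. inverse (1 + x\<^sup>2))"
    using integrable_inverse_1_plus_square by (simp add: set_integrable_def)
  then show ?thesis
    unfolding decay_weight_def[abs_def] by (intro integrable_lborel_Basis_prod)
qed

text \<open>Every coordinate is bounded by the norm. Decay of order twice the dimension in the norm
  therefore suffices for domination by the weight.\<close>

lemma decay_weight_ge: "inverse ((1 + (norm x)\<^sup>2) ^ DIM('a)) \<le> decay_weight (x :: 'a::euclidean_space)"
proof -
  have "(\<Prod>b\<in>(Basis::'a set). 1 + (x \<bullet> b)\<^sup>2) \<le> (\<Prod>b\<in>(Basis::'a set). 1 + (norm x)\<^sup>2)"
  proof (rule prod_mono, intro conjI)
    fix b :: 'a assume "b \<in> Basis"
    then have "\<bar>x \<bullet> b\<bar> \<le> norm x" by (rule Basis_le_norm)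
    then have "\<bar>x \<bullet> b\<bar>\<^sup>2 \<le> (norm x)\<^sup>2" by (rule power_mono) simp
    then show "1 + (x \<bullet> b)\<^sup>2 \<le> 1 + (norm x)\<^sup>2" by simp
  qed (simp add: add_nonneg_nonneg)
  moreover have "0 < (\<Prod>b\<in>(Basis::'a set). 1 + (x \<bullet> b)\<^sup>2)"
    by (intro prod_pos) (simp add: add_pos_nonneg)
  ultimately show ?thesis
    unfolding decay_weight_eq by (intro le_imp_inverse_le) simp_all
qed

text \<open>Lets a bound at an intermediate point of a difference quotient be replaced by one at x.
  The factor 3 per coordinate comes from 1 + t^2 \<le> 1 + 2 (t+s)^2 + 2 s^2 with s^2 \<le>
  1.\<close>

lemma decay_weight_shift:
  fixes x :: "'a::euclidean_space"
  assumes "norm u \<le> 1"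
  shows "decay_weight (x + u) \<le> 3 ^ DIM('a) * decay_weight x"
proof -
  have "inverse (1 + ((x + u) \<bullet> b)\<^sup>2) \<le> 3 * inverse (1 + (x \<bullet> b)\<^sup>2)" if "b \<in> Basis" for b
  proof -
    define s t where "s = u \<bullet> b" and "t = x \<bullet> b"
    have "\<bar>s\<bar> \<le> 1" unfolding s_def using Basis_le_norm[OF that, of u] assms by simp
    then have "s\<^sup>2 \<le> 1" by (simp add: abs_square_le_1)
    moreover have "t\<^sup>2 \<le> 2 * (t + s)\<^sup>2 + 2 * s\<^sup>2"
      using zero_le_power2[of "t + 2 * s"] by (simp add: power2_eq_square algebra_simps)
    moreover have "0 \<le> (t + s)\<^sup>2" by simp
    ultimately have "1 + t\<^sup>2 \<le> 3 * (1 + (t + s)\<^sup>2)" by argo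
    moreover have "0 < 1 + t\<^sup>2" "0 < 1 + (t + s)\<^sup>2" by (simp_all add: add_pos_nonneg)
    ultimately have "inverse (1 + (t + s)\<^sup>2) \<le> 3 * inverse (1 + t\<^sup>2)" by (simp add: field_simps)
    then show ?thesis by (simp add: s_def t_def inner_add_left)
  qed
  then have "decay_weight (x + u) \<le> (\<Prod>b\<in>Basis. 3 * inverse (1 + (x \<bullet> b)\<^sup>2))"
    unfolding decay_weight_def by (intro prod_mono) auto
  then show ?thesis by (simp add: decay_weight_def prod.distrib)
qed

lemma schwartz_partial:
  assumes "\<phi> \<in> schwartz" "b \<in> Basis"
  shows "partial b \<phi> \<in> schwartz"
  unfolding schwartz_def mem_Collect_eq
proof (intro allI impI)
  fix bs :: "'a list" assume "set bs \<subseteq> Basis"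
  \<comment> \<open>\<open>foldr\<close> applies the last entry first, so appending \<open>b\<close>
    means differentiating along \<open>b\<close> before the directions in \<open>bs\<close>.\<close>
  then have "set (bs @ [b]) \<subseteq> Basis" using assms(2) by simp
  with assms(1) have "(\<forall>x. foldr partial (bs @ [b]) \<phi> differentiable at x) \<and>
     (\<forall>k. \<exists>B. \<forall>x. norm x ^ k * norm (foldr partial (bs @ [b]) \<phi> x) \<le> B)"
    unfolding schwartz_def by blast
  then show "(\<forall>x. foldr partial bs (partial b \<phi>) differentiable at x) \<and>
     (\<forall>k. \<exists>B. \<forall>x. norm x ^ k * norm (foldr partial bs (partial b \<phi>) x) \<le> B)"
    by simp
qed

lemma
  assumes "\<phi> \<in> schwartz"
  shows schwartz_differentiable: "\<phi> differentiable (at x)"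
    and schwartz_bounds: "\<exists>B. \<forall>x. norm x ^ k * norm (\<phi> x) \<le> B"
proof -
  have "set [] \<subseteq> Basis" by simp
  with assms have "(\<forall>x. foldr partial [] \<phi> differentiable at x) \<and>
     (\<forall>k. \<exists>B. \<forall>x. norm x ^ k * norm (foldr partial [] \<phi> x) \<le> B)"
    unfolding schwartz_def by blast
  then show "\<phi> differentiable (at x)" "\<exists>B. \<forall>x. norm x ^ k * norm (\<phi> x) \<le> B" by auto
qed

lemma schwartz_isCont: "\<phi> \<in> schwartz \<Longrightarrow> isCont \<phi> x"
  by (intro differentiable_imp_continuous_within schwartz_differentiable)

lemma schwartz_measurable:
  assumes "\<phi> \<in> schwartz"
  shows "\<phi> \<in> borel_measurable borel"
  by (intro borel_measurable_continuous_onI continuous_at_imp_continuous_on ballI schwartz_isCont assms)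

lemma schwartz_decay:
  fixes \<phi> :: "'a::euclidean_space \<Rightarrow> complex"
  assumes "\<phi> \<in> schwartz"
  obtains B where "B \<ge> 0" "\<And>x. norm (\<phi> x) \<le> B * decay_weight x"
proof -
  obtain C where C: "\<And>k x. norm x ^ k * norm (\<phi> x) \<le> C k"
    using schwartz_bounds[OF assms] by metis
  \<comment> \<open>The binomial expansion of (1 + |x|^2)^d, d the dimension, with each even power
    of the norm estimated by its seminorm bound.\<close>
  define B where "B = (\<Sum>k\<le>DIM('a). real (DIM('a) choose k) * C (2 * k))"
  have le: "norm (\<phi> x) \<le> B * decay_weight x" and B: "0 \<le> B" for x
  proof -
    have "(1 + (norm x)\<^sup>2) ^ DIM('a) * norm (\<phi> x)
        = (\<Sum>k\<le>DIM('a). real (DIM('a) choose k) * (norm x ^ (2 * k) * norm (\<phi> x)))"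
      unfolding add.commute[of 1] binomial_ring[of "(norm x)\<^sup>2" 1]
      by (simp add: sum_distrib_right power_mult mult.assoc)
    also have "\<dots> \<le> B"
      unfolding B_def by (intro sum_mono mult_left_mono C) auto
    finally have b: "(1 + (norm x)\<^sup>2) ^ DIM('a) * norm (\<phi> x) \<le> B" .
    have p: "0 < (1 + (norm x)\<^sup>2) ^ DIM('a)" by (simp add: add_pos_nonneg)
    show "0 \<le> B" using b p by (meson mult_nonneg_nonneg norm_ge_zero less_imp_le order_trans)
    have "norm (\<phi> x) \<le> B * inverse ((1 + (norm x)\<^sup>2) ^ DIM('a))"
      using b p by (simp add: field_simps)
    also have "\<dots> \<le> B * decay_weight x"
      by (intro mult_left_mono decay_weight_ge \<open>0 \<le> B\<close>)
    finally show "norm (\<phi> x) \<le> B * decay_weight x" .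
  qed
  show ?thesis by (rule that[OF B le])
qed

lemma schwartz_integrable:
  assumes "\<phi> \<in> schwartz"
  shows "integrable lborel \<phi>"
proof -
  obtain B where B: "B \<ge> 0" "\<And>x. norm (\<phi> x) \<le> B * decay_weight x" using schwartz_decay[OF assms] by blast
  show ?thesis
  proof (rule Bochner_Integration.integrable_bound)
    show "integrable lborel (\<lambda>x. B * decay_weight x)" by (intro integrable_mult_right integrable_decay_weight)
    show "AE x in lborel. norm (\<phi> x) \<le> norm (B * decay_weight x)"
      using order_trans[OF B(2) abs_ge_self] by (intro AE_I2) simp
  qed (use schwartz_measurable[OF assms] in simp)
qed

section \<open>Decay of transforms of Schwartz functions, and inversion\<close>

lemma chi_difference_quotient:
  "(\<lambda>n. of_real (real (Suc n)) * (chi (inverse (real (Suc n)) * c) - 1)) \<longlonglongrightarrow> of_real (2 * pi * c) * \<i>"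
proof -
  let ?z = "\<lambda>n. complex_of_real (inverse (real (Suc n)))"
  let ?f = "\<lambda>z. exp (of_real (2 * pi * c) * \<i> * z)"
  have "(?f has_field_derivative of_real (2 * pi * c) * \<i>) (at 0)"
    by (auto intro!: derivative_eq_intros)
  then have "((\<lambda>h. (?f (0 + h) - ?f 0) / h) \<longlongrightarrow> of_real (2 * pi * c) * \<i>) (at 0)"
    unfolding DERIV_def .
  moreover have "filterlim ?z (at 0) sequentially"
    unfolding filterlim_at
    using tendsto_of_real[OF LIMSEQ_inverse_real_of_nat, where 'a=complex] by (simp del: of_nat_Suc)
  ultimately have "(\<lambda>n. (?f (0 + ?z n) - ?f 0) / ?z n) \<longlonglongrightarrow> of_real (2 * pi * c) * \<i>"
    by (rule filterlim_compose)
  moreover have "(?f (0 + ?z n) - ?f 0) / ?z n = of_real (real (Suc n)) * (chi (inverse (real (Suc n)) * c) - 1)" for n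
  proof -
    have "?f (0 + ?z n) = chi (inverse (real (Suc n)) * c)"
      unfolding chi_def cis_conv_exp by (simp add: ac_simps)
    then show ?thesis by (simp add: field_simps del: of_nat_Suc)
  qed
  ultimately show ?thesis by simp
qed

lemma schwartz_difference_quotient:
  fixes \<phi> :: "'a::euclidean_space \<Rightarrow> complex"
  assumes \<phi>: "\<phi> \<in> schwartz" and b: "b \<in> Basis"
  shows "(\<lambda>n. of_real (real (Suc n)) * (\<phi> (x + inverse (real (Suc n)) *\<^sub>R b) - \<phi> x)) \<longlonglongrightarrow> partial b \<phi> x"
proof -
  let ?D = "frechet_derivative \<phi> (at x)"
  let ?h = "\<lambda>n. inverse (real (Suc n)) *\<^sub>R b"
  have D: "(\<phi> has_derivative ?D) (at x)"
    using schwartz_differentiable[OF \<phi>] frechet_derivative_works by blast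
  have "b \<noteq> 0" using b by (rule nonzero_Basis)
  have "((\<lambda>h. norm (\<phi> (x + h) - \<phi> x - ?D h) / norm h) \<longlongrightarrow> 0) (at 0)"
    using D unfolding has_derivative_at by blast
  moreover have "filterlim ?h (at 0) sequentially"
    unfolding filterlim_at using scaled_sequence[of b] \<open>b \<noteq> 0\<close> by simp
  ultimately have lim: "(\<lambda>n. norm (\<phi> (x + ?h n) - \<phi> x - ?D (?h n)) / norm (?h n)) \<longlonglongrightarrow> 0"
    by (rule filterlim_compose)
  have "norm (\<phi> (x + ?h n) - \<phi> x - ?D (?h n)) / norm (?h n)
      = norm (of_real (real (Suc n)) * (\<phi> (x + ?h n) - \<phi> x) - partial b \<phi> x)" for n
  proof -
    have "?D (?h n) = inverse (real (Suc n)) *\<^sub>R partial b \<phi> x"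
      unfolding partial_def using has_derivative_bounded_linear[OF D] by (simp add: linear_simps)
    then have eq: "of_real (real (Suc n)) * (\<phi> (x + ?h n) - \<phi> x) - partial b \<phi> x
       = of_real (real (Suc n)) * (\<phi> (x + ?h n) - \<phi> x - ?D (?h n))"
      by (simp add: scaleR_conv_of_real algebra_simps del: of_nat_Suc)
    show ?thesis unfolding eq using b by (simp add: norm_mult divide_inverse mult.commute del: of_nat_Suc)
  qed
  with lim have "(\<lambda>n. norm (of_real (real (Suc n)) * (\<phi> (x + ?h n) - \<phi> x) - partial b \<phi> x)) \<longlonglongrightarrow> 0" by simp
  then show ?thesis by (simp only: tendsto_norm_zero_iff LIM_zero_iff)
qed

text \<open>The mean value theorem on the segment from x in direction \<open>b\<close>; the segment
  has length at most 1, so \<open>decay_weight_shift\<close> makes the bound independent of the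
  intermediate point.\<close>

lemma schwartz_difference_bound:
  fixes \<phi> :: "'a::euclidean_space \<Rightarrow> complex"
  assumes \<phi>: "\<phi> \<in> schwartz" and b: "b \<in> Basis" and h: "0 < h" "h \<le> 1"
    and B: "B \<ge> 0" "\<And>x. norm (partial b \<phi> x) \<le> B * decay_weight x"
  shows "norm (\<phi> (x + h *\<^sub>R b) - \<phi> x) \<le> h * (B * (3 ^ DIM('a) * decay_weight x))"
proof -
  have der: "((\<lambda>s. \<phi> (x + s *\<^sub>R b)) has_derivative (\<lambda>d. d *\<^sub>R partial b \<phi> (x + s *\<^sub>R b))) (at s)" for s
  proof -
    have D: "(\<phi> has_derivative frechet_derivative \<phi> (at (x + s *\<^sub>R b))) (at (x + s *\<^sub>R b))"
      using schwartz_differentiable[OF \<phi>] frechet_derivative_works by blast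
    have "((\<lambda>s. x + s *\<^sub>R b) has_derivative (\<lambda>d. d *\<^sub>R b)) (at s)"
      by (auto intro!: derivative_eq_intros)
    from has_derivative_compose[OF this D]
    show ?thesis
      unfolding partial_def using has_derivative_bounded_linear[OF D] by (simp add: linear_simps)
  qed
  then have cont: "continuous_on {0..h} (\<lambda>s. \<phi> (x + s *\<^sub>R b))"
    by (intro continuous_at_imp_continuous_on ballI has_derivative_continuous) blast
  obtain s where s: "s \<in> {0<..<h}"
      "norm (\<phi> (x + h *\<^sub>R b) - \<phi> (x + 0 *\<^sub>R b)) \<le> norm ((h - 0) *\<^sub>R partial b \<phi> (x + s *\<^sub>R b))"
    using mvt_general[OF h(1) cont der] by blast
  have "norm (s *\<^sub>R b) \<le> 1" using s(1) h(2) b by simp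
  have "norm (partial b \<phi> (x + s *\<^sub>R b)) \<le> B * (3 ^ DIM('a) * decay_weight x)"
    by (rule order_trans[OF B(2)]) (intro mult_left_mono B decay_weight_shift \<open>norm (s *\<^sub>R b) \<le> 1\<close>)
  then have "h * norm (partial b \<phi> (x + s *\<^sub>R b)) \<le> h * (B * (3 ^ DIM('a) * decay_weight x))"
    using h by (intro mult_left_mono) auto
  moreover have "norm (\<phi> (x + h *\<^sub>R b) - \<phi> x) \<le> h * norm (partial b \<phi> (x + s *\<^sub>R b))"
    using s(2) h by simp
  ultimately show ?thesis by (rule order_trans[rotated])
qed

text \<open>The transform of a difference quotient is evaluated in two ways: dominated convergence
  gives the transform of the derivative, while translation turns into a factor \<open>chi\<close>
  whose difference quotient gives 2 pi i times the coordinate of \<omega>.\<close>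

lemma fourier_partial:
  fixes \<phi> :: "'a::euclidean_space \<Rightarrow> complex"
  assumes \<phi>: "\<phi> \<in> schwartz" and b: "b \<in> Basis"
  shows "fourier (partial b \<phi>) \<omega> = of_real (2 * pi * (\<omega> \<bullet> b)) * \<i> * fourier \<phi> \<omega>"
proof -
  note [measurable] = schwartz_measurable[OF \<phi>] schwartz_measurable[OF schwartz_partial[OF \<phi> b]]
  let ?h = "\<lambda>n. inverse (real (Suc n))"
  let ?q = "\<lambda>n x. of_real (real (Suc n)) * (\<phi> (x + ?h n *\<^sub>R b) - \<phi> x)"
  obtain B where B: "B \<ge> 0" "\<And>x. norm (partial b \<phi> x) \<le> B * decay_weight x"
    using schwartz_decay[OF schwartz_partial[OF \<phi> b]] by blast
  have i: "integrable lborel (\<lambda>x. chi (- (x \<bullet> \<omega>)) * \<phi> (x + u))" for u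
    by (rule integrable_chi_mult) (use integrable_lborel_translate[of \<phi> "- u"] schwartz_integrable[OF \<phi>] in simp_all)
  have "(\<lambda>n. LINT x|lborel. chi (- (x \<bullet> \<omega>)) * ?q n x) \<longlonglongrightarrow> (LINT x|lborel. chi (- (x \<bullet> \<omega>)) * partial b \<phi> x)"
  proof (rule integral_dominated_convergence)
    show "integrable lborel (\<lambda>x::'a. B * (3 ^ DIM('a) * decay_weight x))"
      by (intro integrable_mult_right integrable_decay_weight)
    show "AE x in lborel. (\<lambda>n. chi (- (x \<bullet> \<omega>)) * ?q n x) \<longlonglongrightarrow> chi (- (x \<bullet> \<omega>)) * partial b \<phi> x"
      by (intro AE_I2 tendsto_mult tendsto_const schwartz_difference_quotient \<phi> b)
    show "AE x in lborel. norm (chi (- (x \<bullet> \<omega>)) * ?q n x) \<le> B * (3 ^ DIM('a) * decay_weight x)" for n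
    proof (intro AE_I2)
      fix x
      have "?h n \<le> 1" by (simp add: divide_simps)
      have "norm (\<phi> (x + ?h n *\<^sub>R b) - \<phi> x) \<le> ?h n * (B * (3 ^ DIM('a) * decay_weight x))"
        by (rule schwartz_difference_bound[OF \<phi> b _ \<open>?h n \<le> 1\<close> B]) simp
      then have "real (Suc n) * norm (\<phi> (x + ?h n *\<^sub>R b) - \<phi> x)
          \<le> real (Suc n) * (?h n * (B * (3 ^ DIM('a) * decay_weight x)))"
        by (rule mult_left_mono) simp
      also have "\<dots> = B * (3 ^ DIM('a) * decay_weight x)"
        by (simp add: mult.assoc[symmetric] del: of_nat_Suc)
      finally show "norm (chi (- (x \<bullet> \<omega>)) * ?q n x) \<le> B * (3 ^ DIM('a) * decay_weight x)"
        by (simp add: norm_mult del: of_nat_Suc)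
    qed
  qed measurable
  moreover have "(LINT x|lborel. chi (- (x \<bullet> \<omega>)) * ?q n x)
      = of_real (real (Suc n)) * (chi (?h n * (\<omega> \<bullet> b)) - 1) * fourier \<phi> \<omega>" for n
  proof -
    have tr: "(LINT x|lborel. chi (- (x \<bullet> \<omega>)) * \<phi> (x + ?h n *\<^sub>R b)) = chi (?h n * (\<omega> \<bullet> b)) * fourier \<phi> \<omega>"
    proof -
      have "(LINT x|lborel. chi (- (x \<bullet> \<omega>)) * \<phi> (x + ?h n *\<^sub>R b))
          = (LINT x|lborel. chi (- ((x - ?h n *\<^sub>R b) \<bullet> \<omega>)) * \<phi> x)"
        using integral_lborel_translate[of "\<lambda>x. chi (- ((x - ?h n *\<^sub>R b) \<bullet> \<omega>)) * \<phi> x" "- (?h n *\<^sub>R b)"]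
        by simp
      also have "\<dots> = (LINT x|lborel. chi (?h n * (\<omega> \<bullet> b)) * (chi (- (x \<bullet> \<omega>)) * \<phi> x))"
      proof (rule Bochner_Integration.integral_cong)
        fix x
        have "- ((x - ?h n *\<^sub>R b) \<bullet> \<omega>) = ?h n * (\<omega> \<bullet> b) + - (x \<bullet> \<omega>)"
          by (simp add: inner_diff_left inner_commute[of b] del: of_nat_Suc)
        then show "chi (- ((x - ?h n *\<^sub>R b) \<bullet> \<omega>)) * \<phi> x = chi (?h n * (\<omega> \<bullet> b)) * (chi (- (x \<bullet> \<omega>)) * \<phi> x)"
          by (simp only: chi_add mult.assoc)
      qed simp
      also have "\<dots> = chi (?h n * (\<omega> \<bullet> b)) * fourier \<phi> \<omega>"
        unfolding fourier_eq by (rule integral_mult_right_zero)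
      finally show ?thesis .
    qed
    have "(LINT x|lborel. chi (- (x \<bullet> \<omega>)) * ?q n x)
       = (LINT x|lborel. of_real (real (Suc n)) * (chi (- (x \<bullet> \<omega>)) * \<phi> (x + ?h n *\<^sub>R b) - chi (- (x \<bullet> \<omega>)) * \<phi> x))"
      by (intro Bochner_Integration.integral_cong) (simp_all add: algebra_simps del: of_nat_Suc)
    also have "\<dots> = of_real (real (Suc n)) * (LINT x|lborel. chi (- (x \<bullet> \<omega>)) * \<phi> (x + ?h n *\<^sub>R b) - chi (- (x \<bullet> \<omega>)) * \<phi> x)"
      by (rule integral_mult_right_zero)
    also have "(LINT x|lborel. chi (- (x \<bullet> \<omega>)) * \<phi> (x + ?h n *\<^sub>R b) - chi (- (x \<bullet> \<omega>)) * \<phi> x)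
       = chi (?h n * (\<omega> \<bullet> b)) * fourier \<phi> \<omega> - fourier \<phi> \<omega>"
      unfolding Bochner_Integration.integral_diff[OF i i[of 0, unfolded add_0_right]] tr
      unfolding fourier_eq ..
    finally show ?thesis by (simp add: algebra_simps del: of_nat_Suc)
  qed
  moreover have "(\<lambda>n. of_real (real (Suc n)) * (chi (?h n * (\<omega> \<bullet> b)) - 1) * fourier \<phi> \<omega>)
      \<longlonglongrightarrow> of_real (2 * pi * (\<omega> \<bullet> b)) * \<i> * fourier \<phi> \<omega>"
    by (intro tendsto_mult tendsto_const chi_difference_quotient)
  ultimately show ?thesis
    unfolding fourier_eq[of "partial b \<phi>"] by (metis (no_types, lifting) LIMSEQ_unique ext)
qed

text \<open>Each new coordinate contributes its factor by applying the induction hypothesis both to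
  \<open>\<phi>\<close> and to its second derivative in that direction, which is why
  \<open>\<phi>\<close> is kept arbitrary.\<close>

lemma fourier_schwartz_decay_aux:
  fixes \<phi> :: "'a::euclidean_space \<Rightarrow> complex"
  assumes "finite A" "A \<subseteq> Basis" "\<phi> \<in> schwartz"
  shows "\<exists>B. \<forall>\<omega>. (\<Prod>b\<in>A. 1 + (\<omega> \<bullet> b)\<^sup>2) * norm (fourier \<phi> \<omega>) \<le> B"
  using assms
proof (induction A arbitrary: \<phi> rule: finite_induct)
  case empty
  then show ?case using norm_fourier_le by auto
next
  case (insert a A)
  have a: "a \<in> Basis" using insert.prems by simp
  note \<phi>a = schwartz_partial[OF insert.prems(2) a]
  obtain B where B: "\<And>\<omega>. (\<Prod>b\<in>A. 1 + (\<omega> \<bullet> b)\<^sup>2) * norm (fourier \<phi> \<omega>) \<le> B"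
    using insert.IH[OF _ insert.prems(2)] insert.prems(1) by auto
  obtain C where C: "\<And>\<omega>. (\<Prod>b\<in>A. 1 + (\<omega> \<bullet> b)\<^sup>2) * norm (fourier (partial a (partial a \<phi>)) \<omega>) \<le> C"
    using insert.IH[OF _ schwartz_partial[OF \<phi>a a]] insert.prems(1) by auto
  have "(\<Prod>b\<in>insert a A. 1 + (\<omega> \<bullet> b)\<^sup>2) * norm (fourier \<phi> \<omega>) \<le> B + C" for \<omega>
  proof -
    let ?P = "\<Prod>b\<in>A. 1 + (\<omega> \<bullet> b)\<^sup>2"
    have P: "0 \<le> ?P" by (intro prod_nonneg) (simp add: add_nonneg_nonneg)
    have "norm (fourier (partial a (partial a \<phi>)) \<omega>) = (2 * pi * (\<omega> \<bullet> a))\<^sup>2 * norm (fourier \<phi> \<omega>)"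
      unfolding fourier_partial[OF \<phi>a a] fourier_partial[OF insert.prems(2) a]
      by (simp add: norm_mult power2_eq_square abs_mult)
    \<comment> \<open>The constant (2 pi)^2 is at least 1 and may be dropped in an upper
      bound.\<close>
    moreover have "(\<omega> \<bullet> a)\<^sup>2 \<le> (2 * pi * (\<omega> \<bullet> a))\<^sup>2"
    proof -
      have "1 \<le> (2 * pi)\<^sup>2" using pi_gt3 by (intro one_le_power) simp
      from mult_right_mono[OF this zero_le_power2[of "\<omega> \<bullet> a"]] show ?thesis by (simp add: power_mult_distrib)
    qed
    ultimately have "(\<omega> \<bullet> a)\<^sup>2 * norm (fourier \<phi> \<omega>) \<le> norm (fourier (partial a (partial a \<phi>)) \<omega>)"
      by (simp add: mult_right_mono)
    then have "?P * ((\<omega> \<bullet> a)\<^sup>2 * norm (fourier \<phi> \<omega>)) \<le> C"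
      using C[of \<omega>] mult_left_mono[OF _ P] by (blast intro: order_trans)
    then show ?thesis
      using B[of \<omega>] insert.hyps by (simp add: algebra_simps)
  qed
  then show ?case by blast
qed

lemma integrable_fourier_schwartz:
  fixes \<phi> :: "'a::euclidean_space \<Rightarrow> complex"
  assumes \<phi>: "\<phi> \<in> schwartz"
  shows "integrable lborel (fourier \<phi>)"
proof -
  note [measurable] = schwartz_measurable[OF \<phi>]
  obtain B where B: "\<And>\<omega>. (\<Prod>b\<in>Basis. 1 + (\<omega> \<bullet> b)\<^sup>2) * norm (fourier \<phi> \<omega>) \<le> B"
    using fourier_schwartz_decay_aux[OF finite_Basis subset_refl \<phi>] by blast
  show ?thesis
  proof (rule Bochner_Integration.integrable_bound)
    show "integrable lborel (\<lambda>x::'a. B * decay_weight x)" by (intro integrable_mult_right integrable_decay_weight)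
    show "AE \<omega> in lborel. norm (fourier \<phi> \<omega>) \<le> norm (B * decay_weight \<omega>)"
    proof (intro AE_I2)
      fix \<omega> :: 'a
      have "0 < (\<Prod>b\<in>Basis. 1 + (\<omega> \<bullet> b)\<^sup>2)" by (intro prod_pos) (simp add: add_pos_nonneg)
      then have "norm (fourier \<phi> \<omega>) \<le> B * decay_weight \<omega>"
        using B[of \<omega>] unfolding decay_weight_eq by (simp add: field_simps)
      then show "norm (fourier \<phi> \<omega>) \<le> norm (B * decay_weight \<omega>)" by simp
    qed
  qed measurable
qed

lemma inv_fourier_minus: "inv_fourier f x = fourier f (- x)"
  unfolding inv_fourier_eq fourier_eq by (simp add: inner_commute)

text \<open>Both sides of the smoothing identity are passed to the limit: the local averages by
  continuity of \<open>f\<close>, the damped inversion integrals by dominated convergence with the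
  integrable transform as majorant.\<close>

lemma fourier_inversion:
  fixes f :: "'a::euclidean_space \<Rightarrow> complex"
  assumes f: "integrable lborel f" "\<And>x. isCont f x" "\<And>x. norm (f x) \<le> B"
    and F: "integrable lborel (fourier f)"
  shows "fourier (inv_fourier f) t = f t"
proof -
  note [measurable] = borel_measurable_integrable[OF f(1), simplified]
  let ?s = "\<lambda>n. inverse (real (Suc n))"
  have "(\<lambda>n. LINT z|lborel. f (t + ?s n *\<^sub>R z) * of_real (gaussian z)) \<longlonglongrightarrow> f t"
  proof (rule integral_gaussian_tendsto[of "\<lambda>u. f (t + u)"])
    fix u :: "nat \<Rightarrow> 'a" assume "u \<longlonglongrightarrow> 0"
    from tendsto_add[OF tendsto_const[of t] this] have "(\<lambda>n. t + u n) \<longlonglongrightarrow> t" by simp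
    with f(2)[of t] show "(\<lambda>n. f (t + u n)) \<longlonglongrightarrow> f t" by (rule isCont_tendsto_compose)
  qed (use f(3) in auto)
  then have "(\<lambda>n. LINT \<omega>|lborel. fourier f \<omega> * (chi (\<omega> \<bullet> t) * of_real (gaussian (?s n *\<^sub>R \<omega>)))) \<longlonglongrightarrow> f t"
    by (subst fourier_gaussian_smoothing[OF f(1)]) simp_all
  moreover have "(\<lambda>n. LINT \<omega>|lborel. fourier f \<omega> * (chi (\<omega> \<bullet> t) * of_real (gaussian (?s n *\<^sub>R \<omega>))))
      \<longlonglongrightarrow> (LINT \<omega>|lborel. fourier f \<omega> * (chi (\<omega> \<bullet> t) * of_real (gaussian (0::'a))))"
  proof (rule integral_dominated_convergence[where w="\<lambda>\<omega>. norm (fourier f \<omega>)"])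
    have "isCont gaussian (0::'a)" unfolding gaussian_def by (intro continuous_intros)
    then have "(\<lambda>n. gaussian (?s n *\<^sub>R \<omega>)) \<longlonglongrightarrow> gaussian (0::'a)" for \<omega> :: 'a
      using scaled_sequence[of \<omega>] by (rule isCont_tendsto_compose)
    then show "AE \<omega> in lborel. (\<lambda>n. fourier f \<omega> * (chi (\<omega> \<bullet> t) * of_real (gaussian (?s n *\<^sub>R \<omega>))))
        \<longlonglongrightarrow> fourier f \<omega> * (chi (\<omega> \<bullet> t) * of_real (gaussian (0::'a)))"
      by (intro AE_I2 tendsto_mult tendsto_const tendsto_of_real)
    show "AE \<omega> in lborel. norm (fourier f \<omega> * (chi (\<omega> \<bullet> t) * of_real (gaussian (?s n *\<^sub>R \<omega>)))) \<le> norm (fourier f \<omega>)" for n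
      by (intro AE_I2) (simp add: norm_mult mult_left_le gaussian_le_1)
    show "integrable lborel (\<lambda>\<omega>. norm (fourier f \<omega>))" using F by simp
  qed measurable
  ultimately have "f t = (LINT \<omega>|lborel. fourier f \<omega> * (chi (\<omega> \<bullet> t) * of_real (gaussian (0::'a))))"
    by (rule LIMSEQ_unique)
  \<comment> \<open>The reflection rewrites the inverse of the forward transform as the forward
    transform of the inverse, the order in which \<open>distr_inv_fourier_fourier\<close> uses
    it.\<close>
  also have "\<dots> = (LINT \<omega>|lborel. fourier f (- \<omega>) * chi (- \<omega> \<bullet> t))"
    using integral_lborel_uminus[of "\<lambda>\<omega>. fourier f \<omega> * chi (\<omega> \<bullet> t)"] by (simp add: gaussian_def)
  also have "\<dots> = fourier (inv_fourier f) t"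
    unfolding fourier_eq[of "inv_fourier f"] inv_fourier_minus by (simp add: mult.commute)
  finally show ?thesis ..
qed

lemma schwartz_inversion:
  assumes \<phi>: "\<phi> \<in> schwartz"
  shows "fourier (inv_fourier \<phi>) t = \<phi> t" "integrable lborel (inv_fourier \<phi>)"
proof -
  note [measurable] = schwartz_measurable[OF \<phi>]
  obtain B where B: "\<forall>x. norm x ^ 0 * norm (\<phi> x) \<le> B"
    using schwartz_bounds[OF \<phi>] by blast
  show "fourier (inv_fourier \<phi>) t = \<phi> t"
    by (rule fourier_inversion[where B=B, OF schwartz_integrable[OF \<phi>] schwartz_isCont[OF \<phi>] _ integrable_fourier_schwartz[OF \<phi>]])
      (use B in simp)
  show "integrable lborel (inv_fourier \<phi>)"
    unfolding inv_fourier_minus[abs_def]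
    by (subst integrable_lborel_uminus) (use integrable_fourier_schwartz[OF \<phi>] in simp_all)
qed

section \<open>Gaussians as Schwartz functions\<close>

text \<open>The factors that iterated partial derivatives put in front of a Gaussian. The inductive
  form gives closure under derivatives and polynomial growth by rule induction.\<close>

inductive complex_polynomial :: "('a::euclidean_space \<Rightarrow> complex) \<Rightarrow> bool" where
  const: "complex_polynomial (\<lambda>x. c)"
| inner: "complex_polynomial (\<lambda>x. of_real (x \<bullet> c))"
| add: "complex_polynomial p \<Longrightarrow> complex_polynomial q \<Longrightarrow> complex_polynomial (\<lambda>x. p x + q x)"
| mult: "complex_polynomial p \<Longrightarrow> complex_polynomial q \<Longrightarrow> complex_polynomial (\<lambda>x. p x * q x)"

lemma partial_eqI: "(f has_derivative D) (at x) \<Longrightarrow> partial b f x = D b"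
  unfolding partial_def by (metis frechet_derivative_at)

lemma has_derivative_frechet:
  "f differentiable (at x) \<Longrightarrow> (f has_derivative frechet_derivative f (at x)) (at x)"
  by (simp add: frechet_derivative_works)

lemma complex_polynomial_partial:
  assumes "complex_polynomial p"
  shows "(\<forall>x. p differentiable (at x)) \<and> complex_polynomial (partial b p)"
  using assms
proof induction
  case (const c)
  have "partial b (\<lambda>x. c) = (\<lambda>x. 0)"
    by (rule ext, rule partial_eqI[THEN trans]) (auto intro!: derivative_eq_intros)
  then show ?case by (simp add: complex_polynomial.const)
next
  case (inner c)
  have d: "((\<lambda>x. complex_of_real (x \<bullet> c)) has_derivative (\<lambda>h. of_real (h \<bullet> c))) (at x)" for x
    by (auto intro!: derivative_eq_intros)
  then have "partial b (\<lambda>x. of_real (x \<bullet> c)) = (\<lambda>x. of_real (b \<bullet> c))"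
    by (intro ext partial_eqI)
  with d show ?case by (auto simp: complex_polynomial.const differentiable_def)
next
  case (add p q)
  have d: "((\<lambda>x. p x + q x) has_derivative (\<lambda>h. frechet_derivative p (at x) h + frechet_derivative q (at x) h)) (at x)" for x
    using add by (intro derivative_intros has_derivative_frechet) auto
  have "partial b (\<lambda>x. p x + q x) = (\<lambda>x. partial b p x + partial b q x)"
    by (rule ext, rule trans[OF partial_eqI[OF d]]) (simp add: partial_def)
  then show ?case using add by (auto intro: complex_polynomial.add)
next
  case (mult p q)
  have d: "((\<lambda>x. p x * q x) has_derivative (\<lambda>h. p x * frechet_derivative q (at x) h + frechet_derivative p (at x) h * q x)) (at x)" for x
    using mult by (intro derivative_intros has_derivative_frechet) auto
  have "partial b (\<lambda>x. p x * q x) = (\<lambda>x. p x * partial b q x + partial b p x * q x)"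
    by (rule ext, rule trans[OF partial_eqI[OF d]]) (simp add: partial_def)
  then show ?case using mult by (auto intro: complex_polynomial.add complex_polynomial.mult)
qed

lemma complex_polynomial_bound:
  assumes "complex_polynomial p"
  shows "\<exists>C n. C \<ge> 0 \<and> (\<forall>x. norm (p x) \<le> C * (1 + norm x) ^ n)"
  using assms
proof induction
  case (const c)
  show ?case by (intro exI[of _ "norm c"] exI[of _ 0]) simp
next
  case (inner c)
  have "norm (complex_of_real (x \<bullet> c)) \<le> norm c * (1 + norm x) ^ 1" for x
    using Cauchy_Schwarz_ineq2[of x c] norm_ge_zero[of c] by (simp add: algebra_simps del: norm_ge_zero)
  then show ?case by (intro exI[of _ "norm c"] exI[of _ 1]) simp
next
  case (add p q)
  then obtain C n D m where C: "C \<ge> 0" "\<And>x. norm (p x) \<le> C * (1 + norm x) ^ n"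
    and D: "D \<ge> 0" "\<And>x. norm (q x) \<le> D * (1 + norm x) ^ m" by blast
  have "norm (p x + q x) \<le> (C + D) * (1 + norm x) ^ (n + m)" for x
  proof -
    have "C * (1 + norm x) ^ n \<le> C * (1 + norm x) ^ (n + m)" "D * (1 + norm x) ^ m \<le> D * (1 + norm x) ^ (n + m)"
      using C D by (intro mult_left_mono power_increasing; simp)+
    then show ?thesis using norm_triangle_ineq[of "p x" "q x"] C(2)[of x] D(2)[of x] by (simp add: distrib_right)
  qed
  then show ?case using C(1) D(1) by (intro exI[of _ "C + D"] exI[of _ "n + m"]) auto
next
  case (mult p q)
  then obtain C n D m where C: "C \<ge> 0" "\<And>x. norm (p x) \<le> C * (1 + norm x) ^ n"
    and D: "D \<ge> 0" "\<And>x. norm (q x) \<le> D * (1 + norm x) ^ m" by blast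
  have "norm (p x * q x) \<le> (C * D) * (1 + norm x) ^ (n + m)" for x
    using mult_mono[OF C(2)[of x] D(2)[of x]] C(1) by (simp add: norm_mult power_add ac_simps)
  then show ?case using C(1) D(1) by (intro exI[of _ "C * D"] exI[of _ "n + m"]) auto
qed

text \<open>With r the distance from \<open>a\<close>, one term of the exponential series gives
  (1+r)^m \<le> m! e^(1+r), and r \<le> 1 + pi r^2 lets the Gaussian absorb this exponential up to
  e^2.\<close>

lemma power_gaussian_bound: "(1 + norm x) ^ m * gaussian (x - a) \<le> (1 + norm a) ^ m * (fact m * exp 2)"
proof -
  define r where "r = norm (x - a)"
  have r: "r \<ge> 0" by (simp add: r_def)
  have "norm x \<le> norm a + r" unfolding r_def using norm_triangle_ineq[of a "x - a"] by simp
  moreover have "(1 + norm a) * (1 + r) = 1 + norm a + r + norm a * r" by (simp add: algebra_simps)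
  moreover have "0 \<le> norm a * r" using r by simp
  ultimately have "1 + norm x \<le> (1 + norm a) * (1 + r)" by linarith
  then have 1: "(1 + norm x) ^ m \<le> (1 + norm a) ^ m * (1 + r) ^ m"
    unfolding power_mult_distrib[symmetric] by (intro power_mono) simp_all
  have "(\<Sum>n\<in>{m}. (1 + r) ^ n /\<^sub>R fact n) \<le> exp (1 + r)"
    unfolding exp_def by (rule sum_le_suminf) (use r in \<open>auto intro: summable_exp\<close>)
  then have 2: "(1 + r) ^ m \<le> fact m * exp (1 + r)" by (simp add: divide_inverse[symmetric] field_simps)
  have "r \<le> 1 + pi * r\<^sup>2"
  proof -
    have "2 * r \<le> r\<^sup>2 + 1" using sum_squares_bound[of r 1] by simp
    moreover have "r\<^sup>2 \<le> pi * r\<^sup>2" using mult_right_mono[of 1 pi "r\<^sup>2"] pi_gt3 by simp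
    moreover have "0 \<le> r\<^sup>2" by simp
    ultimately show ?thesis by linarith
  qed
  then have 3: "exp (1 + r) * gaussian (x - a) \<le> exp 2"
    unfolding gaussian_def r_def[symmetric] exp_add[symmetric] by simp
  have "(1 + norm x) ^ m * gaussian (x - a) \<le> ((1 + norm a) ^ m * (fact m * exp (1 + r))) * gaussian (x - a)"
    by (intro mult_right_mono order_trans[OF 1] mult_left_mono 2) simp_all
  also have "\<dots> = (1 + norm a) ^ m * (fact m * (exp (1 + r) * gaussian (x - a)))" by simp
  also have "\<dots> \<le> (1 + norm a) ^ m * (fact m * exp 2)"
    by (intro mult_left_mono 3) simp_all
  finally show ?thesis .
qed

text \<open>Modulated Gaussians test integrable functions in \<open>L1_eq_of_distr_eq\<close>;
  translated ones, whose transforms are modulated Gaussians, test symbols in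
  \<open>fourier_times_eq_iff\<close>.\<close>

lemma gaussian_schwartz:
  fixes a w :: "'a::euclidean_space"
  shows "(\<lambda>t. chi (- (t \<bullet> w)) * of_real (gaussian (t - a))) \<in> schwartz"
proof -
  define E where "E t = chi (- (t \<bullet> w)) * complex_of_real (gaussian (t - a))" for t
  \<comment> \<open>The logarithmic derivative of \<open>E\<close> in direction \<open>b\<close>:
    the derivative of - 2 pi i (t \<bullet> w) - pi |t - a|^2, an affine function of t.\<close>
  define l where "l b t = - (2 * pi * (b \<bullet> w)) * \<i> + of_real (2 * pi * (a \<bullet> b)) + of_real (- 2 * pi) * complex_of_real (t \<bullet> b)" for b t :: 'a
  have l: "complex_polynomial (l b)" for b
    unfolding l_def[abs_def] by (intro complex_polynomial.intros)
  have dE: "(E has_derivative (\<lambda>b. l b t * E t)) (at t)" for t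
  proof -
    have E: "E = (\<lambda>t. exp (\<i> * of_real (2 * pi * (- (t \<bullet> w))) + of_real (- pi * ((t - a) \<bullet> (t - a)))))"
      by (rule ext) (simp add: E_def chi_def cis_conv_exp gaussian_def power2_norm_eq_inner exp_add exp_of_real del: of_real_mult of_real_minus)
    have "((\<lambda>t. \<i> * of_real (2 * pi * (- (t \<bullet> w))) + complex_of_real (- pi * ((t - a) \<bullet> (t - a)))) has_derivative
        (\<lambda>b. l b t)) (at t)"
      by (auto intro!: derivative_eq_intros simp: fun_eq_iff l_def algebra_simps inner_commute)
    from has_derivative_compose[OF this has_field_derivative_imp_has_derivative[OF DERIV_exp]]
    show ?thesis unfolding E by (simp add: mult.commute)
  qed
  \<comment> \<open>The products of polynomials with \<open>E\<close> are closed under partial derivatives.\<close>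
  have step: "partial b (\<lambda>t. p t * E t) = (\<lambda>t. (partial b p t + p t * l b t) * E t)"
    "(\<lambda>t. p t * E t) differentiable (at t)" if p: "complex_polynomial p" for p b t
  proof -
    have d: "((\<lambda>t. p t * E t) has_derivative (\<lambda>h. p t * (l h t * E t) + frechet_derivative p (at t) h * E t)) (at t)" for t
      using complex_polynomial_partial[OF p] by (intro has_derivative_mult has_derivative_frechet dE) auto
    show "partial b (\<lambda>t. p t * E t) = (\<lambda>t. (partial b p t + p t * l b t) * E t)"
      by (rule ext, rule trans[OF partial_eqI[OF d]]) (simp add: partial_def algebra_simps)
    show "(\<lambda>t. p t * E t) differentiable (at t)" using d differentiable_def by blast
  qed
  have iter: "\<exists>p. complex_polynomial p \<and> foldr partial bs E = (\<lambda>t. p t * E t)" for bs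
  proof (induction bs)
    case Nil
    show ?case by (intro exI[of _ "\<lambda>t. 1"]) (simp add: complex_polynomial.const)
  next
    case (Cons b bs)
    then obtain p where p: "complex_polynomial p" "foldr partial bs E = (\<lambda>t. p t * E t)" by blast
    have "complex_polynomial (\<lambda>t. partial b p t + p t * l b t)"
      using complex_polynomial_partial[OF p(1)] l p(1) by (intro complex_polynomial.intros) auto
    then show ?case using p step(1)[OF p(1)] by auto
  qed
  have "E \<in> schwartz"
    unfolding schwartz_def mem_Collect_eq
  proof (intro allI impI conjI)
    fix bs :: "'a list" and t :: 'a and k :: nat
    obtain p where p: "complex_polynomial p" "foldr partial bs E = (\<lambda>t. p t * E t)" using iter by blast
    show "foldr partial bs E differentiable at t" unfolding p(2) by (rule step(2)[OF p(1)])
    obtain C n where C: "C \<ge> 0" "\<And>x. norm (p x) \<le> C * (1 + norm x) ^ n"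
      using complex_polynomial_bound[OF p(1)] by blast
    have "norm x ^ k * norm (p x * E x) \<le> C * ((1 + norm a) ^ (k + n) * (fact (k + n) * exp 2))" for x
    proof -
      have "norm x ^ k * norm (p x * E x) \<le> (1 + norm x) ^ k * ((C * (1 + norm x) ^ n) * gaussian (x - a))"
        unfolding E_def norm_mult using C
        by (intro mult_mono power_mono mult_nonneg_nonneg) auto
      also have "\<dots> = C * ((1 + norm x) ^ (k + n) * gaussian (x - a))" by (simp add: power_add)
      also have "\<dots> \<le> C * ((1 + norm a) ^ (k + n) * (fact (k + n) * exp 2))"
        by (intro mult_left_mono power_gaussian_bound C)
      finally show ?thesis .
    qed
    then show "\<exists>B. \<forall>x. norm x ^ k * norm (foldr partial bs E x) \<le> B" unfolding p(2) by blast
  qed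
  then show ?thesis unfolding E_def[abs_def] .
qed

section \<open>Comparison of symbols\<close>

lemma gaussian_L2: "(\<lambda>x. of_real (gaussian x)) \<in> L2"
proof -
  have "integrable lborel (\<lambda>x::'a::euclidean_space. (norm (complex_of_real (gaussian x)))\<^sup>2)"
  proof (rule Bochner_Integration.integrable_bound)
    show "integrable lborel (gaussian :: 'a \<Rightarrow> real)" by (rule integrable_gaussian)
    show "AE x in lborel. norm ((norm (complex_of_real (gaussian (x::'a))))\<^sup>2) \<le> norm (gaussian x)"
      by (intro AE_I2) (simp add: power2_eq_square mult_left_le gaussian_le_1)
  qed simp
  then show ?thesis by (simp add: L2_iff)
qed

lemma AE_gaussian_mult_zero:
  assumes "AE x in lborel. d x * complex_of_real (gaussian x) = 0"
  shows "AE x in lborel. d x = 0"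
  using assms by eventually_elim (simp add: less_imp_neq[OF gaussian_pos, symmetric])

lemma fourier_translated_gaussian:
  "fourier (\<lambda>t. of_real (gaussian (t - x))) \<omega> = chi (- (x \<bullet> \<omega>)) * of_real (gaussian \<omega>)"
  using fourier_modulation_translation[of "\<lambda>t. of_real (gaussian t)" 0 x \<omega>]
  by (simp add: modulation_eq[abs_def] translation_def[abs_def] fourier_gaussian)

text \<open>Testing with modulated Gaussians says that the difference times a Gaussian has vanishing
  transform; \<open>fourier_L1_inj\<close> and positivity of the Gaussian finish. This makes the
  choice in \<open>L1_density\<close> harmless.\<close>

lemma L1_eq_of_distr_eq:
  assumes k: "k \<in> L1" and K: "K \<in> L1" and eq: "distr_eq (distr_of k) (distr_of K)"
  shows "AE x in lborel. k x = K x"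
proof -
  have i: "integrable lborel k" "integrable lborel K" using k K by (simp_all add: L1_def)
  note [measurable] = L1_measurable[OF k] L1_measurable[OF K]
  have bd: "integrable lborel (\<lambda>t. f t * (chi (- (t \<bullet> \<omega>)) * of_real (gaussian t)))"
    if "integrable lborel f" for f \<omega>
    using integrable_mult_bounded[OF that, of "\<lambda>t. chi (- (t \<bullet> \<omega>)) * of_real (gaussian t)" 1]
    by (simp add: norm_mult gaussian_le_1 mult.commute)
  have "integrable lborel (\<lambda>x. (k x - K x) * of_real (gaussian x))"
    using bd[OF i(1), of 0] bd[OF i(2), of 0] by (simp add: left_diff_distrib)
  moreover have "fourier (\<lambda>x. (k x - K x) * of_real (gaussian x)) \<omega> = 0" for \<omega>
  proof -
    let ?\<phi> = "\<lambda>t. chi (- (t \<bullet> \<omega>)) * of_real (gaussian t)"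
    have "?\<phi> \<in> schwartz" using gaussian_schwartz[of \<omega> 0] by simp
    from bspec[OF eq[unfolded distr_eq_def distr_of_def] this]
    have "(LINT t|lborel. k t * ?\<phi> t) = (LINT t|lborel. K t * ?\<phi> t)" .
    then have "(LINT t|lborel. k t * ?\<phi> t - K t * ?\<phi> t) = 0"
      using bd[OF i(1)] bd[OF i(2)] by simp
    then show ?thesis unfolding fourier_eq by (simp add: algebra_simps)
  qed
  ultimately have "AE x in lborel. (k x - K x) * of_real (gaussian x) = 0"
    by (rule fourier_L1_inj)
  then have "AE x in lborel. k x - K x = 0" by (rule AE_gaussian_mult_zero)
  then show ?thesis by simp
qed

text \<open>The multiplication formula for \<open>K\<close> and the inverse transform of the test
  function, which is integrable by the decay estimates and transforms back to the test
  function.\<close>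

lemma distr_inv_fourier_fourier:
  assumes "K \<in> L1"
  shows "distr_eq (distr_of K) (distr_inv_fourier (distr_of (fourier K)))"
  unfolding distr_eq_def distr_inv_fourier_def distr_of_def
proof
  fix \<phi> :: "'a \<Rightarrow> complex" assume \<phi>: "\<phi> \<in> schwartz"
  show "(LINT x|lborel. K x * \<phi> x) = (LINT x|lborel. fourier K x * inv_fourier \<phi> x)"
    using fourier_swap[of K "inv_fourier \<phi>"] schwartz_inversion[OF \<phi>] assms by (simp add: L1_def)
qed

text \<open>\<open>K\<close> itself witnesses the choice, so the selected function agrees with
  \<open>K\<close> almost everywhere; for each fixed x the map y \<mapsto> x - y preserves null
  sets, so the convolutions agree at every point.\<close>

lemma convolution_L1_density:
  assumes [measurable]: "m \<in> borel_measurable borel" and K: "K \<in> L1"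
  shows "Defs.convolution m (L1_density (distr_inv_fourier (distr_of (fourier K)))) = Defs.convolution m K"
    (is "Defs.convolution m ?k = _")
proof (rule ext)
  fix x
  have "?k \<in> L1 \<and> distr_eq (distr_of ?k) (distr_inv_fourier (distr_of (fourier K)))"
    unfolding L1_density_def by (rule someI[of _ K]) (simp add: K distr_inv_fourier_fourier)
  then have k: "?k \<in> L1" and "distr_eq (distr_of ?k) (distr_of K)"
    using distr_inv_fourier_fourier[OF K] by (simp_all add: distr_eq_def)
  from L1_eq_of_distr_eq[OF k K this(2)] have "AE y in lborel. ?k (x + (-1) *\<^sub>R y) = K (x + (-1) *\<^sub>R y)"
    by (intro AE_lborel_isometry) simp_all
  then have ae: "AE y in lborel. m y * ?k (x - y) = m y * K (x - y)"
    by eventually_elim simp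
  note [measurable] = L1_measurable[OF k] L1_measurable[OF K]
  show "Defs.convolution m ?k x = Defs.convolution m K x"
    unfolding Defs.convolution_def by (intro integral_cong_AE[OF _ _ ae]) measurable
qed

text \<open>The correlation at t is the STFT of \<open>g2\<close> with window \<open>g1\<close> at
  (- t, 0), so \<open>stft_eq\<close> gives the formula at every point t.\<close>

lemma window_correlation_eq:
  assumes g1: "v1 \<in> L2_fourier g1" and g2: "v2 \<in> L2_fourier g2"
  shows "window_correlation g1 g2 = fourier (\<lambda>\<xi>. v2 \<xi> * cnj (v1 \<xi>))"
proof
  fix t
  note [measurable] = L2_measurable[OF L2_fourierD(1)[OF g1]] L2_measurable[OF L2_fourierD(1)[OF g2]]
  have "window_correlation g1 g2 t = (LINT y|lborel. g2 y * cnj (g1 (t + y)))"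
    unfolding window_correlation_def Defs.convolution_def
    using integral_lborel_uminus[of "\<lambda>y. g2 y * cnj (g1 (t + y))"] by simp
  also have "\<dots> = stft g1 g2 (- t, 0)"
    by (simp add: stft_def L2_inner_def modulation_eq translation_def add.commute)
  also have "\<dots> = fourier (\<lambda>\<xi>. v2 \<xi> * cnj (v1 \<xi>)) t"
    unfolding stft_eq[OF g2 g1] by (simp add: inv_fourier_minus)
  finally show "window_correlation g1 g2 t = fourier (\<lambda>\<xi>. v2 \<xi> * cnj (v1 \<xi>)) t" .
qed

text \<open>The symbols are only bounded, so injectivity on L^1 cannot be applied to their
  difference directly. A Gaussian weight makes it integrable, and the transform of the weighted
  difference at \<omega> is exactly the test against the Gaussian translated by \<omega>.\<close>

lemma fourier_times_eq_iff:
  assumes m: "m \<in> Linf" and K: "K \<in> L1"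
  shows "distr_eq (fourier_times m (fourier K)) (distr_fourier (distr_of m))
    \<longleftrightarrow> (AE x in lborel. Defs.convolution m K x = m x)"
proof -
  obtain B where B: "AE x in lborel. norm (m x) \<le> B" and mm[measurable]: "m \<in> borel_measurable borel"
    using m by (auto simp: Linf_def)
  define M where "M = Defs.convolution m K"
  have "M \<in> Linf" unfolding M_def using m K by (intro convolution_Linf) (simp_all add: L1_def)
  then obtain C where C: "AE x in lborel. norm (M x) \<le> C" and Mm[measurable]: "M \<in> borel_measurable borel"
    by (auto simp: Linf_def)
  have eq: "distr_eq (fourier_times m (fourier K)) (distr_fourier (distr_of m))
      \<longleftrightarrow> (\<forall>\<phi>\<in>schwartz. (LINT x|lborel. M x * fourier \<phi> x) = (LINT x|lborel. m x * fourier \<phi> x))"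
    unfolding fourier_times_def convolution_L1_density[OF mm K] distr_eq_def distr_fourier_def distr_of_def M_def ..
  have "(\<forall>\<phi>\<in>schwartz. (LINT x|lborel. M x * fourier \<phi> x) = (LINT x|lborel. m x * fourier \<phi> x))
    \<longleftrightarrow> (AE x in lborel. M x = m x)"
  proof
    assume ae: "AE x in lborel. M x = m x"
    show "\<forall>\<phi>\<in>schwartz. (LINT x|lborel. M x * fourier \<phi> x) = (LINT x|lborel. m x * fourier \<phi> x)"
    proof
      fix \<phi> :: "'a \<Rightarrow> complex" assume "\<phi> \<in> schwartz"
      note [measurable] = schwartz_measurable[OF this]
      show "(LINT x|lborel. M x * fourier \<phi> x) = (LINT x|lborel. m x * fourier \<phi> x)"
      proof (rule integral_cong_AE)
        show "AE x in lborel. M x * fourier \<phi> x = m x * fourier \<phi> x" using ae by eventually_elim simp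
      qed measurable
    qed
  next
    assume D: "\<forall>\<phi>\<in>schwartz. (LINT x|lborel. M x * fourier \<phi> x) = (LINT x|lborel. m x * fourier \<phi> x)"
    have ig: "integrable lborel (\<lambda>x::'a. chi (- (\<omega> \<bullet> x)) * complex_of_real (gaussian x))" for \<omega>
      by (rule integrable_chi_mult) (auto intro!: integrable_of_real)
    have im: "integrable lborel (\<lambda>x. m x * (chi (- (\<omega> \<bullet> x)) * of_real (gaussian x)))"
      and iM: "integrable lborel (\<lambda>x. M x * (chi (- (\<omega> \<bullet> x)) * of_real (gaussian x)))" for \<omega>
      by (rule integrable_mult_bounded[OF ig mm B], rule integrable_mult_bounded[OF ig Mm C])
    have "integrable lborel (\<lambda>x. (M x - m x) * of_real (gaussian x))"
      using im[of 0] iM[of 0] by (simp add: left_diff_distrib)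
    moreover have "fourier (\<lambda>x. (M x - m x) * of_real (gaussian x)) \<omega> = 0" for \<omega>
    proof -
      have "(\<lambda>t. of_real (gaussian (t - \<omega>))) \<in> schwartz" using gaussian_schwartz[of 0 \<omega>] by simp
      with D have "(LINT x|lborel. M x * (chi (- (\<omega> \<bullet> x)) * of_real (gaussian x)))
          = (LINT x|lborel. m x * (chi (- (\<omega> \<bullet> x)) * of_real (gaussian x)))"
        unfolding fourier_translated_gaussian[symmetric] by blast
      then have "(LINT x|lborel. M x * (chi (- (\<omega> \<bullet> x)) * of_real (gaussian x)) - m x * (chi (- (\<omega> \<bullet> x)) * of_real (gaussian x))) = 0"
        using im iM by simp
      then show ?thesis unfolding fourier_eq by (simp add: algebra_simps inner_commute)
    qed
    ultimately have "AE x in lborel. (M x - m x) * of_real (gaussian x) = 0"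
      by (rule fourier_L1_inj)
    then have "AE x in lborel. M x - m x = 0" by (rule AE_gaussian_mult_zero)
    then show "AE x in lborel. M x = m x" by simp
  qed
  with eq show ?thesis unfolding M_def by simp
qed

lemma L2_inv_fourier_inj:
  assumes "r \<in> L2_inv_fourier w" "r \<in> L2_inv_fourier w'" "w \<in> L2" "w' \<in> L2"
  shows "AE x in lborel. w x = w' x"
proof -
  have "(\<lambda>x. 1 * r x + (- 1) * r x) \<in> L2_fourier (\<lambda>x. 1 * w (- x) + (- 1) * w' (- x))"
    using assms(1,2) unfolding L2_inv_fourier_eq_reflect by (rule L2_fourier_linear)
  from L2_fourierD(3)[OF this] have "L2_norm (\<lambda>x. w (- x) - w' (- x)) = 0"
    by (simp add: L2_norm_def)
  then have "L2_norm (\<lambda>x. w x - w' x) = 0"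
    using L2_norm_reflect[OF L2_diff[OF assms(3,4)]] by simp
  then show ?thesis using L2_norm_eq_0_iff[OF L2_diff[OF assms(3,4)]] by simp
qed

lemma fourier_multiplier_eq_iff:
  fixes m m' :: "'a::euclidean_space \<Rightarrow> complex"
  assumes m: "m \<in> Linf" and m': "m' \<in> Linf"
  shows "(\<forall>f\<in>L2. fourier_multiplier m f = fourier_multiplier m' f) \<longleftrightarrow> (AE x in lborel. m x = m' x)"
proof
  assume ae: "AE x in lborel. m x = m' x"
  show "\<forall>f\<in>L2. fourier_multiplier m f = fourier_multiplier m' f"
  proof
    fix f :: "'a \<Rightarrow> complex" assume "f \<in> L2"
    then obtain u where u: "u \<in> L2_fourier f" using L2_fourier_exists by blast
    note u2 = L2_fourierD(2)[OF u]
    have "AE x in lborel. m x * u x = m' x * u x" using ae by eventually_elim simp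
    then show "fourier_multiplier m f = fourier_multiplier m' f"
      unfolding fourier_multiplier_eq[OF m u] fourier_multiplier_eq[OF m' u]
      by (rule L2_inv_fourier_cong_AE) (intro Linf_mult_L2 m m' u2)+
  qed
next
  assume eq: "\<forall>f\<in>L2. fourier_multiplier m f = fourier_multiplier m' f"
  \<comment> \<open>One test function suffices: the Gaussian has a Fourier transform without zeros.\<close>
  let ?g = "\<lambda>x::'a. complex_of_real (gaussian x)"
  have "fourier ?g \<in> L2_fourier ?g"
    by (intro L2_fourier_L1_L2 gaussian_L2 integrable_of_real integrable_gaussian)
  then have u: "?g \<in> L2_fourier ?g" using fourier_gaussian by (metis (no_types, lifting) ext)
  note w = Linf_mult_L2[OF m gaussian_L2] Linf_mult_L2[OF m' gaussian_L2]
  obtain r where r: "r \<in> L2_inv_fourier (\<lambda>x. m x * ?g x)" using L2_inv_fourier_exists[OF w(1)] .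
  moreover have "L2_inv_fourier (\<lambda>x. m x * ?g x) = L2_inv_fourier (\<lambda>x. m' x * ?g x)"
    using eq gaussian_L2 unfolding fourier_multiplier_eq[OF m u, symmetric] fourier_multiplier_eq[OF m' u, symmetric] by blast
  ultimately have "AE x in lborel. m x * ?g x = m' x * ?g x"
    by (intro L2_inv_fourier_inj[OF r _ w]) simp
  then have "AE x in lborel. (m x - m' x) * ?g x = 0" by eventually_elim (simp add: left_diff_distrib)
  then have "AE x in lborel. m x - m' x = 0" by (rule AE_gaussian_mult_zero)
  then show "AE x in lborel. m x = m' x" by simp
qed

lemma convolution_character:
  assumes K: "K \<in> L1"
  shows "Defs.convolution (\<lambda>y. chi (t \<bullet> y)) K x = chi (t \<bullet> x) * fourier K t"
proof -
  note [measurable] = L1_measurable[OF K]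
  have "Defs.convolution (\<lambda>y. chi (t \<bullet> y)) K x = (LINT y|lborel. chi (t \<bullet> (x - y)) * K y)"
    unfolding Defs.convolution_def
    using integral_lborel_reflect[of "\<lambda>y. chi (t \<bullet> (x - y)) * K y" x] by simp
  also have "\<dots> = (LINT y|lborel. chi (t \<bullet> x) * (chi (- (y \<bullet> t)) * K y))"
    by (simp add: inner_diff_right chi_diff inner_commute mult.assoc)
  also have "\<dots> = chi (t \<bullet> x) * fourier K t"
    unfolding fourier_eq by (rule integral_mult_right_zero)
  finally show ?thesis .
qed

text \<open>A constant transform belongs to a point mass at 0, whereas an integrable function
  carries no mass at a single point.\<close>

lemma fourier_L1_not_const_1:
  fixes K :: "'a::euclidean_space \<Rightarrow> complex"
  assumes K: "K \<in> L1"
  shows "\<not> (\<forall>t. fourier K t = 1)"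
proof
  assume 1: "\<forall>t. fourier K t = 1"
  have i: "integrable lborel K" using K by (simp add: L1_def)
  note [measurable] = L1_measurable[OF K]
  \<comment> \<open>The multiplication formula turns the average of the constant transform against a
    wide Gaussian into an integral of \<open>K\<close> against a narrow one; the normalising powers
    of the scale cancel.\<close>
  have avg: "(LINT y|lborel. K y * of_real (gaussian (real (Suc n) *\<^sub>R y))) = 1" for n
  proof -
    define s where "s = inverse (real (Suc n))"
    have s: "s > 0" by (simp add: s_def)
    let ?g = "\<lambda>\<omega>::'a. chi (\<omega> \<bullet> 0) * complex_of_real (gaussian (s *\<^sub>R \<omega>))"
    have g: "integrable lborel ?g" using s by (auto intro!: integrable_of_real integrable_gaussian_scale)
    have F: "fourier ?g y = of_real (gaussian (real (Suc n) *\<^sub>R y)) / s ^ DIM('a)" for y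
      using fourier_gaussian_scale[OF s, of 0 "real (Suc n) *\<^sub>R y"] by (simp add: s_def del: of_nat_Suc)
    have "1 / s ^ DIM('a) = fourier ?g 0" unfolding F by (simp add: gaussian_def)
    also have "\<dots> = (LINT \<omega>|lborel. fourier K \<omega> * ?g \<omega>)"
      unfolding fourier_eq[of ?g] using 1 by simp
    also have "\<dots> = (LINT y|lborel. K y * fourier ?g y)" by (rule fourier_swap[OF i g])
    also have "\<dots> = (LINT y|lborel. K y * of_real (gaussian (real (Suc n) *\<^sub>R y))) / s ^ DIM('a)"
      unfolding F by (simp del: of_nat_Suc)
    finally show ?thesis using s by simp
  qed
  have "(\<lambda>n. LINT y|lborel. K y * of_real (gaussian (real (Suc n) *\<^sub>R y))) \<longlonglongrightarrow> (LINT y|(lborel::'a measure). 0)"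
  proof (rule integral_dominated_convergence[where w="\<lambda>y. norm (K y)"])
    show "AE y in lborel. (\<lambda>n. K y * of_real (gaussian (real (Suc n) *\<^sub>R y))) \<longlonglongrightarrow> 0"
      using AE_lborel_singleton[of 0]
    proof eventually_elim
      case (elim y)
      have "(\<lambda>n. gaussian (real (Suc n) *\<^sub>R y)) \<longlonglongrightarrow> 0"
      proof (rule tendsto_sandwich[OF always_eventually always_eventually tendsto_const])
        have "gaussian y < 1" using elim by (simp add: gaussian_def)
        then show "(\<lambda>n. gaussian y ^ Suc n) \<longlonglongrightarrow> 0"
          by (intro LIMSEQ_Suc LIMSEQ_power_zero) simp
        \<comment> \<open>Since (n+1)^2 \<ge> n+1, the narrow Gaussians are dominated by a geometric
          sequence, whose ratio is below 1 away from the origin.\<close>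
        show "\<forall>n. gaussian (real (Suc n) *\<^sub>R y) \<le> gaussian y ^ Suc n"
        proof
          fix n
          have "real (Suc n) * (pi * (norm y)\<^sup>2) \<le> (real (Suc n))\<^sup>2 * (pi * (norm y)\<^sup>2)"
            by (intro mult_right_mono) (simp_all add: power2_eq_square)
          then show "gaussian (real (Suc n) *\<^sub>R y) \<le> gaussian y ^ Suc n"
            unfolding gaussian_def exp_of_nat_mult[symmetric]
            by (simp add: power_mult_distrib algebra_simps del: of_nat_Suc)
        qed
      qed simp
      from tendsto_mult[OF tendsto_const[of "K y"] tendsto_of_real[OF this]]
      show ?case by simp
    qed
    show "AE y in lborel. norm (K y * of_real (gaussian (real (Suc n) *\<^sub>R y))) \<le> norm (K y)" for n
      by (intro AE_I2) (simp add: norm_mult mult_left_le gaussian_le_1)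
    show "integrable lborel (\<lambda>y. norm (K y))" using i by simp
  qed measurable
  then show False unfolding avg using LIMSEQ_unique[OF tendsto_const] by fastforce
qed

theorem theorem4p7:
  fixes g1 g2 :: "real ^ 'd \<Rightarrow> complex"
  assumes "g1 \<in> L2" and "g2 \<in> L2"
  shows "(\<forall>m\<in>Linf.
            bounded_linear_operator_L2 (fourier_multiplier m) \<and>
            bounded_linear_operator_L2 (stft_multiplier g1 g2 (one_tensor m)) \<and>
            ((\<forall>f\<in>L2. stft_multiplier g1 g2 (one_tensor m) f = fourier_multiplier m f) \<longleftrightarrow>
              distr_eq (fourier_times m (window_correlation g1 g2)) (distr_fourier (distr_of m)))) \<and>
         ((\<forall>m\<in>Linf. distr_eq (fourier_times m (window_correlation g1 g2))
                               (distr_fourier (distr_of m))) \<longrightarrow>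
            (\<forall>t. window_correlation g1 g2 t = 1)) \<and>
         \<not> (\<forall>t. window_correlation g1 g2 t = 1)"
proof -
  obtain v1 where v1: "v1 \<in> L2_fourier g1" using L2_fourier_exists[OF assms(1)] .
  obtain v2 where v2: "v2 \<in> L2_fourier g2" using L2_fourier_exists[OF assms(2)] .
  define K where "K = (\<lambda>\<xi>. v2 \<xi> * cnj (v1 \<xi>))"
  have K: "K \<in> L1"
    unfolding K_def L1_def mem_Collect_eq
    by (intro L2_mult_integrable L2_cnj L2_fourierD(2)[OF v1] L2_fourierD(2)[OF v2])
  have C: "window_correlation g1 g2 = fourier K"
    unfolding K_def by (rule window_correlation_eq[OF v1 v2])
  have A: "stft_multiplier g1 g2 (one_tensor m) f = fourier_multiplier (Defs.convolution m K) f"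
    if "m \<in> Linf" "f \<in> L2" for m f
    unfolding K_def by (rule stft_multiplier_eq_fourier_multiplier[OF that(1) v1 v2 that(2)])
  have M: "Defs.convolution m K \<in> Linf" if "m \<in> Linf" for m
    using convolution_Linf[OF that] K by (simp add: L1_def)
  show ?thesis
  proof (intro conjI ballI impI allI)
    fix m :: "real ^ 'd \<Rightarrow> complex" assume m: "m \<in> Linf"
    show "bounded_linear_operator_L2 (fourier_multiplier m)"
      by (rule fourier_multiplier_bounded_linear[OF m])
    show "bounded_linear_operator_L2 (stft_multiplier g1 g2 (one_tensor m))"
      \<comment> \<open>\<open>A\<close> identifies the operators on L^2 only, which is enough
        because boundedness and linearity concern L^2 arguments alone.\<close>
      by (rule bounded_linear_operator_L2_cong[OF A[OF m] fourier_multiplier_bounded_linear[OF M[OF m]]])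
    show "(\<forall>f\<in>L2. stft_multiplier g1 g2 (one_tensor m) f = fourier_multiplier m f) \<longleftrightarrow>
        distr_eq (fourier_times m (window_correlation g1 g2)) (distr_fourier (distr_of m))"
      \<comment> \<open>Both sides become the same condition: the convolution of \<open>m\<close>
        with \<open>K\<close> equals \<open>m\<close> almost everywhere.\<close>
      unfolding C fourier_times_eq_iff[OF m K] using A[OF m] fourier_multiplier_eq_iff[OF M[OF m] m] by simp
  next
    fix t :: "real ^ 'd"
    assume all: "\<forall>m\<in>Linf. distr_eq (fourier_times m (window_correlation g1 g2)) (distr_fourier (distr_of m))"
    have "(\<lambda>y. chi (t \<bullet> y)) \<in> Linf"
      unfolding Linf_def by (auto intro!: exI[of _ 1])
    with all have "AE x in lborel. chi (t \<bullet> x) * fourier K t = chi (t \<bullet> x)"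
      unfolding C using fourier_times_eq_iff[OF _ K] convolution_character[OF K] by fastforce
    \<comment> \<open>The factor \<open>fourier K t\<close> does not depend on x, so a single point
      where the identity holds determines it after cancelling the unimodular character.\<close>
    from AE_lborel_ex[OF this] obtain x where "chi (t \<bullet> x) * fourier K t = chi (t \<bullet> x)" ..
    moreover have "chi (t \<bullet> x) \<noteq> 0" using norm_chi[of "t \<bullet> x"] by force
    ultimately show "window_correlation g1 g2 t = 1" unfolding C by simp
  next
    show "\<not> (\<forall>t. window_correlation g1 g2 t = 1)"
      unfolding C by (rule fourier_L1_not_const_1[OF K])
  qed
qed

end
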